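(* Let $M$ be a compact connected oriented Riemannian manifold, $F\to M$ a $C^\infty$ Hermitian vector bundle with sheaf of sections $\mathscr F$, $\nabla$ an integrable (flat) connection on $F$ compatible with the Hermitian structure, and $E\in{\mathscr A}^1({\mathfrak u}(F))$ an ${\mathfrak u}(F)$-valued $1$-form. Let $\mathcal E:{\mathscr F}\to{\mathscr A}^1\otimes_{\mathscr A}{\mathscr F}$ be the morphism determined by $E$. Then $\hat\nabla=\nabla+{\mathcal E}$ is a Yang-Mills connection if and only if $$\delta(\nabla(E))+\delta(E\wedge E)+E^{\dagger}(\nabla(E))+E^{\dagger}(E\wedge E)=0.$$
   Context: ${\mathscr A}$ is the sheaf of differentiable functions on $M$, ${\mathscr R}$ the sheaf of real-valued $C^\infty$ functions, ${\mathscr A}^k$ the sheaf of differential $k$-forms (real-valued when tensored over ${\mathscr R}$). ${\mathfrak u}({\mathscr F})$ is the sheaf of antihermitian endomorphisms of $F$, and ${\mathscr A}^k({\mathfrak u}(F)):=\Gamma(M,{\mathscr A}^k\otimes_{\mathscr R}{\mathfrak u}({\mathscr F}))$. If locally $E=\sum_a\eta_a\otimes e_a$, then ${\mathcal E}(\sigma)=\sum_a\eta_a\otimes e_a(\sigma)$ and $E\wedge E:=\sum_{a,b}(\eta_a\wedge\eta_b)\otimes(e_a\circ e_b)$. A connection $\nabla$ is compatible with the Hermitian structure (Hermitian) if $\langle\nabla\sigma,\tau\rangle+\langle\sigma,\nabla\tau\rangle=d\langle\sigma,\tau\rangle$. It induces operators $\nabla:{\mathscr A}^k({\mathfrak u}(F))\to{\mathscr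 A}^{k+1}({\mathfrak u}(F))$, $\nabla(\beta\otimes h)=d\beta\otimes h+(-1)^k\beta\wedge(\nabla\circ h-h\circ\nabla)$. Its curvature $K_\nabla\in{\mathscr A}^2({\mathfrak u}(F))$ corresponds to $\nabla^1\circ\nabla$, where $\nabla^1(\beta\otimes\sigma)=d\beta\otimes\sigma-\beta\wedge\nabla\sigma$; $\nabla$ is integrable (flat) if $K_\nabla=0$. The Hermitian metric on $F$ induces a metric $\langle\cdot,\cdot\rangle$ on ${\mathfrak u}(F)$ satisfying $\langle[c,a],b\rangle+\langle a,[c,b]\rangle=0$. On ${\mathscr A}^k({\mathfrak u}(F))$ one has the product $\langle\langle\xi\otimes\sigma,\xi'\otimes\sigma'\rangle\rangle=\int_M(\xi\wedge\star\xi')\langle\sigma,\sigma'\rangle$, with norm $\|\cdot\|$. The Yang-Mills functional on Hermitian connections is ${\sf YM}(\nabla)=\|K_\nabla\|^2$; a Yang-Mills connection (field) is a Hermitian connection $\nabla$ at which ${\sf YM}$ is stationary, i.e. $\frac{d}{d\epsilon}\big|_{\epsilon=0}\|K_{\nabla+\epsilon{\mathcal B}}\|^2=0$ for all $B\in{\mathscr A}^1({\mathfrak u}(F))$, where ${\mathcal B}$ is the morphism determined by $B$. $\delta:{\mathscr A}^2({\mathfrak u}(F))\to{\mathscr A}^1({\mathfrak u}(F))$ is the formal adjoint, with respect to $\langle\langle\cdot,\cdot\rangle\rangle$, of $\nabla:{\mathscr A}^1({\mathfrak u}(F))\to{\mathscr A}^2({\mathfrak u}(F))$. For a $1$-form $\eta$,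 $\eta^\natural$ is the vector field dual to $\eta$ under the Riemannian metric and $\iota$ denotes the interior product. $E^\dagger:{\mathscr A}^2({\mathfrak u}(F))\to{\mathscr A}^1({\mathfrak u}(F))$ is given, for $E=\eta\otimes e$, by $E^\dagger(\gamma\otimes c)=\iota_{\eta^\natural}(\gamma)\otimes[c,e]$, and is extended additively in $E$ (local sums $E=\sum_a\eta_a\otimes e_a$). *)

theory Defs
  imports "HOL-Analysis.Analysis" "HOL-Library.Function_Algebras"
begin

section \<open>Oriented Riemannian manifolds\<close>

text \<open>
  The underlying space of the manifold is a whole Hausdorff type \<open>'m\<close>; \<open>charts\<close> is an atlas of
  pairs (domain, coordinate map).  A tangent vector at \<open>p\<close> is a directional derivative acting on the
  real functions that are smooth near \<open>p\<close> (and, by convention, yields \<open>0\<close> on all other functions).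
\<close>

type_synonym 'm tvec = "('m \<Rightarrow> real) \<Rightarrow> real"
type_synonym 'm form1 = "'m \<Rightarrow> 'm tvec \<Rightarrow> real"

record ('m, 'n) rmfd =
  charts :: "('m set \<times> ('m \<Rightarrow> real ^ 'n::finite)) set"
  metric :: "'m \<Rightarrow> 'm tvec \<Rightarrow> 'm tvec \<Rightarrow> real"

primrec Ck_on :: "nat \<Rightarrow> 'a::real_normed_vector set \<Rightarrow> ('a \<Rightarrow> 'b::real_normed_vector) \<Rightarrow> bool" where
  "Ck_on 0 S f \<longleftrightarrow> continuous_on S f"
| "Ck_on (Suc k) S f \<longleftrightarrow> (\<forall>x\<in>S. f differentiable (at x)) \<and>
     (\<forall>v. Ck_on k S (\<lambda>x. frechet_derivative f (at x) v))"

definition smooth_on :: "'a::real_normed_vector set \<Rightarrow> ('a \<Rightarrow> 'b::real_normed_vector) \<Rightarrow> bool" where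
  "smooth_on S f \<longleftrightarrow> (\<forall>k. Ck_on k S f)"

definition oriented_atlas :: "('m::topological_space set \<times> ('m \<Rightarrow> real ^ 'n::finite)) set \<Rightarrow> bool" where
  "oriented_atlas A \<longleftrightarrow>
     (\<Union>c\<in>A. fst c) = UNIV \<and>
     (\<forall>(W, \<phi>)\<in>A. open W \<and> open (\<phi> ` W) \<and> homeomorphism W (\<phi> ` W) \<phi> (inv_into W \<phi>)) \<and>
     (\<forall>(W, \<phi>)\<in>A. \<forall>(W', \<phi>')\<in>A.
        smooth_on (\<phi> ` (W \<inter> W')) (\<phi>' \<circ> inv_into W \<phi>) \<and>
        (\<forall>x\<in>\<phi> ` (W \<inter> W').
           det (matrix (frechet_derivative (\<phi>' \<circ> inv_into W \<phi>) (at x))) > 0))"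

definition smooth_fun ::
  "('m, 'n::finite) rmfd \<Rightarrow> 'm set \<Rightarrow> ('m \<Rightarrow> 'b::real_normed_vector) \<Rightarrow> bool" where
  "smooth_fun M U f \<longleftrightarrow>
     (\<forall>(W, \<phi>)\<in>charts M. smooth_on (\<phi> ` (U \<inter> W)) (f \<circ> inv_into W \<phi>))"

text \<open>\<open>coord_vec M (W, \<phi>) v p\<close> is the value at \<open>p\<close> of the coordinate vector field of the chart
  \<open>(W, \<phi>)\<close> with constant components \<open>v\<close>.\<close>

definition coord_vec :: "('m::topological_space, 'n::finite) rmfd \<Rightarrow>
    'm set \<times> ('m \<Rightarrow> real ^ 'n) \<Rightarrow> real ^ 'n \<Rightarrow> 'm \<Rightarrow> 'm tvec" where
  "coord_vec M c v p = (\<lambda>f.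
     if \<exists>U. open U \<and> p \<in> U \<and> smooth_fun M U f
     then frechet_derivative (f \<circ> inv_into (fst c) (snd c)) (at (snd c p)) v else 0)"

definition tspace :: "('m::topological_space, 'n::finite) rmfd \<Rightarrow> 'm \<Rightarrow> 'm tvec set" where
  "tspace M p = {coord_vec M c v p | c v. c \<in> charts M \<and> p \<in> fst c}"

definition tscale :: "real \<Rightarrow> 'm tvec \<Rightarrow> 'm tvec" where
  "tscale r X = (\<lambda>f. r * X f)"

definition covector :: "('m::topological_space, 'n::finite) rmfd \<Rightarrow> 'm \<Rightarrow> ('m tvec \<Rightarrow> real) \<Rightarrow> bool" where
  "covector M p \<eta> \<longleftrightarrow> (\<forall>X\<in>tspace M p. \<forall>Y\<in>tspace M p. \<eta> (X + Y) = \<eta> X + \<eta> Y) \<and>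
     (\<forall>X\<in>tspace M p. \<forall>r. \<eta> (tscale r X) = r * \<eta> X)"

definition oriented_riemannian_manifold :: "('m::t2_space, 'n::finite) rmfd \<Rightarrow> bool" where
  "oriented_riemannian_manifold M \<longleftrightarrow>
     oriented_atlas (charts M) \<and>
     (\<forall>p. \<forall>X\<in>tspace M p. covector M p (metric M p X)) \<and>
     (\<forall>p. \<forall>X\<in>tspace M p. \<forall>Y\<in>tspace M p. metric M p X Y = metric M p Y X) \<and>
     (\<forall>p. \<forall>X\<in>tspace M p. X \<noteq> 0 \<longrightarrow> metric M p X X > 0) \<and>
     (\<forall>c\<in>charts M. \<forall>v w.
        smooth_fun M (fst c) (\<lambda>p. metric M p (coord_vec M c v p) (coord_vec M c w p)))"

definition sharp :: "('m::topological_space, 'n::finite) rmfd \<Rightarrow> 'm \<Rightarrow> ('m tvec \<Rightarrow> real) \<Rightarrow> 'm tvec" where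
  "sharp M p \<eta> = (THE X. X \<in> tspace M p \<and> (\<forall>Y\<in>tspace M p. metric M p X Y = \<eta> Y))"

definition orthonormal_basis ::
  "('m::topological_space, 'n::finite) rmfd \<Rightarrow> 'm \<Rightarrow> ('n \<Rightarrow> 'm tvec) \<Rightarrow> bool" where
  "orthonormal_basis M p b \<longleftrightarrow> (\<forall>i. b i \<in> tspace M p) \<and>
     (\<forall>i j. metric M p (b i) (b j) = (if i = j then 1 else 0))"

text \<open>Integration of \<open>f vol\<close>, where \<open>vol\<close> is the Riemannian volume form, i.e.
  \<open>sqrt (det g) dx\<^sub>1 \<dots> dx\<^sub>n\<close> in every (positively oriented) chart of the atlas.  The compact manifold
  is cut into finitely many disjoint Borel pieces whose closures lie in chart domains; by the
  change of variables formula the integral does not depend on the chosen pieces and charts.\<close>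

definition subordinate :: "('m::topological_space, 'n::finite) rmfd \<Rightarrow>
    nat \<times> (nat \<Rightarrow> 'm set \<times> ('m \<Rightarrow> real ^ 'n)) \<times> (nat \<Rightarrow> 'm set) \<Rightarrow> bool" where
  "subordinate M = (\<lambda>(m, c, A).
     (\<forall>k<m. c k \<in> charts M \<and> A k \<in> sets borel \<and> closure (A k) \<subseteq> fst (c k)) \<and>
     disjoint_family_on A {..<m} \<and> (\<Union>k<m. A k) = UNIV)"

definition gram :: "('m::topological_space, 'n::finite) rmfd \<Rightarrow>
    'm set \<times> ('m \<Rightarrow> real ^ 'n) \<Rightarrow> 'm \<Rightarrow> real ^ 'n ^ 'n" where
  "gram M c p = (\<chi> i j. metric M p (coord_vec M c (axis i 1) p) (coord_vec M c (axis j 1) p))"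

definition vol_integral :: "('m::topological_space, 'n::finite) rmfd \<Rightarrow> ('m \<Rightarrow> real) \<Rightarrow> real" where
  "vol_integral M f = (case (SOME d. subordinate M d) of (m, c, A) \<Rightarrow>
     \<Sum>k<m. set_lebesgue_integral lborel (snd (c k) ` A k)
       (\<lambda>x. let p = inv_into (fst (c k)) (snd (c k)) x in f p * sqrt (det (gram M (c k) p))))"

definition real_form1 :: "('m::topological_space, 'n::finite) rmfd \<Rightarrow> 'm set \<Rightarrow> 'm form1 set" where
  "real_form1 M U = {\<beta>. (\<forall>p\<in>U. covector M p (\<beta> p)) \<and>
     (\<forall>c\<in>charts M. \<forall>v. smooth_fun M (U \<inter> fst c) (\<lambda>p. \<beta> p (coord_vec M c v p)))}"

text \<open>The exterior derivative of a real \<open>1\<close>-form: \<open>d\<beta> = \<Sum> df\<^sub>a \<and> dg\<^sub>a\<close> whenever \<open>\<beta> = \<Sum> f\<^sub>a dg\<^sub>a\<close> locally.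
  Here and below wedge products of \<open>1\<close>-forms are normalised by
  \<open>(\<alpha> \<and> \<beta>)(X, Y) = \<alpha> X * \<beta> Y - \<alpha> Y * \<beta> X\<close>.\<close>

definition ext_d :: "('m::topological_space, 'n::finite) rmfd \<Rightarrow> 'm form1 \<Rightarrow>
    'm \<Rightarrow> 'm tvec \<Rightarrow> 'm tvec \<Rightarrow> real" where
  "ext_d M \<beta> p X Y = (THE r. \<exists>U (N::nat) f g. open U \<and> p \<in> U \<and>
     (\<forall>a<N. smooth_fun M U (f a :: 'm \<Rightarrow> real) \<and> smooth_fun M U (g a :: 'm \<Rightarrow> real)) \<and>
     (\<forall>q\<in>U. \<forall>Z\<in>tspace M q. \<beta> q Z = (\<Sum>a<N. f a q * Z (g a))) \<and>
     r = (\<Sum>a<N. X (f a) * Y (g a) - Y (f a) * X (g a)))"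

definition cderiv :: "'m tvec \<Rightarrow> ('m \<Rightarrow> complex) \<Rightarrow> complex" where
  "cderiv X f = Complex (X (\<lambda>q. Re (f q))) (X (\<lambda>q. Im (f q)))"

section \<open>Hermitian vector bundles\<close>

text \<open>
  The fibres \<open>fibre F p\<close> are complex subspaces of one complex vector space \<open>'v\<close> (scalar
  multiplication \<open>scl F\<close>); this is no restriction, as the direct sum of all fibres of a bundle can
  serve as \<open>'v\<close>, and no topology of \<open>'v\<close> is involved.  The smooth structure is given by local frames
  \<open>(W, e)\<close>, where \<open>e 0, \<dots>, e (rank F - 1)\<close> trivialise the bundle over \<open>W\<close>.
\<close>

record ('m, 'v) hbundle =
  scl :: "complex \<Rightarrow> 'v \<Rightarrow> 'v"
  fibre :: "'m \<Rightarrow> 'v set"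
  rank :: nat
  frames :: "('m set \<times> (nat \<Rightarrow> 'm \<Rightarrow> 'v)) set"
  herm :: "'m \<Rightarrow> 'v \<Rightarrow> 'v \<Rightarrow> complex"

abbreviation rscl :: "('m, 'v) hbundle \<Rightarrow> real \<Rightarrow> 'v \<Rightarrow> 'v" where
  "rscl F r v \<equiv> scl F (complex_of_real r) v"

definition sections :: "('m, 'n::finite) rmfd \<Rightarrow> ('m, 'v::ab_group_add) hbundle \<Rightarrow>
    'm set \<Rightarrow> ('m \<Rightarrow> 'v) set" where
  "sections M F U = {\<sigma>. (\<forall>p\<in>U. \<sigma> p \<in> fibre F p) \<and>
     (\<forall>(W, e)\<in>frames F. \<exists>c. (\<forall>k<rank F. smooth_fun M (U \<inter> W) (c k :: 'm \<Rightarrow> complex)) \<and>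
        (\<forall>p\<in>U \<inter> W. \<sigma> p = (\<Sum>k<rank F. scl F (c k p) (e k p))))}"

definition hermitian_bundle ::
  "('m::t2_space, 'n::finite) rmfd \<Rightarrow> ('m, 'v::ab_group_add) hbundle \<Rightarrow> bool" where
  "hermitian_bundle M F \<longleftrightarrow>
     vector_space (scl F) \<and>
     (\<forall>p. module.subspace (scl F) (fibre F p)) \<and>
     (\<Union>t\<in>frames F. fst t) = UNIV \<and>
     (\<forall>(W, e)\<in>frames F. open W \<and> (\<forall>k<rank F. e k \<in> sections M F W) \<and>
        (\<forall>p\<in>W. \<forall>v\<in>fibre F p. \<exists>!c. (\<forall>k\<ge>rank F. c k = 0) \<and>
           v = (\<Sum>k<rank F. scl F (c k) (e k p)))) \<and>
     (\<forall>p. \<forall>v\<in>fibre F p. \<forall>w\<in>fibre F p.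
        (\<forall>u\<in>fibre F p. herm F p (v + w) u = herm F p v u + herm F p w u) \<and>
        (\<forall>z. herm F p (scl F z v) w = z * herm F p v w) \<and>
        herm F p w v = cnj (herm F p v w)) \<and>
     (\<forall>p. \<forall>v\<in>fibre F p. v \<noteq> 0 \<longrightarrow> Re (herm F p v v) > 0) \<and>
     (\<forall>U. open U \<longrightarrow> (\<forall>\<sigma>\<in>sections M F U. \<forall>\<tau>\<in>sections M F U.
        smooth_fun M U (\<lambda>p. herm F p (\<sigma> p) (\<tau> p))))"

text \<open>An element of \<open>A\<^sup>1 \<otimes> F\<close> over \<open>U\<close> is a smooth family of real-linear maps \<open>T\<^sub>p M \<rightarrow> F\<^sub>p\<close>.\<close>

definition bundle_form1 :: "('m::topological_space, 'n::finite) rmfd \<Rightarrow>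
    ('m, 'v::ab_group_add) hbundle \<Rightarrow> 'm set \<Rightarrow> ('m \<Rightarrow> 'm tvec \<Rightarrow> 'v) set" where
  "bundle_form1 M F U = {\<omega>.
     (\<forall>p\<in>U. \<forall>X\<in>tspace M p. \<omega> p X \<in> fibre F p \<and>
        (\<forall>Y\<in>tspace M p. \<omega> p (X + Y) = \<omega> p X + \<omega> p Y) \<and>
        (\<forall>r. \<omega> p (tscale r X) = rscl F r (\<omega> p X))) \<and>
     (\<forall>c\<in>charts M. \<forall>v. (\<lambda>p. \<omega> p (coord_vec M c v p)) \<in> sections M F (U \<inter> fst c))}"

text \<open>
  Antihermitian endomorphisms of a fibre, and forms with values in them, are extended by \<open>0\<close> off the
  fibres and off the tangent spaces, so that equality of forms is equality of functions.
\<close>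

definition u_fibre :: "('m, 'v::ab_group_add) hbundle \<Rightarrow> 'm \<Rightarrow> ('v \<Rightarrow> 'v) set" where
  "u_fibre F p = {a.
     (\<forall>v\<in>fibre F p. a v \<in> fibre F p \<and> (\<forall>w\<in>fibre F p. a (v + w) = a v + a w) \<and>
        (\<forall>z. a (scl F z v) = scl F z (a v))) \<and>
     (\<forall>v. v \<notin> fibre F p \<longrightarrow> a v = 0) \<and>
     (\<forall>v\<in>fibre F p. \<forall>w\<in>fibre F p. herm F p (a v) w + herm F p v (a w) = 0)}"

definition u_sections :: "('m::topological_space, 'n::finite) rmfd \<Rightarrow>
    ('m, 'v::ab_group_add) hbundle \<Rightarrow> 'm set \<Rightarrow> ('m \<Rightarrow> 'v \<Rightarrow> 'v) set" where
  "u_sections M F U = {s. (\<forall>p\<in>U. s p \<in> u_fibre F p) \<and>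
     (\<forall>U'. open U' \<and> U' \<subseteq> U \<longrightarrow>
        (\<forall>\<sigma>\<in>sections M F U'. (\<lambda>p. s p (\<sigma> p)) \<in> sections M F U'))}"

type_synonym ('m, 'v) uform1 = "'m \<Rightarrow> 'm tvec \<Rightarrow> 'v \<Rightarrow> 'v"
type_synonym ('m, 'v) uform2 = "'m \<Rightarrow> 'm tvec \<Rightarrow> 'm tvec \<Rightarrow> 'v \<Rightarrow> 'v"

definition u_forms1 :: "('m::topological_space, 'n::finite) rmfd \<Rightarrow>
    ('m, 'v::ab_group_add) hbundle \<Rightarrow> ('m, 'v) uform1 set" where
  "u_forms1 M F = {\<omega>.
     (\<forall>p. \<forall>X\<in>tspace M p. \<omega> p X \<in> u_fibre F p \<and>
        (\<forall>Y\<in>tspace M p. \<omega> p (X + Y) = \<omega> p X + \<omega> p Y) \<and>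
        (\<forall>r v. \<omega> p (tscale r X) v = rscl F r (\<omega> p X v))) \<and>
     (\<forall>p X. X \<notin> tspace M p \<longrightarrow> \<omega> p X = 0) \<and>
     (\<forall>c\<in>charts M. \<forall>v. (\<lambda>p. \<omega> p (coord_vec M c v p)) \<in> u_sections M F (fst c))}"

definition u_forms2 :: "('m::topological_space, 'n::finite) rmfd \<Rightarrow>
    ('m, 'v::ab_group_add) hbundle \<Rightarrow> ('m, 'v) uform2 set" where
  "u_forms2 M F = {\<omega>.
     (\<forall>p. \<forall>X\<in>tspace M p. \<forall>Y\<in>tspace M p. \<omega> p X Y \<in> u_fibre F p \<and>
        \<omega> p Y X = - \<omega> p X Y \<and>
        (\<forall>Z\<in>tspace M p. \<omega> p (X + Z) Y = \<omega> p X Y + \<omega> p Z Y) \<and>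
        (\<forall>r v. \<omega> p (tscale r X) Y v = rscl F r (\<omega> p X Y v))) \<and>
     (\<forall>p X Y. X \<notin> tspace M p \<or> Y \<notin> tspace M p \<longrightarrow> \<omega> p X Y = 0) \<and>
     (\<forall>c\<in>charts M. \<forall>v w.
        (\<lambda>p. \<omega> p (coord_vec M c v p) (coord_vec M c w p)) \<in> u_sections M F (fst c))}"

text \<open>The metric on antihermitian endomorphisms is \<open>\<langle>a, b\<rangle> = Tr (a b\<^sup>*)\<close>, which is real.\<close>

definition unitary_basis :: "('m, 'v) hbundle \<Rightarrow> 'm \<Rightarrow> (nat \<Rightarrow> 'v) \<Rightarrow> bool" where
  "unitary_basis F p u \<longleftrightarrow> (\<forall>k<rank F. u k \<in> fibre F p) \<and>
     (\<forall>k<rank F. \<forall>l<rank F. herm F p (u k) (u l) = (if k = l then 1 else 0))"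

definition u_inner :: "('m, 'v) hbundle \<Rightarrow> 'm \<Rightarrow> ('v \<Rightarrow> 'v) \<Rightarrow> ('v \<Rightarrow> 'v) \<Rightarrow> real" where
  "u_inner F p a b = (let u = SOME u. unitary_basis F p u in
     Re (\<Sum>k<rank F. herm F p (a (u k)) (b (u k))))"

text \<open>The products on \<open>A\<^sup>k(u(F))\<close>: the Hodge star is defined by \<open>\<xi> \<and> \<star>\<xi>' = \<langle>\<xi>, \<xi>'\<rangle> vol\<close>, where the
  products \<open>b\<^sub>i\<^sub>1 \<and> \<dots> \<and> b\<^sub>i\<^sub>k\<close> (\<open>i\<^sub>1 < \<dots> < i\<^sub>k\<close>) of an orthonormal basis of covectors are orthonormal.
  Hence the factor \<open>1/2\<close> in the sum over all pairs in degree two.\<close>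

definition inner_form1 :: "('m::topological_space, 'n::finite) rmfd \<Rightarrow> ('m, 'v) hbundle \<Rightarrow>
    ('m, 'v) uform1 \<Rightarrow> ('m, 'v) uform1 \<Rightarrow> real" where
  "inner_form1 M F \<alpha> \<beta> = vol_integral M (\<lambda>p. let b = SOME b. orthonormal_basis M p b in
     \<Sum>i\<in>UNIV. u_inner F p (\<alpha> p (b i)) (\<beta> p (b i)))"

definition inner_form2 :: "('m::topological_space, 'n::finite) rmfd \<Rightarrow> ('m, 'v) hbundle \<Rightarrow>
    ('m, 'v) uform2 \<Rightarrow> ('m, 'v) uform2 \<Rightarrow> real" where
  "inner_form2 M F \<alpha> \<beta> = vol_integral M (\<lambda>p. let b = SOME b. orthonormal_basis M p b in
     (1 / 2) * (\<Sum>i\<in>UNIV. \<Sum>j\<in>UNIV. u_inner F p (\<alpha> p (b i) (b j)) (\<beta> p (b i) (b j))))"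

section \<open>Connections\<close>

text \<open>
  A connection \<open>\<nabla>\<close> (written \<open>D\<close> in formulas) is a morphism of sheaves \<open>F \<rightarrow> A\<^sup>1 \<otimes> F\<close>, represented by one operator on functions \<open>'m \<Rightarrow> 'v\<close>, of which
  only the action on smooth sections over open sets matters; locality says that the value at a point
  depends only on the germ of the section, i.e. compatibility with restrictions.
\<close>

type_synonym ('m, 'v) connection = "('m \<Rightarrow> 'v) \<Rightarrow> 'm \<Rightarrow> 'm tvec \<Rightarrow> 'v"

definition is_connection :: "('m::topological_space, 'n::finite) rmfd \<Rightarrow>
    ('m, 'v::ab_group_add) hbundle \<Rightarrow> ('m, 'v) connection \<Rightarrow> bool" where
  "is_connection M F D \<longleftrightarrow> (\<forall>U. open U \<longrightarrow> (\<forall>\<sigma>\<in>sections M F U.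
     D \<sigma> \<in> bundle_form1 M F U \<and>
     (\<forall>\<tau>\<in>sections M F U. \<forall>p\<in>U. \<forall>X\<in>tspace M p.
        ((\<forall>q\<in>U. \<sigma> q = \<tau> q) \<longrightarrow> D \<sigma> p X = D \<tau> p X) \<and>
        D (\<lambda>q. \<sigma> q + \<tau> q) p X = D \<sigma> p X + D \<tau> p X) \<and>
     (\<forall>f. smooth_fun M U f \<longrightarrow> (\<forall>p\<in>U. \<forall>X\<in>tspace M p.
        D (\<lambda>q. scl F (f q) (\<sigma> q)) p X = scl F (cderiv X f) (\<sigma> p) + scl F (f p) (D \<sigma> p X)))))"

definition hermitian_connection :: "('m::topological_space, 'n::finite) rmfd \<Rightarrow>
    ('m, 'v::ab_group_add) hbundle \<Rightarrow> ('m, 'v) connection \<Rightarrow> bool" where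
  "hermitian_connection M F D \<longleftrightarrow> is_connection M F D \<and>
     (\<forall>U. open U \<longrightarrow> (\<forall>\<sigma>\<in>sections M F U. \<forall>\<tau>\<in>sections M F U. \<forall>p\<in>U. \<forall>X\<in>tspace M p.
        herm F p (D \<sigma> p X) (\<tau> p) + herm F p (\<sigma> p) (D \<tau> p X) =
        cderiv X (\<lambda>q. herm F q (\<sigma> q) (\<tau> q))))"

definition morphism_of :: "('m, 'v) uform1 \<Rightarrow> ('m, 'v) connection" where
  "morphism_of E = (\<lambda>\<sigma> p X. E p X (\<sigma> p))"

text \<open>\<open>\<nabla>\<^sup>1 : A\<^sup>1 \<otimes> F \<rightarrow> A\<^sup>2 \<otimes> F\<close>, given by \<open>\<beta> \<otimes> \<sigma> \<mapsto> d\<beta> \<otimes> \<sigma> - \<beta> \<and> \<nabla>\<sigma>\<close> on local decompositions.\<close>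

definition nabla1 :: "('m::topological_space, 'n::finite) rmfd \<Rightarrow>
    ('m, 'v::ab_group_add) hbundle \<Rightarrow> ('m, 'v) connection \<Rightarrow>
    ('m \<Rightarrow> 'm tvec \<Rightarrow> 'v) \<Rightarrow> 'm \<Rightarrow> 'm tvec \<Rightarrow> 'm tvec \<Rightarrow> 'v" where
  "nabla1 M F D \<omega> p X Y = (THE w. \<exists>U (N::nat) \<beta> \<sigma>. open U \<and> p \<in> U \<and>
     (\<forall>a<N. \<beta> a \<in> real_form1 M U \<and> \<sigma> a \<in> sections M F U) \<and>
     (\<forall>q\<in>U. \<forall>Z\<in>tspace M q. \<omega> q Z = (\<Sum>a<N. rscl F (\<beta> a q Z) (\<sigma> a q))) \<and>
     w = (\<Sum>a<N. rscl F (ext_d M (\<beta> a) p X Y) (\<sigma> a p)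
        - (rscl F (\<beta> a p X) (D (\<sigma> a) p Y) - rscl F (\<beta> a p Y) (D (\<sigma> a) p X))))"

definition curvature :: "('m::topological_space, 'n::finite) rmfd \<Rightarrow>
    ('m, 'v::ab_group_add) hbundle \<Rightarrow> ('m, 'v) connection \<Rightarrow> ('m, 'v) uform2" where
  "curvature M F D p X Y v =
     (if X \<in> tspace M p \<and> Y \<in> tspace M p \<and> v \<in> fibre F p
      then THE w. \<exists>U \<sigma>. open U \<and> p \<in> U \<and> \<sigma> \<in> sections M F U \<and> \<sigma> p = v \<and>
             w = nabla1 M F D (D \<sigma>) p X Y
      else 0)"

definition flat_connection :: "('m::topological_space, 'n::finite) rmfd \<Rightarrow>
    ('m, 'v::ab_group_add) hbundle \<Rightarrow> ('m, 'v) connection \<Rightarrow> bool" where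
  "flat_connection M F D \<longleftrightarrow> curvature M F D = 0"

text \<open>The endomorphism-valued \<open>1\<close>-form \<open>\<nabla> \<circ> h - h \<circ> \<nabla>\<close>, for a local section \<open>h\<close> of \<open>u(F)\<close>.\<close>

definition conn_comm :: "('m::topological_space, 'n::finite) rmfd \<Rightarrow>
    ('m, 'v::ab_group_add) hbundle \<Rightarrow> ('m, 'v) connection \<Rightarrow>
    ('m \<Rightarrow> 'v \<Rightarrow> 'v) \<Rightarrow> ('m, 'v) uform1" where
  "conn_comm M F D h p X v =
     (if X \<in> tspace M p \<and> v \<in> fibre F p
      then THE w. \<exists>U \<sigma>. open U \<and> p \<in> U \<and> \<sigma> \<in> sections M F U \<and> \<sigma> p = v \<and>
             w = D (\<lambda>q. h q (\<sigma> q)) p X - h p (D \<sigma> p X)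
      else 0)"

text \<open>The induced operator \<open>\<nabla> : A\<^sup>1(u(F)) \<rightarrow> A\<^sup>2(u(F))\<close>, given on local decompositions by
  \<open>\<beta> \<otimes> h \<mapsto> d\<beta> \<otimes> h - \<beta> \<and> (\<nabla> \<circ> h - h \<circ> \<nabla>)\<close>.\<close>

definition nabla_u :: "('m::topological_space, 'n::finite) rmfd \<Rightarrow>
    ('m, 'v::ab_group_add) hbundle \<Rightarrow> ('m, 'v) connection \<Rightarrow> ('m, 'v) uform1 \<Rightarrow> ('m, 'v) uform2" where
  "nabla_u M F D E p X Y v =
     (if X \<in> tspace M p \<and> Y \<in> tspace M p \<and> v \<in> fibre F p
      then THE w. \<exists>U (N::nat) \<beta> h. open U \<and> p \<in> U \<and>
         (\<forall>a<N. \<beta> a \<in> real_form1 M U \<and> h a \<in> u_sections M F U) \<and>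
         (\<forall>q\<in>U. \<forall>Z\<in>tspace M q. \<forall>u\<in>fibre F q. E q Z u = (\<Sum>a<N. rscl F (\<beta> a q Z) (h a q u))) \<and>
         w = (\<Sum>a<N. rscl F (ext_d M (\<beta> a) p X Y) (h a p v)
            - (rscl F (\<beta> a p X) (conn_comm M F D (h a) p Y v)
               - rscl F (\<beta> a p Y) (conn_comm M F D (h a) p X v)))
      else 0)"

section \<open>The operations on forms with values in antihermitian endomorphisms\<close>

text \<open>\<open>tensor_rep M F p A N \<eta> e\<close>: the value \<open>A\<close> at \<open>p\<close> of a \<open>u(F)\<close>-valued \<open>1\<close>-form is
  \<open>\<Sum>a<N. \<eta>\<^sub>a \<otimes> e\<^sub>a\<close>.\<close>

definition tensor_rep :: "('m::topological_space, 'n::finite) rmfd \<Rightarrow>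
    ('m, 'v::ab_group_add) hbundle \<Rightarrow> 'm \<Rightarrow> ('m tvec \<Rightarrow> 'v \<Rightarrow> 'v) \<Rightarrow>
    nat \<Rightarrow> (nat \<Rightarrow> 'm tvec \<Rightarrow> real) \<Rightarrow> (nat \<Rightarrow> 'v \<Rightarrow> 'v) \<Rightarrow> bool" where
  "tensor_rep M F p A N \<eta> e \<longleftrightarrow>
     (\<forall>a<N. covector M p (\<eta> a) \<and> e a \<in> u_fibre F p) \<and>
     (\<forall>X\<in>tspace M p. \<forall>v\<in>fibre F p. A X v = (\<Sum>a<N. rscl F (\<eta> a X) (e a v)))"

text \<open>\<open>E \<and> E = \<Sum>a b. (\<eta>\<^sub>a \<and> \<eta>\<^sub>b) \<otimes> (e\<^sub>a \<circ> e\<^sub>b)\<close>\<close>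

definition wedge_self :: "('m::topological_space, 'n::finite) rmfd \<Rightarrow>
    ('m, 'v::ab_group_add) hbundle \<Rightarrow> ('m, 'v) uform1 \<Rightarrow> ('m, 'v) uform2" where
  "wedge_self M F E p X Y v =
     (if X \<in> tspace M p \<and> Y \<in> tspace M p \<and> v \<in> fibre F p
      then THE w. \<exists>N \<eta> e. tensor_rep M F p (E p) N \<eta> e \<and>
         w = (\<Sum>a<N. \<Sum>b<N. rscl F (\<eta> a X * \<eta> b Y - \<eta> a Y * \<eta> b X) (e a (e b v)))
      else 0)"

text \<open>\<open>E\<^sup>\<dagger>(\<gamma> \<otimes> c) = \<Sum>a. \<iota>(\<eta>\<^sub>a\<^sup>\<natural>) \<gamma> \<otimes> [c, e\<^sub>a]\<close>; the contraction of \<open>\<omega> = \<Sum> \<gamma> \<otimes> c\<close> with a tangent vector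
  \<open>Z\<close> is \<open>\<omega>(Z, \<cdot>)\<close>.\<close>

definition dagger :: "('m::topological_space, 'n::finite) rmfd \<Rightarrow>
    ('m, 'v::ab_group_add) hbundle \<Rightarrow> ('m, 'v) uform1 \<Rightarrow> ('m, 'v) uform2 \<Rightarrow> ('m, 'v) uform1" where
  "dagger M F E \<omega> p Y v =
     (if Y \<in> tspace M p \<and> v \<in> fibre F p
      then THE w. \<exists>N \<eta> e. tensor_rep M F p (E p) N \<eta> e \<and>
         w = (\<Sum>a<N. \<omega> p (sharp M p (\<eta> a)) Y (e a v) - e a (\<omega> p (sharp M p (\<eta> a)) Y v))
      else 0)"

definition formal_adjoint :: "('m::topological_space, 'n::finite) rmfd \<Rightarrow>
    ('m, 'v::ab_group_add) hbundle \<Rightarrow> (('m, 'v) uform1 \<Rightarrow> ('m, 'v) uform2) \<Rightarrow>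
    (('m, 'v) uform2 \<Rightarrow> ('m, 'v) uform1) \<Rightarrow> bool" where
  "formal_adjoint M F T \<delta> \<longleftrightarrow> (\<forall>\<omega>\<in>u_forms2 M F. \<delta> \<omega> \<in> u_forms1 M F \<and>
     (\<forall>B\<in>u_forms1 M F. inner_form2 M F (T B) \<omega> = inner_form1 M F B (\<delta> \<omega>)))"

section \<open>Yang-Mills connections\<close>

definition YM :: "('m::topological_space, 'n::finite) rmfd \<Rightarrow>
    ('m, 'v::ab_group_add) hbundle \<Rightarrow> ('m, 'v) connection \<Rightarrow> real" where
  "YM M F D = inner_form2 M F (curvature M F D) (curvature M F D)"

definition yang_mills_connection :: "('m::topological_space, 'n::finite) rmfd \<Rightarrow>
    ('m, 'v::ab_group_add) hbundle \<Rightarrow> ('m, 'v) connection \<Rightarrow> bool" where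
  "yang_mills_connection M F D \<longleftrightarrow> hermitian_connection M F D \<and>
     (\<forall>B\<in>u_forms1 M F.
        ((\<lambda>\<epsilon>. YM M F (D + (\<lambda>\<sigma> p X. rscl F \<epsilon> (morphism_of B \<sigma> p X)))) has_real_derivative 0) (at 0))"

end

theory Submission
  imports Defs
begin

text \<open>
  As \<open>\<nabla>\<close> is flat, \<open>\<nabla> + A\<close> has curvature \<open>\<nabla>(A) + A \<and> A\<close>.  Along \<open>A = E + \<epsilon> B\<close> this is
  \<open>K + \<epsilon> L + \<epsilon>\<^sup>2 (B \<and> B)\<close> with \<open>K = \<nabla>(E) + E \<and> E\<close> and \<open>L = \<nabla>(B) + [E, B]\<close>, where
  \<open>[E, B](X, Y) = [E X, B Y] - [E Y, B X]\<close>, so the derivative of \<open>YM\<close> is \<open>2 \<langle>\<langle>L, K\<rangle>\<rangle>\<close>.  The adjoint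
  \<open>\<delta>\<close> moves \<open>\<nabla>\<close> away from \<open>B\<close>, and invariance of the metric on \<open>u(F)\<close> gives
  \<open>\<langle>\<langle>[E, B], K\<rangle>\<rangle> = \<langle>\<langle>B, E\<^sup>\<dagger> K\<rangle>\<rangle>\<close> pointwise.  The derivative is therefore \<open>2 \<langle>\<langle>B, G\<rangle>\<rangle>\<close> with \<open>G\<close> the
  left-hand side of the equation; the choice \<open>B = G\<close> and definiteness of the product yield \<open>G = 0\<close>.

  All operators are evaluated on coordinate vector fields of one chart, where for instance
  \<open>\<nabla>(A)(\<partial>\<^sub>v, \<partial>\<^sub>w) = [\<nabla>\<^sub>v, A\<^sub>w] - [\<nabla>\<^sub>w, A\<^sub>v]\<close>; this shows that they do not depend on the local
  decompositions used to define them.  Smoothness of \<open>E\<^sup>\<dagger>\<close> and continuity of the fibrewise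
  products follow by rewriting contractions over orthonormal bases with the inverse Gram matrix.
\<close>

section \<open>Calculus of smooth functions\<close>

text \<open>Two features of the definitions shape the proof. The operators are definite descriptions
  over all local decompositions, or over all extensions of a vector, so nothing can be computed
  before existence and uniqueness of the value are known. Coordinate fields are good test vectors
  because they commute: no Lie bracket term ever appears, and uniqueness reduces to the symmetry of
  second derivatives or to linearity over functions. The integral is a finite sum of Lebesgue
  integrals, additive only for integrable functions, while the pairings use bases picked point by
  point without any regularity. Continuity of the pairings must therefore precede the expansion of
  \<open>YM\<close> as a polynomial of degree four in the parameter, whose linear coefficient is the
  variation. The form \<open>G\<close> is an admissible direction only if it is itself smooth and
  antihermitian; \<open>nabla_u_in\<close>, \<open>wedge_self_in\<close> and
  \<open>dagger_in\<close> serve this purpose. Definiteness needs an argument of its own, since the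
  pieces of integration are merely Borel and lie in different charts.\<close>

lemma Ck_on_cong:
  assumes "open S" "\<And>x. x \<in> S \<Longrightarrow> f x = g x" "Ck_on k S f"
  shows "Ck_on k S g"
  using assms(2,3)
proof (induction k arbitrary: f g)
  case 0
  then show ?case by (metis Ck_on.simps(1) continuous_on_cong)
next
  case (Suc k)
  have d: "g differentiable at x" if "x \<in> S" for x
  proof -
    have "(f has_derivative frechet_derivative f (at x)) (at x)"
      using Suc.prems that by (simp add: frechet_derivative_works[symmetric])
    then have "(g has_derivative frechet_derivative f (at x)) (at x)"
      by (rule has_derivative_transform_within_open[OF _ assms(1) that]) (use Suc.prems in auto)
    then show ?thesis by (auto simp: differentiable_def)
  qed
  have e: "frechet_derivative f (at x) = frechet_derivative g (at x)" if "x \<in> S" for x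
    using frechet_derivative_transform_within_open[of f x S g] Suc.prems that assms(1)
    by auto
  show ?case
    using d e Suc.IH[of "\<lambda>x. frechet_derivative f (at x) _" "\<lambda>x. frechet_derivative g (at x) _"] Suc.prems
    by simp
qed

lemma Ck_on_subset: "Ck_on k S f \<Longrightarrow> T \<subseteq> S \<Longrightarrow> Ck_on k T f"
  by (induction k arbitrary: f) (auto intro: continuous_on_subset)

lemma Ck_on_SucD: "Ck_on (Suc k) S f \<Longrightarrow> Ck_on k S f"
proof (induction k arbitrary: f)
  case 0
  then show ?case
    by (auto intro!: continuous_at_imp_continuous_on differentiable_imp_continuous_within)
next
  case (Suc k)
  then show ?case by (metis Ck_on.simps(2))
qed

lemma Ck_on_const: "Ck_on k S (\<lambda>x. c)"
  by (induction k arbitrary: c) auto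

text \<open>Model for the bilinear, linear, inverse and composition rules: the derivative of the
  combination has a closed formula on \<open>S\<close>, the induction hypothesis makes that formula
  \<open>Ck_on k\<close>, and \<open>Ck_on_cong\<close> carries this over to the derivative
  itself.\<close>

lemma Ck_on_add:
  assumes "open S" "Ck_on k S f" "Ck_on k S g"
  shows "Ck_on k S (\<lambda>x. f x + g x)"
  using assms(2,3)
proof (induction k arbitrary: f g)
  case 0
  then show ?case by (auto intro: continuous_intros)
next
  case (Suc k)
  have e: "frechet_derivative f (at x) v + frechet_derivative g (at x) v =
      frechet_derivative (\<lambda>x. f x + g x) (at x) v" if "x \<in> S" for x v
    using Suc.prems that has_derivative_add[of f _ "at x" g]
    by (metis (no_types, lifting) Ck_on.simps(2) frechet_derivative_at frechet_derivative_works)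
  have "Ck_on k S (\<lambda>x. frechet_derivative f (at x) v + frechet_derivative g (at x) v)" for v
    using Suc by auto
  then have "Ck_on k S (\<lambda>x. frechet_derivative (\<lambda>x. f x + g x) (at x) v)" for v
    using Ck_on_cong[OF assms(1)] e by (metis (no_types, lifting))
  then show ?case using Suc.prems by (auto intro: differentiable_add)
qed

lemma Ck_on_sum:
  assumes "open S" "\<And>i. i \<in> I \<Longrightarrow> Ck_on k S (f i)"
  shows "Ck_on k S (\<lambda>x. \<Sum>i\<in>I. f i x)"
  using assms(2)
  by (induction I rule: infinite_finite_induct) (auto intro: Ck_on_const Ck_on_add assms(1))

lemma (in bounded_bilinear) Ck_on:
  assumes "open S" "Ck_on k S f" "Ck_on k S g"
  shows "Ck_on k S (\<lambda>x. prod (f x) (g x))"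
  using assms(2,3)
proof (induction k arbitrary: f g)
  case 0
  then show ?case by (auto intro: continuous_on)
next
  case (Suc k)
  have h: "((\<lambda>x. prod (f x) (g x)) has_derivative
      (\<lambda>v. prod (f x) (frechet_derivative g (at x) v) + prod (frechet_derivative f (at x) v) (g x))) (at x)"
    if "x \<in> S" for x
    using Suc.prems that by (intro FDERIV) (auto simp: frechet_derivative_works[symmetric])
  \<comment> \<open>Each Leibniz term pairs a derivative, which is \<open>Ck_on k\<close>, with an
    undifferentiated factor, which \<open>Ck_on_SucD\<close> lowers from \<open>Suc k\<close> to
    \<open>k\<close>.\<close>
  have "Ck_on k S (\<lambda>x. prod (f x) (frechet_derivative g (at x) v) + prod (frechet_derivative f (at x) v) (g x))" for v
    by (rule Ck_on_add[OF assms(1)]; rule Suc.IH)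
      (use Suc.prems Ck_on_SucD[OF Suc.prems(1)] Ck_on_SucD[OF Suc.prems(2)] in auto)
  then have "Ck_on k S (\<lambda>x. frechet_derivative (\<lambda>x. prod (f x) (g x)) (at x) v)" for v
    by (rule Ck_on_cong[OF assms(1), rotated]) (erule fun_cong[OF frechet_derivative_at[OF h]])
  moreover have "(\<lambda>x. prod (f x) (g x)) differentiable at x" if "x \<in> S" for x
    using h[OF that] by (auto simp: differentiable_def)
  ultimately show ?case by simp
qed

lemma (in bounded_linear) Ck_on:
  assumes "open S" "Ck_on k S g"
  shows "Ck_on k S (\<lambda>x. f (g x))"
  using assms(2)
proof (induction k arbitrary: g)
  case 0
  then show ?case by (auto intro: continuous_on)
next
  case (Suc k)
  have h: "((\<lambda>x. f (g x)) has_derivative (\<lambda>v. f (frechet_derivative g (at x) v))) (at x)"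
    if "x \<in> S" for x
    using Suc.prems that by (intro has_derivative) (auto simp: frechet_derivative_works[symmetric])
  have "Ck_on k S (\<lambda>x. f (frechet_derivative g (at x) v))" for v
    using Suc by auto
  then have "Ck_on k S (\<lambda>x. frechet_derivative (\<lambda>x. f (g x)) (at x) v)" for v
    by (rule Ck_on_cong[OF assms(1), rotated]) (erule fun_cong[OF frechet_derivative_at[OF h]])
  moreover have "(\<lambda>x. f (g x)) differentiable at x" if "x \<in> S" for x
    using h[OF that] by (auto simp: differentiable_def)
  ultimately show ?case by simp
qed

text \<open>The derivative of the reciprocal is a product containing the reciprocal twice, and to
  these factors the induction hypothesis applies at the lower level.\<close>

lemma Ck_on_inverse:
  fixes f :: "'a::real_normed_vector \<Rightarrow> real"
  assumes "open S" "Ck_on k S f" "\<And>x. x \<in> S \<Longrightarrow> f x \<noteq> 0"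
  shows "Ck_on k S (\<lambda>x. inverse (f x))"
  using assms(2)
proof (induction k)
  case 0
  then show ?case using assms(3) by (auto intro: continuous_intros)
next
  case (Suc k)
  have h: "((\<lambda>x. inverse (f x)) has_derivative
      (\<lambda>v. - (inverse (f x) * frechet_derivative f (at x) v * inverse (f x)))) (at x)"
    if "x \<in> S" for x
    using Suc.prems that assms(3)
    by (intro Deriv.has_derivative_inverse) (auto simp: frechet_derivative_works[symmetric])
  have "Ck_on k S (\<lambda>x. - (inverse (f x) * frechet_derivative f (at x) v * inverse (f x)))" for v
    using Suc Ck_on_SucD[OF Suc.prems]
    by (intro bounded_linear.Ck_on[OF bounded_linear_minus[OF bounded_linear_ident]]
        bounded_bilinear.Ck_on[OF bounded_bilinear_mult] assms(1)) auto
  then have "Ck_on k S (\<lambda>x. frechet_derivative (\<lambda>x. inverse (f x)) (at x) v)" for v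
    by (rule Ck_on_cong[OF assms(1), rotated]) (erule fun_cong[OF frechet_derivative_at[OF h]])
  moreover have "(\<lambda>x. inverse (f x)) differentiable at x" if "x \<in> S" for x
    using h[OF that] by (auto simp: differentiable_def)
  ultimately show ?case by simp
qed

text \<open>\<open>Ck_on\<close> controls derivatives in fixed directions only, whereas the chain
  rule differentiates the outer function in a direction that moves with the point. Expansion over
  \<open>Basis\<close> turns this into finitely many fixed directions with variable coefficients,
  which is why \<open>Ck_on_compose\<close> asks for a Euclidean middle space.\<close>

lemma frechet_derivative_expand:
  fixes f :: "'a::euclidean_space \<Rightarrow> 'b::real_normed_vector"
  assumes "f differentiable at x"
  shows "frechet_derivative f (at x) v = (\<Sum>b\<in>Basis. (v \<bullet> b) *\<^sub>R frechet_derivative f (at x) b)"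
proof -
  interpret linear "frechet_derivative f (at x)"
    using assms by (rule linear_frechet_derivative)
  show ?thesis
    by (subst euclidean_representation[of v, symmetric]) (simp add: sum scale)
qed

lemma Ck_on_compose:
  fixes f :: "'b::euclidean_space \<Rightarrow> 'c::real_normed_vector"
    and g :: "'a::real_normed_vector \<Rightarrow> 'b"
  assumes "open S" "open T" "g ` S \<subseteq> T" "Ck_on k T f" "Ck_on k S g"
  shows "Ck_on k S (f \<circ> g)"
  using assms(4,5)
proof (induction k arbitrary: f)
  case 0
  then show ?case using assms(3) by (metis Ck_on.simps(1) continuous_on_compose continuous_on_subset)
next
  case (Suc k)
  have dg: "g differentiable at x" and df: "f differentiable at (g x)" if "x \<in> S" for x
    using Suc.prems that assms(3) by auto
  have e: "(\<Sum>b\<in>Basis. (frechet_derivative g (at x) v \<bullet> b) *\<^sub>R ((\<lambda>y. frechet_derivative f (at y) b) \<circ> g) x)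
      = frechet_derivative (f \<circ> g) (at x) v" if "x \<in> S" for x v
    using frechet_derivative_compose[OF dg df, OF that that]
      frechet_derivative_expand[OF df[OF that], of "frechet_derivative g (at x) v"]
    by (simp add: o_def)
  have "Ck_on k S (\<lambda>x. \<Sum>b\<in>Basis. (frechet_derivative g (at x) v \<bullet> b) *\<^sub>R ((\<lambda>y. frechet_derivative f (at y) b) \<circ> g) x)" for v
    by (rule Ck_on_sum[OF assms(1)], rule bounded_bilinear.Ck_on[OF bounded_bilinear_scaleR assms(1)],
        rule bounded_linear.Ck_on[OF bounded_linear_inner_left assms(1)], use Suc.prems in simp,
        rule Suc.IH, use Suc.prems in simp, rule Ck_on_SucD, rule Suc.prems)
  then have "Ck_on k S (\<lambda>x. frechet_derivative (f \<circ> g) (at x) v)" for v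
    by (rule Ck_on_cong[OF assms(1), rotated]) (rule e)
  moreover have "(f \<circ> g) differentiable at x" if "x \<in> S" for x
    using dg df that by (auto intro: differentiable_chain_at)
  ultimately show ?case unfolding Ck_on.simps by blast
qed

lemma smooth_on_cong:
  assumes "smooth_on S f" "open S" "\<And>x. x \<in> S \<Longrightarrow> f x = g x"
  shows "smooth_on S g"
  using assms Ck_on_cong by (metis smooth_on_def)

lemma smooth_on_subset: "smooth_on S f \<Longrightarrow> T \<subseteq> S \<Longrightarrow> smooth_on T f"
  by (metis Ck_on_subset smooth_on_def)

lemma smooth_on_const: "smooth_on S (\<lambda>x. c)"
  by (simp add: smooth_on_def Ck_on_const)

lemma smooth_on_add:
  "open S \<Longrightarrow> smooth_on S f \<Longrightarrow> smooth_on S g \<Longrightarrow> smooth_on S (\<lambda>x. f x + g x)"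
  by (simp add: smooth_on_def Ck_on_add)

lemma (in bounded_bilinear) smooth_on:
  "open S \<Longrightarrow> smooth_on S f \<Longrightarrow> smooth_on S g \<Longrightarrow> smooth_on S (\<lambda>x. prod (f x) (g x))"
  by (simp add: smooth_on_def Ck_on)

lemma (in bounded_linear) smooth_on:
  "open S \<Longrightarrow> smooth_on S g \<Longrightarrow> smooth_on S (\<lambda>x. f (g x))"
  by (simp add: smooth_on_def Ck_on)

lemma smooth_on_inverse:
  fixes f :: "'a::real_normed_vector \<Rightarrow> real"
  shows "open S \<Longrightarrow> smooth_on S f \<Longrightarrow> (\<And>x. x \<in> S \<Longrightarrow> f x \<noteq> 0) \<Longrightarrow> smooth_on S (\<lambda>x. inverse (f x))"
  by (simp add: smooth_on_def Ck_on_inverse)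

lemma smooth_on_compose:
  fixes f :: "'b::euclidean_space \<Rightarrow> 'c::real_normed_vector"
  shows "smooth_on T f \<Longrightarrow> smooth_on S g \<Longrightarrow> open S \<Longrightarrow> open T \<Longrightarrow> g ` S \<subseteq> T \<Longrightarrow> smooth_on S (f \<circ> g)"
  by (simp add: smooth_on_def Ck_on_compose)

lemma smooth_on_frechet_derivative:
  "smooth_on S f \<Longrightarrow> smooth_on S (\<lambda>x. frechet_derivative f (at x) v)"
  unfolding smooth_on_def by (metis Ck_on.simps(2))

lemma smooth_on_imp_differentiable: "smooth_on S f \<Longrightarrow> x \<in> S \<Longrightarrow> f differentiable at x"
  unfolding smooth_on_def by (metis Ck_on.simps(2))

lemma smooth_on_imp_continuous_on: "smooth_on S f \<Longrightarrow> continuous_on S f"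
  unfolding smooth_on_def by (metis Ck_on.simps(1))

lemma smooth_on_id: "open S \<Longrightarrow> smooth_on S (\<lambda>x. x)"
  unfolding smooth_on_def
proof
  fix k show "Ck_on k S (\<lambda>x. x)"
    by (cases k) (auto simp: Ck_on_const continuous_on_id)
qed

text \<open>Mean value theorem twice: along \<open>v\<close> for the difference of two translates of
  \<open>f\<close>, then along \<open>w\<close> for the derivative of \<open>f\<close> in direction
  \<open>v\<close>. The left-hand side is symmetric in \<open>v\<close> and \<open>w\<close>; the
  right-hand side is not.\<close>

lemma second_difference:
  fixes f :: "'a::real_normed_vector \<Rightarrow> real"
  assumes S: "smooth_on S f" and h: "h > 0"
    and box: "\<And>s t. 0 \<le> s \<Longrightarrow> s \<le> h \<Longrightarrow> 0 \<le> t \<Longrightarrow> t \<le> h \<Longrightarrow> x + s *\<^sub>R v + t *\<^sub>R w \<in> S"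
  shows "\<exists>s t. 0 \<le> s \<and> s \<le> h \<and> 0 \<le> t \<and> t \<le> h \<and>
     f (x + h *\<^sub>R v + h *\<^sub>R w) - f (x + h *\<^sub>R v) - f (x + h *\<^sub>R w) + f x =
     h * (h * frechet_derivative (\<lambda>y. frechet_derivative f (at y) v) (at (x + s *\<^sub>R v + t *\<^sub>R w)) w)"
proof -
  let ?g = "\<lambda>y. frechet_derivative f (at y) v"
  have Sg: "smooth_on S ?g" by (rule smooth_on_frechet_derivative[OF S])
  have der: "((\<lambda>s. F (a + s *\<^sub>R u)) has_real_derivative frechet_derivative F (at (a + s *\<^sub>R u)) u) (at s)"
    if "F differentiable at (a + s *\<^sub>R u)" for F :: "'a \<Rightarrow> real" and a u s
  proof -
    have F: "(F has_derivative frechet_derivative F (at (a + s *\<^sub>R u))) (at (a + s *\<^sub>R u))"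
      using that by (simp add: frechet_derivative_works[symmetric])
    have "((\<lambda>s. a + s *\<^sub>R u) has_derivative (\<lambda>r. r *\<^sub>R u)) (at s)"
      by (auto intro!: derivative_eq_intros)
    from has_derivative_compose[OF this F]
    have "((\<lambda>s. F (a + s *\<^sub>R u)) has_derivative (\<lambda>r. frechet_derivative F (at (a + s *\<^sub>R u)) (r *\<^sub>R u))) (at s)" .
    moreover have "frechet_derivative F (at (a + s *\<^sub>R u)) (r *\<^sub>R u) = frechet_derivative F (at (a + s *\<^sub>R u)) u * r" for r
      using linear_scale[OF linear_frechet_derivative[OF that]] by simp
    ultimately show ?thesis by (simp add: has_field_derivative_def)
  qed
  let ?p = "\<lambda>s. f ((x + h *\<^sub>R w) + s *\<^sub>R v) - f (x + s *\<^sub>R v)"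
  have "\<exists>s. 0 < s \<and> s < h \<and> ?p h - ?p 0 = (h - 0) * (?g ((x + h *\<^sub>R w) + s *\<^sub>R v) - ?g (x + s *\<^sub>R v))"
  proof (rule MVT2[OF h])
    fix s assume s: "0 \<le> s" "s \<le> h"
    have "x + h *\<^sub>R w + s *\<^sub>R v \<in> S" "x + s *\<^sub>R v \<in> S"
      using box[OF s, of h] box[OF s, of 0] h by (auto simp: ac_simps)
    then show "(?p has_real_derivative (?g ((x + h *\<^sub>R w) + s *\<^sub>R v) - ?g (x + s *\<^sub>R v))) (at s)"
      using S by (intro DERIV_diff der smooth_on_imp_differentiable)
  qed
  then obtain s where s: "0 < s" "s < h" and
    1: "?p h - ?p 0 = h * (?g ((x + s *\<^sub>R v) + h *\<^sub>R w) - ?g ((x + s *\<^sub>R v) + 0 *\<^sub>R w))"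
    by (auto simp: ac_simps)
  have "\<exists>t. 0 < t \<and> t < h \<and> ?g ((x + s *\<^sub>R v) + h *\<^sub>R w) - ?g ((x + s *\<^sub>R v) + 0 *\<^sub>R w) =
      (h - 0) * frechet_derivative ?g (at (x + s *\<^sub>R v + t *\<^sub>R w)) w"
    using s by (intro MVT2[OF h] der smooth_on_imp_differentiable[OF Sg] box) auto
  then obtain t where t: "0 < t" "t < h" and
    2: "?g ((x + s *\<^sub>R v) + h *\<^sub>R w) - ?g ((x + s *\<^sub>R v) + 0 *\<^sub>R w) =
      h * frechet_derivative ?g (at (x + s *\<^sub>R v + t *\<^sub>R w)) w" by auto
  show ?thesis
    using s t 1 2 by (intro exI[of _ s] exI[of _ t]) (auto simp: algebra_simps)
qed

text \<open>The symmetric second difference equals both mixed derivatives at nearby points, up to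
  the same factor \<open>h * h\<close>; continuity of both mixed derivatives at \<open>x\<close>
  then forces equality.\<close>

lemma frechet_derivative_commute:
  fixes f :: "'a::real_normed_vector \<Rightarrow> real"
  assumes S: "smooth_on S f" and "open S" "x \<in> S"
  shows "frechet_derivative (\<lambda>y. frechet_derivative f (at y) v) (at x) w =
         frechet_derivative (\<lambda>y. frechet_derivative f (at y) w) (at x) v"
proof (rule ccontr)
  let ?A = "\<lambda>x. frechet_derivative (\<lambda>y. frechet_derivative f (at y) v) (at x) w"
  let ?B = "\<lambda>x. frechet_derivative (\<lambda>y. frechet_derivative f (at y) w) (at x) v"
  assume ne: "?A x \<noteq> ?B x"
  \<comment> \<open>Half of the gap: two values closer than \<open>e\<close> to their limits cannot
    coincide.\<close>
  define e where "e = \<bar>?A x - ?B x\<bar> / 2"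
  have e: "e > 0" using ne by (simp add: e_def)
  have cont: "isCont ?A x" "isCont ?B x"
    by (rule continuous_on_interior[of S], intro smooth_on_imp_continuous_on smooth_on_frechet_derivative S,
        use assms in \<open>simp add: interior_open\<close>)+
  obtain d1 where d1: "d1 > 0" "\<And>y. dist y x < d1 \<Longrightarrow> dist (?A y) (?A x) < e"
    using cont(1) e unfolding continuous_at_eps_delta by blast
  obtain d2 where d2: "d2 > 0" "\<And>y. dist y x < d2 \<Longrightarrow> dist (?B y) (?B x) < e"
    using cont(2) e unfolding continuous_at_eps_delta by blast
  obtain d3 where d3: "d3 > 0" "\<And>y. dist y x < d3 \<Longrightarrow> y \<in> S"
    using assms(2,3) by (metis open_dist)
  define d where "d = min d1 (min d2 d3)"
  have d: "d > 0" using d1 d2 d3 by (simp add: d_def)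
  \<comment> \<open>Keeps the whole parallelogram with sides \<open>h *\<^sub>R v\<close> and
    \<open>h *\<^sub>R w\<close> in the ball of radius \<open>d\<close>; the summand
    \<open>1\<close> covers vanishing \<open>v\<close> and \<open>w\<close> and makes the estimate
    strict.\<close>
  define h where "h = d / (1 + norm v + norm w)"
  have pos: "1 + norm v + norm w > 0" by (smt (verit) norm_ge_zero)
  have h: "h > 0" using d pos by (simp add: h_def)
  have near: "dist (x + s *\<^sub>R v + t *\<^sub>R w) x < d" if "0 \<le> s" "s \<le> h" "0 \<le> t" "t \<le> h" for s t
  proof -
    have "dist (x + s *\<^sub>R v + t *\<^sub>R w) x \<le> s * norm v + t * norm w"
      using that norm_triangle_ineq[of "s *\<^sub>R v" "t *\<^sub>R w"] by (simp add: dist_norm add.assoc)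
    also have "\<dots> \<le> h * norm v + h * norm w"
      using that by (intro add_mono mult_right_mono) auto
    also have "\<dots> < h * (1 + norm v + norm w)" using h by (simp add: algebra_simps)
    also have "\<dots> = d" using pos by (simp add: h_def)
    finally show ?thesis .
  qed
  have near': "dist (x + s *\<^sub>R w + t *\<^sub>R v) x < d" if "0 \<le> s" "s \<le> h" "0 \<le> t" "t \<le> h" for s t
    using near[OF that(3,4,1,2)] by (simp add: ac_simps)
  obtain s t where st: "0 \<le> s" "s \<le> h" "0 \<le> t" "t \<le> h" and
    1: "f (x + h *\<^sub>R v + h *\<^sub>R w) - f (x + h *\<^sub>R v) - f (x + h *\<^sub>R w) + f x = h * (h * ?A (x + s *\<^sub>R v + t *\<^sub>R w))"
    using second_difference[OF S h, of x v w] near d3(2) by (auto simp: d_def)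
  obtain s' t' where st': "0 \<le> s'" "s' \<le> h" "0 \<le> t'" "t' \<le> h" and
    2: "f (x + h *\<^sub>R w + h *\<^sub>R v) - f (x + h *\<^sub>R w) - f (x + h *\<^sub>R v) + f x = h * (h * ?B (x + s' *\<^sub>R w + t' *\<^sub>R v))"
    using second_difference[OF S h, of x w v] near' d3(2) by (auto simp: d_def)
  have swap: "x + h *\<^sub>R w + h *\<^sub>R v = x + h *\<^sub>R v + h *\<^sub>R w" by (simp add: ac_simps)
  have "h * (h * ?A (x + s *\<^sub>R v + t *\<^sub>R w)) = h * (h * ?B (x + s' *\<^sub>R w + t' *\<^sub>R v))"
    using 1 2 unfolding swap by linarith
  then have "?A (x + s *\<^sub>R v + t *\<^sub>R w) = ?B (x + s' *\<^sub>R w + t' *\<^sub>R v)"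
    using h by simp
  moreover have "dist (?A (x + s *\<^sub>R v + t *\<^sub>R w)) (?A x) < e"
    using near[OF st] d1 by (auto simp: d_def)
  moreover have "dist (?B (x + s' *\<^sub>R w + t' *\<^sub>R v)) (?B x) < e"
    using near'[OF st'] d2 by (auto simp: d_def)
  ultimately show False unfolding dist_real_def e_def by (auto simp: abs_if split: if_splits)
qed

section \<open>Tangent vectors and differential forms on a Riemannian manifold\<close>

abbreviation chart_inv :: "'m set \<times> ('m \<Rightarrow> real ^ 'n) \<Rightarrow> real ^ 'n \<Rightarrow> 'm" where
  "chart_inv c \<equiv> inv_into (fst c) (snd c)"

definition chart_coord :: "'m set \<times> ('m \<Rightarrow> real ^ 'n) \<Rightarrow> 'n \<Rightarrow> 'm \<Rightarrow> real" where
  "chart_coord c i q = snd c q $ i"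

text \<open>Local decompositions of forms are indexed by natural numbers below some \<open>N\<close>, coordinates by \<open>'n\<close>.\<close>

definition enum_UNIV :: "nat \<Rightarrow> 'n::finite" where
  "enum_UNIV = (SOME h. bij_betw h {..<CARD('n)} UNIV)"

lemma bij_enum_UNIV: "bij_betw (enum_UNIV :: nat \<Rightarrow> 'n::finite) {..<CARD('n)} UNIV"
proof -
  have "\<exists>h. bij_betw h {..<CARD('n)} (UNIV :: 'n set)"
    using ex_bij_betw_nat_finite[of "UNIV :: 'n set"] by (simp add: atLeast0LessThan)
  then show ?thesis unfolding enum_UNIV_def by (rule someI_ex)
qed

lemma sum_enum_UNIV: "(\<Sum>a<CARD('n). f (enum_UNIV a :: 'n::finite)) = (\<Sum>i\<in>UNIV. f i)"
  by (rule sum.reindex_bij_betw[OF bij_enum_UNIV])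

lemma vec_expand: "v = (\<Sum>i\<in>UNIV. v $ i *\<^sub>R axis i (1::real))"
  by (simp add: vec_eq_iff axis_def if_distrib sum.delta cong: if_cong)

lemma tscale_eq: "tscale r X f = r * X f"
  by (simp add: tscale_def)

lemma coord_vec_smooth:
  assumes "smooth_fun M U f" "open U" "p \<in> U"
  shows "coord_vec M c v p f = frechet_derivative (f \<circ> chart_inv c) (at (snd c p)) v"
  using assms by (auto simp: coord_vec_def)

lemma smooth_fun_iff:
  "smooth_fun M U f \<longleftrightarrow> (\<forall>c\<in>charts M. smooth_on (snd c ` (U \<inter> fst c)) (f \<circ> chart_inv c))"
  by (auto simp: smooth_fun_def split: prod.splits)

lemma smooth_fun_subset: "smooth_fun M U f \<Longrightarrow> V \<subseteq> U \<Longrightarrow> smooth_fun M V f"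
  unfolding smooth_fun_iff by (meson Int_mono image_mono order_refl smooth_on_subset)

lemma smooth_fun_const: "smooth_fun M U (\<lambda>q. k)"
  by (simp add: smooth_fun_iff o_def smooth_on_const)

lemma real_form1_coord:
  "\<beta> \<in> real_form1 M U \<Longrightarrow> c \<in> charts M \<Longrightarrow> smooth_fun M (U \<inter> fst c) (\<lambda>p. \<beta> p (coord_vec M c v p))"
  unfolding real_form1_def by auto

locale riemannian =
  fixes M :: "('m::t2_space, 'n::finite) rmfd"
  assumes riemannian: "oriented_riemannian_manifold M"
begin

lemma atlas: "oriented_atlas (charts M)"
  using riemannian by (simp add: oriented_riemannian_manifold_def)

lemma chart_cover: obtains c where "c \<in> charts M" "p \<in> fst c"
  using atlas unfolding oriented_atlas_def by blast

lemma chart_homeo: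
  "c \<in> charts M \<Longrightarrow> homeomorphism (fst c) (snd c ` fst c) (snd c) (chart_inv c)"
  and chart_open: "c \<in> charts M \<Longrightarrow> open (fst c)"
  and chart_image_open': "c \<in> charts M \<Longrightarrow> open (snd c ` fst c)"
  using atlas unfolding oriented_atlas_def by (cases c, force)+

lemma chart_transition:
  "c \<in> charts M \<Longrightarrow> c' \<in> charts M \<Longrightarrow> smooth_on (snd c ` (fst c \<inter> fst c')) (snd c' \<circ> chart_inv c)"
  using atlas unfolding oriented_atlas_def by (fastforce split: prod.splits)

lemma chart_inv [simp]: "c \<in> charts M \<Longrightarrow> q \<in> fst c \<Longrightarrow> chart_inv c (snd c q) = q"
  using chart_homeo by (metis homeomorphism_apply1)

lemma chart_image_open:
  assumes "c \<in> charts M" "open U"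
  shows "open (snd c ` (U \<inter> fst c))"
proof -
  have "openin (top_of_set (fst c)) (U \<inter> fst c)"
    using assms by (metis inf_commute openin_open_Int)
  then show ?thesis
    using homeomorphism_imp_open_map[OF chart_homeo[OF assms(1)]] chart_image_open'[OF assms(1)]
    by (metis openin_open_trans)
qed

lemma smooth_fun_cong:
  assumes "smooth_fun M U f" "open U" "\<And>q. q \<in> U \<Longrightarrow> f q = g q"
  shows "smooth_fun M U g"
  unfolding smooth_fun_iff
proof
  fix c assume c: "c \<in> charts M"
  show "smooth_on (snd c ` (U \<inter> fst c)) (g \<circ> chart_inv c)"
    by (rule smooth_on_cong[of _ "f \<circ> chart_inv c"])
      (use assms c chart_image_open in \<open>auto simp: smooth_fun_iff\<close>)
qed

text \<open>Smoothness in one chart that sees all of \<open>U\<close> is carried to every other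
  chart by composition with a smooth transition map.\<close>

lemma smooth_fun_chartI:
  assumes c: "c \<in> charts M" and U: "open U" "U \<subseteq> fst c"
    and f: "smooth_on (snd c ` U) (f \<circ> chart_inv c)"
  shows "smooth_fun M U f"
  unfolding smooth_fun_iff
proof
  fix c' assume c': "c' \<in> charts M"
  have o: "open (snd c' ` (U \<inter> fst c'))" "open (snd c ` U)"
    using chart_image_open[OF c' U(1)] chart_image_open[OF c U(1)] U(2) by (auto simp: inf_absorb1)
  have "smooth_on (snd c' ` (U \<inter> fst c')) (snd c \<circ> chart_inv c')"
    by (rule smooth_on_subset[OF chart_transition[OF c' c]]) (use U in auto)
  then have "smooth_on (snd c' ` (U \<inter> fst c')) ((f \<circ> chart_inv c) \<circ> (snd c \<circ> chart_inv c'))"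
    by (rule smooth_on_compose[OF f _ o]) (use c' in auto)
  then show "smooth_on (snd c' ` (U \<inter> fst c')) (f \<circ> chart_inv c')"
    by (rule smooth_on_cong[OF _ o(1)]) (use c c' U in auto)
qed

lemma smooth_fun_add:
  "open U \<Longrightarrow> smooth_fun M U f \<Longrightarrow> smooth_fun M U g \<Longrightarrow> smooth_fun M U (\<lambda>q. f q + g q)"
  unfolding smooth_fun_iff o_def by (auto intro!: smooth_on_add chart_image_open)

lemma smooth_fun_bilinear:
  "bounded_bilinear b \<Longrightarrow> open U \<Longrightarrow> smooth_fun M U f \<Longrightarrow> smooth_fun M U g \<Longrightarrow>
    smooth_fun M U (\<lambda>q. b (f q) (g q))"
  unfolding smooth_fun_iff o_def using bounded_bilinear.smooth_on[OF _ chart_image_open] by blast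

lemma smooth_fun_linear:
  "bounded_linear b \<Longrightarrow> open U \<Longrightarrow> smooth_fun M U f \<Longrightarrow> smooth_fun M U (\<lambda>q. b (f q))"
  unfolding smooth_fun_iff o_def using bounded_linear.smooth_on[OF _ chart_image_open] by blast

lemmas smooth_fun_mult = smooth_fun_bilinear[OF bounded_bilinear_mult]
lemmas smooth_fun_of_real = smooth_fun_linear[OF bounded_linear_of_real]
lemmas smooth_fun_Re = smooth_fun_linear[OF bounded_linear_Re]
lemmas smooth_fun_Im = smooth_fun_linear[OF bounded_linear_Im]

lemma smooth_fun_minus: "open U \<Longrightarrow> smooth_fun M U f \<Longrightarrow> smooth_fun M U (\<lambda>q. - f q)"
  by (rule smooth_fun_linear[OF bounded_linear_minus[OF bounded_linear_ident]])

lemma smooth_fun_inverse: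
  fixes f :: "'m \<Rightarrow> real"
  shows "open U \<Longrightarrow> smooth_fun M U f \<Longrightarrow> (\<And>q. q \<in> U \<Longrightarrow> f q \<noteq> 0) \<Longrightarrow> smooth_fun M U (\<lambda>q. inverse (f q))"
  unfolding smooth_fun_iff o_def
proof
  fix c assume *: "open U" "\<forall>c\<in>charts M. smooth_on (snd c ` (U \<inter> fst c)) (\<lambda>x. f (chart_inv c x))"
    "\<And>q. q \<in> U \<Longrightarrow> f q \<noteq> 0" and c: "c \<in> charts M"
  have "f (chart_inv c x) \<noteq> 0" if "x \<in> snd c ` (U \<inter> fst c)" for x
    using that *(3) chart_inv[OF c] by auto
  with * c show "smooth_on (snd c ` (U \<inter> fst c)) (\<lambda>x. inverse (f (chart_inv c x)))"
    by (intro smooth_on_inverse chart_image_open) auto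
qed

lemma smooth_fun_sum:
  "open U \<Longrightarrow> (\<And>i. i \<in> I \<Longrightarrow> smooth_fun M U (f i)) \<Longrightarrow> smooth_fun M U (\<lambda>q. \<Sum>i\<in>I. f i q)"
proof (induction I rule: infinite_finite_induct)
  case (insert i I)
  then have "smooth_fun M U (f i)" "smooth_fun M U (\<lambda>q. \<Sum>i\<in>I. f i q)" by blast+
  then show ?case using insert smooth_fun_add[OF insert.prems(1), of "f i"] by simp
qed (simp_all add: smooth_fun_const)

lemma smooth_fun_prod:
  fixes f :: "'i \<Rightarrow> 'm \<Rightarrow> real"
  shows "open U \<Longrightarrow> (\<And>i. i \<in> I \<Longrightarrow> smooth_fun M U (f i)) \<Longrightarrow> smooth_fun M U (\<lambda>q. \<Prod>i\<in>I. f i q)"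
proof (induction I rule: infinite_finite_induct)
  case (insert i I)
  then have "smooth_fun M U (f i)" "smooth_fun M U (\<lambda>q. \<Prod>i\<in>I. f i q)" by blast+
  then show ?case using insert smooth_fun_mult[OF insert.prems(1), of "f i"] by simp
qed (simp_all add: smooth_fun_const)

lemma smooth_fun_imp_continuous_on:
  assumes "open U" "smooth_fun M U f"
  shows "continuous_on U f"
proof -
  have "continuous_on (U \<inter> fst c) f" if c: "c \<in> charts M" for c
  proof -
    have "continuous_on (snd c ` (U \<inter> fst c)) (f \<circ> chart_inv c)"
      using assms c unfolding smooth_fun_iff by (blast intro: smooth_on_imp_continuous_on)
    moreover have "continuous_on (U \<inter> fst c) (snd c)"
      using chart_homeo[OF c] by (meson continuous_on_subset homeomorphism_def inf_le2)
    ultimately have "continuous_on (U \<inter> fst c) ((f \<circ> chart_inv c) \<circ> snd c)"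
      by (rule continuous_on_compose[rotated])
    then show ?thesis
      by (rule continuous_on_eq) (use c in auto)
  qed
  then have "continuous_on (\<Union>c\<in>charts M. U \<inter> fst c) f"
    using assms chart_open by (intro continuous_on_open_UN) auto
  moreover have "(\<Union>c\<in>charts M. U \<inter> fst c) = U"
    using chart_cover by blast
  ultimately show ?thesis by simp
qed

subsection \<open>Tangent spaces\<close>

lemma smooth_at_chart:
  assumes "smooth_fun M U f" "c \<in> charts M" "p \<in> U" "p \<in> fst c"
  shows "(f \<circ> chart_inv c) differentiable at (snd c p)"
  using assms by (intro smooth_on_imp_differentiable[of "snd c ` (U \<inter> fst c)"]) (auto simp: smooth_fun_iff)

lemma coord_vec_change:
  assumes c: "c \<in> charts M" "p \<in> fst c" and c': "c' \<in> charts M" "p \<in> fst c'"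
  shows "coord_vec M c v p =
    coord_vec M c' (frechet_derivative (snd c' \<circ> chart_inv c) (at (snd c p)) v) p" (is "_ = coord_vec M c' ?w p")
proof
  fix f
  show "coord_vec M c v p f = coord_vec M c' ?w p f"
  proof (cases "\<exists>U. open U \<and> p \<in> U \<and> smooth_fun M U f")
    case False
    \<comment> \<open>On functions not smooth near \<open>p\<close> both operators take the default
      value \<open>0\<close>; the default does not depend on the chart, so the two agree as
      functions.\<close>
    then show ?thesis by (simp only: coord_vec_def False if_False)
  next
    case True
    then obtain U where U: "open U" "p \<in> U" "smooth_fun M U f" by auto
    let ?V = "snd c ` ((U \<inter> fst c') \<inter> fst c)"
    have V: "open ?V" "snd c p \<in> ?V"
      using chart_image_open[OF c(1)] U chart_open[OF c'(1)] c c' by (blast, auto)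
    have 1: "(snd c' \<circ> chart_inv c) differentiable at (snd c p)"
      using chart_transition[OF c(1) c'(1)] c c' by (intro smooth_on_imp_differentiable) auto
    have 2: "(f \<circ> chart_inv c') differentiable at ((snd c' \<circ> chart_inv c) (snd c p))"
      using smooth_at_chart[OF U(3) c'(1) U(2) c'(2)] c by simp
    have "frechet_derivative (f \<circ> chart_inv c) (at (snd c p)) =
        frechet_derivative ((f \<circ> chart_inv c') \<circ> (snd c' \<circ> chart_inv c)) (at (snd c p))"
      by (rule frechet_derivative_transform_within_open[OF smooth_at_chart[OF U(3) c(1) U(2) c(2)] V])
        (use c c' in auto)
    then show ?thesis
      using U c frechet_derivative_compose[OF 1 2]
      by (simp add: coord_vec_smooth[OF U(3,1,2)] o_def)
  qed
qed

lemma coord_vec_add: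
  assumes "c \<in> charts M" "p \<in> fst c"
  shows "coord_vec M c (v + w) p = coord_vec M c v p + coord_vec M c w p"
proof
  fix f show "coord_vec M c (v + w) p f = (coord_vec M c v p + coord_vec M c w p) f"
    using assms linear_add[OF linear_frechet_derivative[OF smooth_at_chart[OF _ assms(1) _ assms(2)]]]
    by (auto simp: coord_vec_def)
qed

lemma coord_vec_scale:
  assumes "c \<in> charts M" "p \<in> fst c"
  shows "coord_vec M c (r *\<^sub>R v) p = tscale r (coord_vec M c v p)"
proof
  fix f show "coord_vec M c (r *\<^sub>R v) p f = tscale r (coord_vec M c v p) f"
  proof (cases "\<exists>U. open U \<and> p \<in> U \<and> smooth_fun M U f")
    case True
    then obtain U where U: "open U" "p \<in> U" "smooth_fun M U f" by auto
    show ?thesis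
      using linear_scale[OF linear_frechet_derivative[OF smooth_at_chart[OF U(3) assms(1) U(2) assms(2)]], of r v]
      by (simp add: coord_vec_smooth[OF U(3,1,2)] tscale_def)
  next
    case False
    then show ?thesis unfolding tscale_def by (simp only: coord_vec_def False if_False mult_zero_right)
  qed
qed

text \<open>\<open>tspace\<close> collects the vectors of all charts around \<open>p\<close>; by
  \<open>coord_vec_change\<close> a single chart already produces all of them.\<close>

lemma tspace_eq:
  assumes "c \<in> charts M" "p \<in> fst c"
  shows "tspace M p = range (\<lambda>v. coord_vec M c v p)"
  using assms coord_vec_change[OF _ _ assms] unfolding tspace_def by blast

lemma coord_vec_in: "c \<in> charts M \<Longrightarrow> p \<in> fst c \<Longrightarrow> coord_vec M c v p \<in> tspace M p"
  using tspace_def by blast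

lemma tspace_obtain:
  assumes "X \<in> tspace M p" "c \<in> charts M" "p \<in> fst c"
  obtains v where "X = coord_vec M c v p"
  using assms tspace_eq[OF assms(2,3)] by blast

lemma tspace_add: "X \<in> tspace M p \<Longrightarrow> Y \<in> tspace M p \<Longrightarrow> X + Y \<in> tspace M p"
  by (metis chart_cover coord_vec_add coord_vec_in tspace_obtain)

lemma tspace_scale: "X \<in> tspace M p \<Longrightarrow> tscale r X \<in> tspace M p"
  by (metis chart_cover coord_vec_scale coord_vec_in tspace_obtain)

lemma tspace_zero: "0 \<in> tspace M p"
proof -
  obtain c where c: "c \<in> charts M" "p \<in> fst c" by (rule chart_cover)
  have "coord_vec M c 0 p = 0"
    using coord_vec_add[OF c, of 0 0] by simp
  then show ?thesis using coord_vec_in[OF c, of 0] by simp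
qed

lemma tspace_sum: "(\<And>i. i \<in> I \<Longrightarrow> X i \<in> tspace M p) \<Longrightarrow> (\<Sum>i\<in>I. X i) \<in> tspace M p"
  by (induction I rule: infinite_finite_induct) (auto intro: tspace_zero tspace_add)

lemma tspace_additive_sum:
  fixes L :: "'m tvec \<Rightarrow> 'x::ab_group_add"
  assumes add: "\<And>X Y. X \<in> tspace M p \<Longrightarrow> Y \<in> tspace M p \<Longrightarrow> L (X + Y) = L X + L Y"
    and X: "\<And>i. i \<in> I \<Longrightarrow> X i \<in> tspace M p"
  shows "L (\<Sum>i\<in>I. X i) = (\<Sum>i\<in>I. L (X i))"
proof -
  have "L 0 = 0" using add[OF tspace_zero tspace_zero] by simp
  then show ?thesis using X
    by (induction I rule: infinite_finite_induct) (auto simp: add tspace_sum)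
qed

lemma smooth_chart_coord: "c \<in> charts M \<Longrightarrow> smooth_fun M (fst c) (chart_coord c i)"
  by (rule smooth_fun_chartI[OF _ chart_open order_refl], assumption, assumption)
    (rule smooth_on_cong[OF bounded_linear.smooth_on[OF bounded_linear_vec_nth _ smooth_on_id]],
     auto simp: chart_coord_def chart_image_open')

text \<open>A vector is recovered from its action on the coordinate functions, so
  \<open>X (chart_coord c i)\<close> plays the role of the \<open>i\<close>-th component in all
  expansions below.\<close>

lemma coord_vec_chart_coord:
  assumes c: "c \<in> charts M" "p \<in> fst c"
  shows "coord_vec M c v p (chart_coord c i) = v $ i"
proof -
  have "frechet_derivative (\<lambda>x::real^'n. x $ i) (at (snd c p)) =
      frechet_derivative (chart_coord c i \<circ> chart_inv c) (at (snd c p))"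
    by (rule frechet_derivative_transform_within_open[OF _ chart_image_open'[OF c(1)]])
      (use c in \<open>auto simp: chart_coord_def intro!: bounded_linear_imp_differentiable bounded_linear_vec_nth\<close>)
  moreover have "frechet_derivative (\<lambda>x::real^'n. x $ i) (at (snd c p)) = (\<lambda>x. x $ i)"
    by (rule frechet_derivative_at[symmetric] bounded_linear_imp_has_derivative bounded_linear_vec_nth)+
  ultimately show ?thesis
    using coord_vec_smooth[OF smooth_chart_coord[OF c(1)] chart_open[OF c(1)] c(2)] by metis
qed

lemma tspace_expand:
  assumes X: "X \<in> tspace M p" and c: "c \<in> charts M" "p \<in> fst c"
  shows "X = (\<Sum>i\<in>UNIV. tscale (X (chart_coord c i)) (coord_vec M c (axis i 1) p))"
proof -
  obtain v where v: "X = coord_vec M c v p" using tspace_obtain[OF X c] .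
  have "coord_vec M c (\<Sum>i\<in>I. v $ i *\<^sub>R axis i 1) p = (\<Sum>i\<in>I. tscale (v $ i) (coord_vec M c (axis i 1) p))"
    if "finite I" for I
    using that
  proof (induction I)
    case empty
    show ?case using coord_vec_add[OF c, of 0 0] by simp
  qed (simp add: coord_vec_add[OF c] coord_vec_scale[OF c])
  from this[of UNIV] show ?thesis
    unfolding vec_expand[symmetric] v coord_vec_chart_coord[OF c] by simp
qed

text \<open>The scaling \<open>s\<close> of the target is left open so that one expansion serves
  covectors, bundle-valued forms and endomorphism-valued forms.\<close>

lemma tspace_linear_expand:
  fixes L :: "'m tvec \<Rightarrow> 'x::ab_group_add"
  assumes add: "\<And>X Y. X \<in> tspace M p \<Longrightarrow> Y \<in> tspace M p \<Longrightarrow> L (X + Y) = L X + L Y"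
    and scale: "\<And>X r. X \<in> tspace M p \<Longrightarrow> L (tscale r X) = s r (L X)"
    and X: "X \<in> tspace M p" and c: "c \<in> charts M" "p \<in> fst c"
  shows "L X = (\<Sum>i\<in>UNIV. s (X (chart_coord c i)) (L (coord_vec M c (axis i 1) p)))"
proof -
  have "L X = L (\<Sum>i\<in>UNIV. tscale (X (chart_coord c i)) (coord_vec M c (axis i 1) p))"
    using tspace_expand[OF X c] by simp
  also have "\<dots> = (\<Sum>i\<in>UNIV. L (tscale (X (chart_coord c i)) (coord_vec M c (axis i 1) p)))"
    using c by (intro tspace_additive_sum add) (auto intro!: tspace_scale coord_vec_in)
  finally show ?thesis using c by (simp add: scale coord_vec_in)
qed

lemma tvec_cong:
  assumes "X \<in> tspace M p" "open U" "p \<in> U" "smooth_fun M U f" "\<And>q. q \<in> U \<Longrightarrow> f q = g q"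
  shows "X f = X g"
proof -
  obtain c v where c: "c \<in> charts M" "p \<in> fst c" and X: "X = coord_vec M c v p"
    using assms(1) by (auto simp: tspace_def)
  have g: "smooth_fun M U g" using smooth_fun_cong[OF assms(4,2,5)] .
  have "frechet_derivative (f \<circ> chart_inv c) (at (snd c p)) = frechet_derivative (g \<circ> chart_inv c) (at (snd c p))"
    by (rule frechet_derivative_transform_within_open[OF smooth_at_chart[OF assms(4) c(1) assms(3) c(2)]
          chart_image_open[OF c(1) assms(2)]]) (use c assms in auto)
  then show ?thesis
    using coord_vec_smooth[OF g assms(2,3)] coord_vec_smooth[OF assms(4,2,3)] X by simp
qed

lemma tvec_const [simp]: "X \<in> tspace M p \<Longrightarrow> X (\<lambda>q. k) = 0"
  using coord_vec_smooth[OF smooth_fun_const open_UNIV]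
  by (force simp: tspace_def o_def)

lemma tvec_add:
  assumes "X \<in> tspace M p" "open U" "p \<in> U" "smooth_fun M U f" "smooth_fun M U g"
  shows "X (\<lambda>q. f q + g q) = X f + X g"
proof -
  obtain c v where c: "c \<in> charts M" "p \<in> fst c" and X: "X = coord_vec M c v p"
    using assms(1) by (auto simp: tspace_def)
  let ?D = "\<lambda>f. frechet_derivative (f \<circ> chart_inv c) (at (snd c p))"
  have "(((\<lambda>q. f q + g q) \<circ> chart_inv c) has_derivative (\<lambda>v. ?D f v + ?D g v)) (at (snd c p))"
    unfolding o_def
    by (intro has_derivative_add)
      (use smooth_at_chart[OF assms(4) c(1) assms(3) c(2)] smooth_at_chart[OF assms(5) c(1) assms(3) c(2)]
        in \<open>simp_all add: frechet_derivative_works o_def\<close>)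
  from fun_cong[OF frechet_derivative_at[OF this], of v] show ?thesis
    using coord_vec_smooth[OF assms(4,2,3), of c v] coord_vec_smooth[OF assms(5,2,3), of c v]
      coord_vec_smooth[OF smooth_fun_add[OF assms(2,4,5)] assms(2,3), of c v] X by (simp add: o_def)
qed

lemma tvec_mult:
  assumes "X \<in> tspace M p" "open U" "p \<in> U" "smooth_fun M U f" "smooth_fun M U g"
  shows "X (\<lambda>q. f q * g q) = X f * g p + f p * X g"
proof -
  obtain c v where c: "c \<in> charts M" "p \<in> fst c" and X: "X = coord_vec M c v p"
    using assms(1) by (auto simp: tspace_def)
  let ?D = "\<lambda>f. frechet_derivative (f \<circ> chart_inv c) (at (snd c p))"
  have "(((\<lambda>q. f q * g q) \<circ> chart_inv c) has_derivative
      (\<lambda>v. f (chart_inv c (snd c p)) * ?D g v + ?D f v * g (chart_inv c (snd c p)))) (at (snd c p))"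
    unfolding o_def
    by (intro has_derivative_mult)
      (use smooth_at_chart[OF assms(4) c(1) assms(3) c(2)] smooth_at_chart[OF assms(5) c(1) assms(3) c(2)]
        in \<open>simp_all add: frechet_derivative_works o_def\<close>)
  from fun_cong[OF frechet_derivative_at[OF this], of v] show ?thesis
    using coord_vec_smooth[OF assms(4,2,3), of c v] coord_vec_smooth[OF assms(5,2,3), of c v]
      coord_vec_smooth[OF smooth_fun_mult[OF assms(2,4,5)] assms(2,3), of c v] X c by (simp add: o_def)
qed

lemma tvec_sum:
  assumes "X \<in> tspace M p" "open U" "p \<in> U" "finite I" "\<And>i. i \<in> I \<Longrightarrow> smooth_fun M U (f i)"
  shows "X (\<lambda>q. \<Sum>i\<in>I. f i q) = (\<Sum>i\<in>I. X (f i))"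
  using assms(4,5)
proof (induction I)
  case empty
  then show ?case using assms(1) by simp
next
  case (insert i I)
  then show ?case
    using tvec_add[OF assms(1-3) _ smooth_fun_sum[OF assms(2)], of "f i" I f] by simp
qed

lemma smooth_fun_coord_vec:
  assumes c: "c \<in> charts M" and U: "open U" and f: "smooth_fun M U f"
  shows "smooth_fun M (U \<inter> fst c) (\<lambda>q. coord_vec M c v q f)"
proof (rule smooth_fun_chartI[OF c])
  show "open (U \<inter> fst c)" using U chart_open[OF c] by blast
  have "smooth_on (snd c ` (U \<inter> fst c)) (\<lambda>x. frechet_derivative (f \<circ> chart_inv c) (at x) v)"
    using f c by (intro smooth_on_frechet_derivative) (simp add: smooth_fun_iff)
  then show "smooth_on (snd c ` (U \<inter> fst c)) ((\<lambda>q. coord_vec M c v q f) \<circ> chart_inv c)"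
    by (rule smooth_on_cong[OF _ chart_image_open[OF c U]])
      (use c coord_vec_smooth[OF f U, of _ c] in auto)
qed simp

text \<open>Coordinate fields have vanishing Lie bracket: this is the symmetry of second derivatives
  in the chart. It is the reason why the coordinate formulas for \<open>ext_d\<close>,
  \<open>nabla1\<close>, \<open>curvature\<close> and \<open>nabla_u\<close> have no bracket
  term.\<close>

lemma coord_vec_commute:
  assumes c: "c \<in> charts M" "p \<in> fst c" and U: "open U" "p \<in> U" and f: "smooth_fun M U f"
  shows "coord_vec M c v p (\<lambda>q. coord_vec M c w q f) = coord_vec M c w p (\<lambda>q. coord_vec M c v q f)"
proof -
  let ?h = "f \<circ> chart_inv c" and ?V = "snd c ` (U \<inter> fst c)"
  have V: "open ?V" "snd c p \<in> ?V" using chart_image_open[OF c(1) U(1)] c U by auto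
  have h: "smooth_on ?V ?h" using f c by (simp add: smooth_fun_iff)
  have UV: "open (U \<inter> fst c)" "p \<in> U \<inter> fst c" using U chart_open[OF c(1)] c by auto
  have "coord_vec M c v p (\<lambda>q. coord_vec M c w q f) =
     frechet_derivative (\<lambda>x. frechet_derivative ?h (at x) w) (at (snd c p)) v" for v w
  proof -
    have "frechet_derivative (\<lambda>x. frechet_derivative ?h (at x) w) (at (snd c p)) =
       frechet_derivative ((\<lambda>q. coord_vec M c w q f) \<circ> chart_inv c) (at (snd c p))"
      by (rule frechet_derivative_transform_within_open[OF smooth_on_imp_differentiable[OF
              smooth_on_frechet_derivative[OF h]] V(1)])
        (use V coord_vec_smooth[OF f U(1), of _ c] c in auto)
    then show ?thesis
      using coord_vec_smooth[OF smooth_fun_coord_vec[OF c(1) U(1) f] UV, of c v] by simp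
  qed
  then show ?thesis using frechet_derivative_commute[OF h V] by metis
qed

subsection \<open>Differential forms\<close>

lemma covector_eval: "covector M p (\<lambda>Z. Z f)"
  by (auto simp: covector_def tscale_def)

lemma covector_expand:
  assumes "covector M p \<eta>" "X \<in> tspace M p" "c \<in> charts M" "p \<in> fst c"
  shows "\<eta> X = (\<Sum>i\<in>UNIV. X (chart_coord c i) * \<eta> (coord_vec M c (axis i 1) p))"
  by (rule tspace_linear_expand[OF _ _ assms(2-4)]) (use assms(1) in \<open>unfold covector_def, blast+\<close>)

text \<open>The form is the differential of the \<open>i\<close>-th coordinate, since a tangent
  vector acts on functions. These differentials are the scalar parts of every explicit decomposition
  below.\<close>

lemma coord_form_in:
  assumes "c \<in> charts M" "open U" "U \<subseteq> fst c"
  shows "(\<lambda>q Z. Z (chart_coord c i)) \<in> real_form1 M U"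
  unfolding real_form1_def
  using smooth_fun_coord_vec[OF _ assms(2) smooth_fun_subset[OF smooth_chart_coord[OF assms(1)] assms(3)]]
  by (auto simp: covector_eval)

text \<open>The two sums in the definition of \<^const>\<open>ext_d\<close> over different decompositions agree since
  second derivatives of the \<open>g\<^sub>a\<close> in one chart commute.\<close>

lemma ext_d_coord:
  assumes \<beta>: "\<beta> \<in> real_form1 M U" and U: "open U" "p \<in> U" and c: "c \<in> charts M" "p \<in> fst c"
  shows "ext_d M \<beta> p (coord_vec M c v p) (coord_vec M c w p) =
     coord_vec M c v p (\<lambda>q. \<beta> q (coord_vec M c w q)) - coord_vec M c w p (\<lambda>q. \<beta> q (coord_vec M c v q))"
proof -
  let ?Q = "\<lambda>r U (N::nat) f g. open U \<and> p \<in> U \<and>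
     (\<forall>a<N. smooth_fun M U (f a :: 'm \<Rightarrow> real) \<and> smooth_fun M U (g a :: 'm \<Rightarrow> real)) \<and>
     (\<forall>q\<in>U. \<forall>Z\<in>tspace M q. \<beta> q Z = (\<Sum>a<N. f a q * Z (g a))) \<and>
     r = (\<Sum>a<N. coord_vec M c v p (f a) * coord_vec M c w p (g a) - coord_vec M c w p (f a) * coord_vec M c v p (g a))"
  let ?P = "\<lambda>r. \<exists>U N f g. ?Q r U N f g"
  let ?r = "coord_vec M c v p (\<lambda>q. \<beta> q (coord_vec M c w q)) - coord_vec M c w p (\<lambda>q. \<beta> q (coord_vec M c v q))"
  have uniq: "r = ?r" if P: "?P r" for r
  proof -
    from P obtain V N f g where Q: "?Q r V N f g" by (elim exE)
    then have V: "open V" "p \<in> V" and f: "\<And>a. a < N \<Longrightarrow> smooth_fun M V (f a)"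
      and g: "\<And>a. a < N \<Longrightarrow> smooth_fun M V (g a)"
      and rep: "\<And>q Z. q \<in> V \<Longrightarrow> Z \<in> tspace M q \<Longrightarrow> \<beta> q Z = (\<Sum>a<N. f a q * Z (g a))"
      and r: "r = (\<Sum>a<N. coord_vec M c v p (f a) * coord_vec M c w p (g a) - coord_vec M c w p (f a) * coord_vec M c v p (g a))"
      by blast+
    let ?W = "U \<inter> V \<inter> fst c"
    have W: "open ?W" "p \<in> ?W" using U V c chart_open[OF c(1)] by auto
    have fW: "smooth_fun M ?W (f a)" and gW: "smooth_fun M ?W (\<lambda>q. coord_vec M c w q (g a))" if "a < N" for a w
      by (rule smooth_fun_subset[OF f[OF that]], blast)
        (rule smooth_fun_subset[OF smooth_fun_coord_vec[OF c(1) V(1) g[OF that]]], blast)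
    have *: "coord_vec M c v p (\<lambda>q. \<beta> q (coord_vec M c w q)) =
      (\<Sum>a<N. coord_vec M c v p (f a) * coord_vec M c w p (g a) +
         f a p * coord_vec M c v p (\<lambda>q. coord_vec M c w q (g a)))" for v w
    proof -
      have "coord_vec M c v p (\<lambda>q. \<beta> q (coord_vec M c w q)) =
        coord_vec M c v p (\<lambda>q. \<Sum>a<N. f a q * coord_vec M c w q (g a))"
        by (rule tvec_cong[OF coord_vec_in[OF c] W])
          (use smooth_fun_subset[OF real_form1_coord[OF \<beta> c(1)], of ?W w] rep coord_vec_in[OF c(1)] in auto)
      also have "\<dots> = (\<Sum>a<N. coord_vec M c v p (\<lambda>q. f a q * coord_vec M c w q (g a)))"
        by (rule tvec_sum[OF coord_vec_in[OF c] W]) (auto intro!: smooth_fun_mult W fW gW)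
      finally show ?thesis
        using tvec_mult[OF coord_vec_in[OF c] W fW gW] by simp
    qed
    show ?thesis unfolding r *[of v w] *[of w v] sum_subtractf[symmetric]
      using coord_vec_commute[OF c V g, of _ v w] by (intro sum.cong) auto
  qed
  have "?P ?r"
  proof -
    let ?V = "U \<inter> fst c"
    \<comment> \<open>The decomposition of \<beta> into its components times the coordinate
      differentials.\<close>
    let ?f = "\<lambda>a q. \<beta> q (coord_vec M c (axis (enum_UNIV a :: 'n) 1) q)"
    let ?g = "\<lambda>a. chart_coord c (enum_UNIV a)"
    have V: "open ?V" "p \<in> ?V" using U c chart_open[OF c(1)] by auto
    have s: "smooth_fun M ?V (?f a) \<and> smooth_fun M ?V (?g a)" for a
      using real_form1_coord[OF \<beta> c(1)] smooth_fun_subset[OF smooth_chart_coord[OF c(1)]] by auto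
    have rep: "\<beta> q Z = (\<Sum>a<CARD('n). ?f a q * Z (?g a))" if "q \<in> ?V" "Z \<in> tspace M q" for q Z
    proof -
      have "covector M q (\<beta> q)" using \<beta> that by (auto simp: real_form1_def)
      from covector_expand[OF this that(2) c(1)] that show ?thesis
        by (subst sum_enum_UNIV[of "\<lambda>i. \<beta> q (coord_vec M c (axis i 1) q) * Z (chart_coord c i)"])
          (simp add: mult.commute)
    qed
    \<comment> \<open>The value belonging to this decomposition need not be computed, because
      \<open>uniq\<close> identifies it with \<open>?r\<close>.\<close>
    define r where "r = (\<Sum>a<CARD('n). coord_vec M c v p (?f a) * coord_vec M c w p (?g a) -
      coord_vec M c w p (?f a) * coord_vec M c v p (?g a))"
    have "?Q r ?V (CARD('n)) ?f ?g"
      by (intro conjI allI impI ballI V rep r_def conjunct1[OF s] conjunct2[OF s])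
    then have "?P r" by (intro exI)
    with uniq[OF this] show ?thesis by (simp only:)
  qed
  then show ?thesis unfolding ext_d_def using uniq by (intro the_equality)
qed

end

section \<open>Orthonormal bases\<close>

text \<open>Common setting for the tangent spaces (real scalars, \<open>cj = id\<close>) and the
  fibres (complex scalars, \<open>cj = cnj\<close>). Positivity is phrased as
  \<open>h v v = r * cj r\<close> with \<open>r\<close> nonzero: this supplies the square root
  needed to normalise a vector without an order on the scalars.\<close>

locale sesquilinear_space = vector_space scale
  for scale :: "'k::field \<Rightarrow> 'v::ab_group_add \<Rightarrow> 'v" +
  fixes S :: "'v set" and h :: "'v \<Rightarrow> 'v \<Rightarrow> 'k" and cj :: "'k \<Rightarrow> 'k"
  assumes subspace_S: "subspace S"
    and h_add: "u \<in> S \<Longrightarrow> v \<in> S \<Longrightarrow> w \<in> S \<Longrightarrow> h (u + v) w = h u w + h v w"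
    and h_scale: "v \<in> S \<Longrightarrow> w \<in> S \<Longrightarrow> h (scale z v) w = z * h v w"
    and h_cj: "v \<in> S \<Longrightarrow> w \<in> S \<Longrightarrow> h w v = cj (h v w)"
    and cj_add: "cj (x + y) = cj x + cj y"
    and cj_mult: "cj (x * y) = cj x * cj y"
    and cj_one: "cj 1 = 1"
    and h_pos: "v \<in> S \<Longrightarrow> v \<noteq> 0 \<Longrightarrow> \<exists>r. r \<noteq> 0 \<and> h v v = r * cj r"
begin

definition orthonormal :: "'i set \<Rightarrow> ('i \<Rightarrow> 'v) \<Rightarrow> bool" where
  "orthonormal I u \<longleftrightarrow> (\<forall>i\<in>I. u i \<in> S) \<and> (\<forall>i\<in>I. \<forall>j\<in>I. h (u i) (u j) = (if i = j then 1 else 0))"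

text \<open>Independence of an indexed family and not of a set: a repeated vector counts as
  dependent, and the coefficients carry the indices of a frame.\<close>

definition free_family :: "'i set \<Rightarrow> ('i \<Rightarrow> 'v) \<Rightarrow> bool" where
  "free_family I e \<longleftrightarrow> (\<forall>c. (\<Sum>i\<in>I. scale (c i) (e i)) = 0 \<longrightarrow> (\<forall>i\<in>I. c i = 0))"

lemma cj_zero [simp]: "cj 0 = 0"
  by (metis add.right_neutral add_left_cancel cj_add)

lemma S_add: "u \<in> S \<Longrightarrow> v \<in> S \<Longrightarrow> u + v \<in> S"
  and S_scale: "u \<in> S \<Longrightarrow> scale z u \<in> S"
  and S_zero: "0 \<in> S"
  and S_diff: "u \<in> S \<Longrightarrow> v \<in> S \<Longrightarrow> u - v \<in> S"
  using subspace_S by (auto intro: subspace_add subspace_scale subspace_0 subspace_diff)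

lemma S_sum: "(\<And>i. i \<in> I \<Longrightarrow> f i \<in> S) \<Longrightarrow> (\<Sum>i\<in>I. f i) \<in> S"
  by (rule subspace_sum[OF subspace_S])

lemma h_zero: "w \<in> S \<Longrightarrow> h 0 w = 0"
  by (metis S_zero add.right_neutral add_left_cancel h_add)

lemma h_diff: "u \<in> S \<Longrightarrow> v \<in> S \<Longrightarrow> w \<in> S \<Longrightarrow> h (u - v) w = h u w - h v w"
  using h_add[of "u - v" v w] S_diff by (simp add: algebra_simps)

lemma h_sum: "w \<in> S \<Longrightarrow> (\<And>i. i \<in> I \<Longrightarrow> f i \<in> S) \<Longrightarrow> h (\<Sum>i\<in>I. f i) w = (\<Sum>i\<in>I. h (f i) w)"
  by (induction I rule: infinite_finite_induct) (auto simp: h_zero h_add S_sum)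

lemma h_lincomb:
  "w \<in> S \<Longrightarrow> (\<And>i. i \<in> I \<Longrightarrow> f i \<in> S) \<Longrightarrow> h (\<Sum>i\<in>I. scale (c i) (f i)) w = (\<Sum>i\<in>I. c i * h (f i) w)"
  by (simp add: h_sum S_scale h_scale)

lemma orthonormal_coeff:
  assumes "orthonormal I u" "finite I" "j \<in> I"
  shows "h (\<Sum>i\<in>I. scale (c i) (u i)) (u j) = c j"
proof -
  have "h (\<Sum>i\<in>I. scale (c i) (u i)) (u j) = (\<Sum>i\<in>I. c i * (if i = j then 1 else 0))"
    using assms by (subst h_lincomb) (auto simp: orthonormal_def intro!: sum.cong)
  also have "\<dots> = c j" using assms by (simp add: if_distrib sum.delta cong: if_cong)
  finally show ?thesis .
qed

lemma span_family:
  "finite J \<Longrightarrow> x \<in> span (e ` J) \<Longrightarrow> \<exists>c. x = (\<Sum>j\<in>J. scale (c j) (e j))"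
proof (induction J arbitrary: x rule: finite_induct)
  case empty
  then show ?case by simp
next
  case (insert j J)
  then obtain k where "x - scale k (e j) \<in> span (e ` J)"
    by (auto simp: span_insert)
  then obtain c where c: "x - scale k (e j) = (\<Sum>j\<in>J. scale (c j) (e j))"
    using insert.IH by blast
  have "(\<Sum>i\<in>J. scale ((c(j := k)) i) (e i)) = (\<Sum>j\<in>J. scale (c j) (e j))"
    using insert.hyps by (intro sum.cong) auto
  then have "x = (\<Sum>i\<in>insert j J. scale ((c(j := k)) i) (e i))"
    using insert.hyps c by (simp add: algebra_simps)
  then show ?case by blast
qed

text \<open>The span inclusion is carried through the induction because it is what keeps the
  residual of the next vector from vanishing.\<close>

lemma gram_schmidt:
  assumes "finite J" "\<And>j. j \<in> J \<Longrightarrow> e j \<in> S" "free_family J e"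
  shows "\<exists>u. orthonormal J u \<and> u ` J \<subseteq> span (e ` J)"
  using assms
proof (induction J rule: finite_induct)
  case empty
  show ?case by (auto simp: orthonormal_def)
next
  case (insert j J)
  have nj: "e j \<noteq> (\<Sum>i\<in>J. scale (c i) (e i))" for c
  proof
    assume eq: "e j = (\<Sum>i\<in>J. scale (c i) (e i))"
    \<comment> \<open>Moving \<open>e j\<close> to the other side gives a relation whose coefficient
      at \<open>j\<close> is \<open>-1\<close>, which freeness excludes.\<close>
    have "(\<Sum>i\<in>J. scale ((c(j := -1)) i) (e i)) = (\<Sum>i\<in>J. scale (c i) (e i))"
      using insert.hyps by (intro sum.cong) auto
    then have "(\<Sum>i\<in>insert j J. scale ((c(j := -1)) i) (e i)) = 0"
      using insert.hyps eq[symmetric] by simp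
    then have "(c(j := -1)) j = 0"
      using insert.prems(2) unfolding free_family_def by blast
    then show False by simp
  qed
  have "free_family J e"
    unfolding free_family_def
  proof (intro allI impI ballI)
    fix c i assume c: "(\<Sum>i\<in>J. scale (c i) (e i)) = 0" and i: "i \<in> J"
    have "(\<Sum>i\<in>J. scale ((c(j := 0)) i) (e i)) = (\<Sum>i\<in>J. scale (c i) (e i))"
      using insert.hyps by (intro sum.cong) auto
    then have "(\<Sum>i\<in>insert j J. scale ((c(j := 0)) i) (e i)) = 0"
      using insert.hyps c by simp
    then have "(c(j := 0)) i = 0"
      using insert.prems(2) i unfolding free_family_def by blast
    then show "c i = 0" using i insert.hyps by (auto split: if_splits)
  qed
  then obtain u where u: "orthonormal J u" "u ` J \<subseteq> span (e ` J)"
    using insert by auto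
  have uS: "u i \<in> S" if "i \<in> J" for i using u(1) that by (simp add: orthonormal_def)
  have ej: "e j \<in> S" using insert.prems by simp
  \<comment> \<open>The residual of \<open>e j\<close> after projection onto the orthonormal family
    built so far; if it were zero, \<open>e j\<close> would be a combination of the earlier
    \<open>e i\<close>.\<close>
  define w where "w = e j - (\<Sum>i\<in>J. scale (h (e j) (u i)) (u i))"
  have sp: "(\<Sum>i\<in>J. scale (h (e j) (u i)) (u i)) \<in> span (e ` J)"
    using u(2) by (intro span_sum span_scale) auto
  have wS: "w \<in> S" unfolding w_def using ej uS by (intro S_diff S_sum S_scale)
  have "w \<noteq> 0"
  proof -
    obtain c where "(\<Sum>i\<in>J. scale (h (e j) (u i)) (u i)) = (\<Sum>i\<in>J. scale (c i) (e i))"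
      using span_family[OF insert.hyps(1) sp] by blast
    then show ?thesis using nj[of c] by (simp add: w_def)
  qed
  then obtain r where r: "r \<noteq> 0" "h w w = r * cj r" using h_pos[OF wS] by auto
  have orth: "h w (u i) = 0" if "i \<in> J" for i
    unfolding w_def using orthonormal_coeff[OF u(1) insert.hyps(1) that]
    by (subst h_diff[OF ej S_sum[OF S_scale[OF uS]] uS[OF that]]) simp_all
  \<comment> \<open>Multiplicativity makes \<open>cj (inverse r)\<close> the inverse of
    \<open>cj r\<close>, so scaling by \<open>inverse r\<close> normalises \<open>w\<close>.\<close>
  have "cj (inverse r) * cj r = 1"
    using cj_mult[of "inverse r" r] r cj_one by simp
  then have rr: "inverse r * cj (inverse r) * (r * cj r) = 1"
    using r(1) by (simp add: field_simps)
  define x where "x = scale (inverse r) w"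
  have xS: "x \<in> S" unfolding x_def by (rule S_scale[OF wS])
  have xx: "h x x = 1"
    unfolding x_def using wS rr
    by (simp add: h_scale S_scale h_cj[of "scale (inverse r) w" w] cj_mult r(2) mult.assoc)
      (simp add: h_cj[of w w, symmetric] r(2)[symmetric] mult.assoc cj_mult[symmetric])
  have xu: "h x (u i) = 0" "h (u i) x = 0" if "i \<in> J" for i
  proof -
    show *: "h x (u i) = 0" unfolding x_def using wS uS[OF that] orth[OF that] by (simp add: h_scale)
    show "h (u i) x = 0" using h_cj[OF xS uS[OF that]] * by simp
  qed
  have "x \<in> span (e ` insert j J)"
    unfolding x_def w_def
    using sp span_mono[of "e ` J" "e ` insert j J"]
    by (intro span_scale span_diff) (auto intro: span_base)
  moreover have "u ` J \<subseteq> span (e ` insert j J)"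
    using u(2) span_mono[of "e ` J" "e ` insert j J"] by auto
  moreover have "orthonormal (insert j J) (u(j := x))"
    unfolding orthonormal_def using insert.hyps u(1) xS xx xu
    by (auto simp: orthonormal_def)
  moreover have "(u(j := x)) ` insert j J = insert x (u ` J)"
    using insert.hyps by auto
  ultimately show ?case
    by (metis insert_subset)
qed

text \<open>Completeness by counting: a nonzero residual would be orthogonal to the whole family and
  extend it to \<open>card I + 1\<close> independent vectors inside the span of at most
  \<open>card I\<close> vectors.\<close>

lemma orthonormal_expand:
  assumes u: "orthonormal I u" and "finite I" "finite T" "S \<subseteq> span T" "card T \<le> card I" and v: "v \<in> S"
  shows "v = (\<Sum>i\<in>I. scale (h v (u i)) (u i))"
proof (rule ccontr)
  define w where "w = v - (\<Sum>i\<in>I. scale (h v (u i)) (u i))"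
  assume "v \<noteq> (\<Sum>i\<in>I. scale (h v (u i)) (u i))"
  then have "w \<noteq> 0" by (simp add: w_def)
  have uS: "u i \<in> S" if "i \<in> I" for i using u that by (simp add: orthonormal_def)
  have wS: "w \<in> S" unfolding w_def using v uS by (intro S_diff S_sum S_scale)
  have ww: "h w w \<noteq> 0"
    using h_pos[OF wS \<open>w \<noteq> 0\<close>] cj_mult[of _ "inverse _"] cj_one
    by (metis field_class.field_inverse mult.commute mult_eq_0_iff zero_neq_one)
  have wu: "h w (u i) = 0" if "i \<in> I" for i
    unfolding w_def using orthonormal_coeff[OF u assms(2) that]
    by (subst h_diff[OF v S_sum[OF S_scale[OF uS]] uS[OF that]]) simp_all
  have uw: "h (u i) w = 0" if "i \<in> I" for i
    using h_cj[OF wS uS[OF that]] wu[OF that] by simp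
  have inj: "inj_on u I"
    using u unfolding inj_on_def orthonormal_def by (metis zero_neq_one)
  have wI: "w \<notin> u ` I"
    using wu ww by auto
  let ?A = "insert w (u ` I)"
  have AS: "?A \<subseteq> S" using wS uS by auto
  have orth: "h x y = 0" if "x \<in> ?A" "y \<in> ?A" "x \<noteq> y" for x y
    using that wu uw u by (auto simp: orthonormal_def)
  have pos: "h x x \<noteq> 0" if "x \<in> ?A" for x
    using that ww u by (auto simp: orthonormal_def)
  have "independent ?A"
  proof (rule independent_if_scalars_zero)
    fix f x assume s: "(\<Sum>y\<in>?A. scale (f y) y) = 0" and x: "x \<in> ?A"
    have "0 = h (\<Sum>y\<in>?A. scale (f y) y) x" using s x AS h_zero by auto
    also have "\<dots> = (\<Sum>y\<in>?A. f y * h y x)"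
      using x AS by (intro h_lincomb) auto
    also have "\<dots> = (\<Sum>y\<in>?A. if y = x then f x * h x x else 0)"
      using orth x by (intro sum.cong) auto
    also have "\<dots> = f x * h x x" using x assms(2) by (simp add: sum.delta)
    finally show "f x = 0" using pos[OF x] by simp
  qed (use assms(2) in simp)
  then have "card ?A \<le> card T"
    using independent_span_bound[OF assms(3)] AS assms(4) by blast
  moreover have "card ?A = Suc (card I)"
    using wI inj assms(2) by (simp add: card_image)
  ultimately show False using assms(5) by simp
qed

text \<open>The coefficients of \<open>e\<close> in terms of \<open>u\<close> and those of
  \<open>u\<close> in terms of \<open>e\<close> form mutually inverse matrices: expanding
  \<open>e k\<close> in \<open>u\<close> and back in \<open>e\<close> must return
  \<open>e k\<close>, and freeness compares coefficients.\<close>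

lemma change_of_basis:
  assumes "finite I" and e: "\<And>i. i \<in> I \<Longrightarrow> e i \<in> S" "free_family I e"
    and ex: "\<And>v. v \<in> S \<Longrightarrow> v = (\<Sum>i\<in>I. scale (h v (u i)) (u i))"
    and B: "\<And>l. l \<in> I \<Longrightarrow> u l = (\<Sum>k\<in>I. scale (B l k) (e k))"
    and km: "k \<in> I" "m \<in> I"
  shows "(\<Sum>l\<in>I. h (e k) (u l) * B l m) = (if k = m then 1 else 0)"
proof -
  let ?d = "\<lambda>m. (\<Sum>l\<in>I. h (e k) (u l) * B l m)"
  have "e k = (\<Sum>l\<in>I. scale (h (e k) (u l)) (u l))"
    using ex e km by auto
  also have "\<dots> = (\<Sum>l\<in>I. scale (h (e k) (u l)) (\<Sum>m\<in>I. scale (B l m) (e m)))"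
    using B by (intro sum.cong) auto
  also have "\<dots> = (\<Sum>l\<in>I. \<Sum>m\<in>I. scale (h (e k) (u l) * B l m) (e m))"
    by (simp add: scale_sum_right)
  also have "\<dots> = (\<Sum>m\<in>I. scale (?d m) (e m))"
    by (subst sum.swap) (simp add: scale_sum_left)
  finally have 1: "e k = (\<Sum>m\<in>I. scale (?d m) (e m))" .
  have "(\<Sum>m\<in>I. scale (if k = m then 1 else 0) (e m)) = (\<Sum>m\<in>I. if k = m then e m else 0)"
    by (intro sum.cong) auto
  then have 2: "e k = (\<Sum>m\<in>I. scale (if k = m then 1 else 0) (e m))"
    using km assms(1) by simp
  have "(\<Sum>m\<in>I. scale (?d m - (if k = m then 1 else 0)) (e m)) = 0"
    unfolding scale_left_diff_distrib sum_subtractf using 1 2 by simp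
  then have "?d m - (if k = m then 1 else 0) = 0"
    by (rule e(2)[unfolded free_family_def, THEN spec, THEN mp, THEN bspec, OF _ km(2)])
  then show ?thesis by simp
qed

text \<open>Independence of the trace from the basis. It exchanges an orthonormal basis chosen at a
  single point for a frame \<open>e\<close>, in which the matrix \<open>m\<close> can be smooth in
  the point.\<close>

lemma trace_eq:
  assumes "finite I" and e: "\<And>i. i \<in> I \<Longrightarrow> e i \<in> S" "free_family I e"
    and u: "orthonormal I u" and ex: "\<And>v. v \<in> S \<Longrightarrow> v = (\<Sum>i\<in>I. scale (h v (u i)) (u i))"
    and B: "\<And>l. l \<in> I \<Longrightarrow> u l = (\<Sum>k\<in>I. scale (B l k) (e k))"
    and f_add: "\<And>v w. v \<in> S \<Longrightarrow> w \<in> S \<Longrightarrow> f (v + w) = f v + f w"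
    and f_scale: "\<And>v z. v \<in> S \<Longrightarrow> f (scale z v) = scale z (f v)"
    and m: "\<And>k. k \<in> I \<Longrightarrow> f (e k) = (\<Sum>l\<in>I. scale (m k l) (e l))"
  shows "(\<Sum>i\<in>I. h (f (u i)) (u i)) = (\<Sum>k\<in>I. m k k)"
proof -
  have uS: "u i \<in> S" if "i \<in> I" for i using u that by (simp add: orthonormal_def)
  have f0: "f 0 = 0" using f_add[OF S_zero S_zero] by simp
  have f_sum: "f (\<Sum>i\<in>J. g i) = (\<Sum>i\<in>J. f (g i))" if "\<And>i. i \<in> J \<Longrightarrow> g i \<in> S" for J and g :: "'a \<Rightarrow> 'v"
    using that by (induction J rule: infinite_finite_induct) (auto simp: f0 f_add S_sum)
  have mS: "(\<Sum>l\<in>I. scale (c l) (e l)) \<in> S" for c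
    using e by (intro S_sum S_scale) auto
  have "h (f (u i)) (u i) = (\<Sum>k\<in>I. \<Sum>l\<in>I. m k l * (h (e l) (u i) * B i k))" if i: "i \<in> I" for i
  proof -
    have inner: "h (\<Sum>l\<in>I. scale (c l) (e l)) (u i) = (\<Sum>l\<in>I. c l * h (e l) (u i))" for c
      by (rule h_lincomb[OF uS[OF i] e(1)])
    have "f (u i) = (\<Sum>k\<in>I. scale (B i k) (\<Sum>l\<in>I. scale (m k l) (e l)))"
      using B[OF i] e m by (simp add: f_sum S_scale f_scale)
    then have "h (f (u i)) (u i) = (\<Sum>k\<in>I. B i k * (\<Sum>l\<in>I. m k l * h (e l) (u i)))"
      using h_lincomb[OF uS[OF i], of I "\<lambda>k. \<Sum>l\<in>I. scale (m k l) (e l)" "B i"]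
        inner mS by simp
    then show ?thesis by (simp add: sum_distrib_left ac_simps)
  qed
  then have "(\<Sum>i\<in>I. h (f (u i)) (u i)) = (\<Sum>i\<in>I. \<Sum>k\<in>I. \<Sum>l\<in>I. m k l * (h (e l) (u i) * B i k))"
    by simp
  also have "\<dots> = (\<Sum>k\<in>I. \<Sum>i\<in>I. \<Sum>l\<in>I. m k l * (h (e l) (u i) * B i k))"
    by (rule sum.swap)
  also have "\<dots> = (\<Sum>k\<in>I. \<Sum>l\<in>I. \<Sum>i\<in>I. m k l * (h (e l) (u i) * B i k))"
    by (intro sum.cong refl sum.swap)
  also have "\<dots> = (\<Sum>k\<in>I. \<Sum>l\<in>I. m k l * (if l = k then 1 else 0))"
    using change_of_basis[OF assms(1) e ex B] by (simp add: sum_distrib_left[symmetric])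
  also have "\<dots> = (\<Sum>k\<in>I. m k k)"
    using assms(1) by (simp add: if_distrib sum.delta cong: if_cong)
  finally show ?thesis .
qed

end

section \<open>The Gram matrix and contractions over orthonormal bases\<close>

definition inv_gram :: "('m::topological_space, 'n::finite) rmfd \<Rightarrow>
    'm set \<times> ('m \<Rightarrow> real ^ 'n) \<Rightarrow> 'm \<Rightarrow> real ^ 'n ^ 'n" where
  "inv_gram M c p = matrix_inv (gram M c p)"

lemma matrix_inv_works:
  fixes A :: "real ^ 'n ^ 'n"
  assumes "det A \<noteq> 0"
  shows "A ** matrix_inv A = mat 1" "matrix_inv A ** A = mat 1"
proof -
  have "\<exists>B. A ** B = mat 1 \<and> B ** A = mat 1"
    using assms by (simp add: invertible_det_nz[symmetric] invertible_def)
  from someI_ex[OF this] show "A ** matrix_inv A = mat 1" "matrix_inv A ** A = mat 1"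
    by (simp_all add: matrix_inv_def)
qed

text \<open>Cramer's rule shows the entries as quotients of determinants, which is how smoothness of
  the inverse Gram matrix will be obtained.\<close>

lemma matrix_inv_cramer:
  fixes A :: "real ^ 'n ^ 'n"
  assumes "det A \<noteq> 0"
  shows "matrix_inv A $ k $ j = det (\<chi> i l. if l = k then axis j 1 $ i else A $ i $ l) / det A"
proof -
  have "A ** matrix_inv A = mat 1"
    by (rule matrix_inv_works(1)[OF assms])
  then have "A *v (matrix_inv A *v axis j 1) = axis j 1"
    by (simp add: matrix_vector_mul_assoc)
  then have "matrix_inv A *v axis j 1 = (\<chi> k. det (\<chi> i l. if l = k then axis j 1 $ i else A $ i $ l) / det A)"
    using cramer[OF assms] by blast
  then have "(matrix_inv A *v axis j 1) $ k = det (\<chi> i l. if l = k then axis j 1 $ i else A $ i $ l) / det A"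
    by (simp only: vec_lambda_beta)
  moreover have "(matrix_inv A *v axis j 1) $ k = matrix_inv A $ k $ j"
    by (simp add: matrix_vector_mul_component inner_axis)
  ultimately show ?thesis by (simp only:)
qed

context riemannian
begin

lemma vector_space_tscale: "vector_space (tscale :: real \<Rightarrow> 'm tvec \<Rightarrow> 'm tvec)"
  by unfold_locales (auto simp: tscale_def fun_eq_iff algebra_simps)

lemma metric_covector: "X \<in> tspace M p \<Longrightarrow> covector M p (metric M p X)"
  and metric_sym: "X \<in> tspace M p \<Longrightarrow> Y \<in> tspace M p \<Longrightarrow> metric M p X Y = metric M p Y X"
  and metric_pos: "X \<in> tspace M p \<Longrightarrow> X \<noteq> 0 \<Longrightarrow> metric M p X X > 0"
  and metric_smooth: "c \<in> charts M \<Longrightarrow>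
    smooth_fun M (fst c) (\<lambda>p. metric M p (coord_vec M c v p) (coord_vec M c w p))"
proof -
  note R = riemannian[unfolded oriented_riemannian_manifold_def]
  show "X \<in> tspace M p \<Longrightarrow> covector M p (metric M p X)"
    using R[THEN conjunct2, THEN conjunct1] by blast
  show "X \<in> tspace M p \<Longrightarrow> Y \<in> tspace M p \<Longrightarrow> metric M p X Y = metric M p Y X"
    using R[THEN conjunct2, THEN conjunct2, THEN conjunct1] by blast
  show "X \<in> tspace M p \<Longrightarrow> X \<noteq> 0 \<Longrightarrow> metric M p X X > 0"
    using R[THEN conjunct2, THEN conjunct2, THEN conjunct2, THEN conjunct1] by blast
  show "c \<in> charts M \<Longrightarrow>
    smooth_fun M (fst c) (\<lambda>p. metric M p (coord_vec M c v p) (coord_vec M c w p))"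
    using R[THEN conjunct2, THEN conjunct2, THEN conjunct2, THEN conjunct2] by blast
qed

lemma tangent_sesquilinear: "sesquilinear_space tscale (tspace M p) (metric M p) id"
proof -
  interpret vector_space "tscale :: real \<Rightarrow> 'm tvec \<Rightarrow> 'm tvec" by (rule vector_space_tscale)
  show ?thesis
  proof unfold_locales
    show "subspace (tspace M p)"
      by (auto intro: subspaceI tspace_zero tspace_add tspace_scale)
    show "metric M p (X + Y) Z = metric M p X Z + metric M p Y Z"
      if "X \<in> tspace M p" "Y \<in> tspace M p" "Z \<in> tspace M p" for X Y Z
      using metric_covector[OF that(3)] that metric_sym[OF _ that(3)] tspace_add[OF that(1,2)]
      unfolding covector_def by metis
    show "metric M p (tscale r X) Z = r * metric M p X Z"
      if "X \<in> tspace M p" "Z \<in> tspace M p" for X Z r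
      using metric_covector[OF that(2)] that metric_sym[OF _ that(2)] tspace_scale[OF that(1)]
      unfolding covector_def by metis
    show "\<exists>r. r \<noteq> 0 \<and> metric M p X X = r * id r" if "X \<in> tspace M p" "X \<noteq> 0" for X
      using metric_pos[OF that] by (intro exI[of _ "sqrt (metric M p X X)"]) auto
  qed (auto simp: metric_sym)
qed

sublocale tangent: sesquilinear_space tscale "tspace M p" "metric M p" id for p
  by (rule tangent_sesquilinear)

text \<open>Applying a vanishing combination to the \<open>i\<close>-th coordinate function isolates
  its \<open>i\<close>-th coefficient.\<close>

lemma coord_vec_free:
  assumes c: "c \<in> charts M" "p \<in> fst c"
  shows "tangent.free_family UNIV (\<lambda>i. coord_vec M c (axis i 1) p)"
  unfolding tangent.free_family_def
proof (intro allI impI ballI)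
  fix a :: "'n \<Rightarrow> real" and i
  assume a: "(\<Sum>i\<in>UNIV. tscale (a i) (coord_vec M c (axis i 1) p)) = 0"
  let ?X = "\<Sum>i\<in>UNIV. tscale (a i) (coord_vec M c (axis i 1) p)"
  have *: "(\<Sum>j\<in>J. tscale (a j) (coord_vec M c (axis j 1) p)) (chart_coord c i) = (\<Sum>j\<in>J. a j * (axis j 1 :: real^'n) $ i)" for J
    by (induction J rule: infinite_finite_induct) (auto simp: tscale_eq coord_vec_chart_coord[OF c])
  have "(\<Sum>j\<in>UNIV. a j * (axis j 1 :: real^'n) $ i) = 0"
    using *[of UNIV] a by simp
  then show "a i = 0"
    by (simp add: axis_def if_distrib sum.delta cong: if_cong)
qed

lemma orthonormal_basis_iff: "orthonormal_basis M p b \<longleftrightarrow> tangent.orthonormal p UNIV b"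
  by (simp add: orthonormal_basis_def tangent.orthonormal_def)

lemma orthonormal_basis_ex: "\<exists>b. orthonormal_basis M p b"
proof -
  obtain c where c: "c \<in> charts M" "p \<in> fst c" by (rule chart_cover)
  show ?thesis
    using tangent.gram_schmidt[OF finite _ coord_vec_free[OF c]] coord_vec_in[OF c]
    unfolding orthonormal_basis_iff by blast
qed

text \<open>The coordinate vectors of a chart span the tangent space and are no more numerous than
  \<open>'n\<close>, the bound that \<open>tangent.orthonormal_expand\<close> needs.\<close>

lemma orthonormal_basis_expand:
  assumes b: "orthonormal_basis M p b" and X: "X \<in> tspace M p"
  shows "X = (\<Sum>i\<in>UNIV. tscale (metric M p X (b i)) (b i))"
proof -
  obtain c where c: "c \<in> charts M" "p \<in> fst c" by (rule chart_cover)
  let ?T = "range (\<lambda>i::'n. coord_vec M c (axis i 1) p)"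
  have "tspace M p \<subseteq> tangent.span ?T"
  proof
    fix X assume "X \<in> tspace M p"
    from tspace_expand[OF this c] show "X \<in> tangent.span ?T"
      by (metis (no_types, lifting) tangent.span_sum tangent.span_scale tangent.span_base rangeI)
  qed
  then show ?thesis
    using b X card_image_le[of "UNIV :: 'n set"]
    by (intro tangent.orthonormal_expand[of p UNIV b ?T]) (auto simp: orthonormal_basis_iff)
qed

lemma orthonormal_basis_in: "orthonormal_basis M p b \<Longrightarrow> b i \<in> tspace M p"
  by (simp add: orthonormal_basis_def)

text \<open>The sum represents \<eta> because \<eta> can be evaluated on the orthonormal expansion
  of its argument; any other dual vector has the same coefficients in that expansion.\<close>

lemma sharp_eq:
  assumes \<eta>: "covector M p \<eta>" and b: "orthonormal_basis M p b"
  shows "sharp M p \<eta> = (\<Sum>i\<in>UNIV. tscale (\<eta> (b i)) (b i))"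
proof -
  let ?X = "\<Sum>i\<in>UNIV. tscale (\<eta> (b i)) (b i)"
  have X: "?X \<in> tspace M p"
    by (intro tspace_sum tspace_scale orthonormal_basis_in[OF b])
  have eq: "metric M p ?X Y = \<eta> Y" if Y: "Y \<in> tspace M p" for Y
  proof -
    have "\<eta> Y = \<eta> (\<Sum>i\<in>UNIV. tscale (metric M p Y (b i)) (b i))"
      using orthonormal_basis_expand[OF b Y] by simp
    also have "\<dots> = (\<Sum>i\<in>UNIV. \<eta> (tscale (metric M p Y (b i)) (b i)))"
      using \<eta> by (intro tspace_additive_sum[where p = p]) (unfold covector_def, blast, rule tspace_scale[OF orthonormal_basis_in[OF b]])
    also have "\<dots> = (\<Sum>i\<in>UNIV. \<eta> (b i) * metric M p (b i) Y)"
      using \<eta> orthonormal_basis_in[OF b] metric_sym[OF Y] by (auto simp: covector_def mult.commute)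
    also have "\<dots> = metric M p ?X Y"
      using orthonormal_basis_in[OF b] by (simp add: tangent.h_lincomb[OF Y])
    finally show ?thesis by simp
  qed
  show ?thesis unfolding sharp_def
  proof (rule the_equality)
    show "?X \<in> tspace M p \<and> (\<forall>Y\<in>tspace M p. metric M p ?X Y = \<eta> Y)" using X eq by auto
  next
    fix Z assume Z: "Z \<in> tspace M p \<and> (\<forall>Y\<in>tspace M p. metric M p Z Y = \<eta> Y)"
    then have "Z = (\<Sum>i\<in>UNIV. tscale (metric M p Z (b i)) (b i))"
      using orthonormal_basis_expand[OF b] by auto
    also have "\<dots> = ?X" using Z orthonormal_basis_in[OF b] by simp
    finally show "Z = ?X" .
  qed
qed

text \<open>\<open>P\<close> holds the components of the orthonormal basis in the coordinate frame.
  Its inverse \<open>C\<close> holds the products of coordinate vectors with basis vectors, and the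
  Gram matrix is \<open>C\<close> times its transpose; inverting this gives the factorisation
  through \<open>P\<close>.\<close>

lemma gram_factor:
  fixes P :: "real ^ 'n ^ 'n"
  assumes c: "c \<in> charts M" "p \<in> fst c" and b: "orthonormal_basis M p b"
    and P: "\<And>k i. P $ k $ i = b k (chart_coord c i)"
  shows "det (gram M c p) > 0" and "inv_gram M c p = transpose P ** P"
proof -
  let ?e = "\<lambda>i. coord_vec M c (axis i 1) p"
  have e: "?e i \<in> tspace M p" for i by (rule coord_vec_in[OF c])
  have Pb: "b k = (\<Sum>i\<in>UNIV. tscale (P $ k $ i) (?e i))" for k
    unfolding P by (rule tspace_expand[OF orthonormal_basis_in[OF b] c])
  define C :: "real ^ 'n ^ 'n" where "C = (\<chi> i k. metric M p (?e i) (b k))"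
  have CP: "C ** P = mat 1"
    using tangent.change_of_basis[of UNIV ?e p b "\<lambda>k i. P $ k $ i", OF finite e coord_vec_free[OF c]
        orthonormal_basis_expand[OF b] Pb]
    by (simp add: vec_eq_iff matrix_matrix_mult_def mat_def C_def)
  have PC: "P ** C = mat 1"
    using CP by (simp add: matrix_left_right_inverse)
  have G: "gram M c p = C ** transpose C"
  proof -
    have "metric M p (?e i) (?e j) = (\<Sum>k\<in>UNIV. metric M p (?e i) (b k) * metric M p (?e j) (b k))" for i j
    proof -
      have "metric M p (?e i) (?e j) = metric M p (\<Sum>k\<in>UNIV. tscale (metric M p (?e i) (b k)) (b k)) (?e j)"
        using orthonormal_basis_expand[OF b e] by metis
      also have "\<dots> = (\<Sum>k\<in>UNIV. metric M p (?e i) (b k) * metric M p (b k) (?e j))"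
        by (rule tangent.h_lincomb[OF e orthonormal_basis_in[OF b]])
      finally show ?thesis using metric_sym[OF e orthonormal_basis_in[OF b]] by simp
    qed
    then show ?thesis
      by (simp add: vec_eq_iff gram_def C_def matrix_matrix_mult_def transpose_def)
  qed
  have "det C \<noteq> 0"
    using CP by (metis det_I det_mul mult_zero_left zero_neq_one)
  then show "det (gram M c p) > 0"
    unfolding G det_mul det_transpose using not_sum_power2_lt_zero by (metis less_eq_real_def mult_eq_0_iff zero_le_square)
  have "gram M c p ** (transpose P ** P) = C ** (transpose C ** transpose P) ** P"
    unfolding G by (simp add: matrix_mul_assoc)
  also have "\<dots> = mat 1"
    unfolding matrix_transpose_mul[symmetric] PC transpose_mat matrix_mul_rid by (rule CP)
  finally have "gram M c p ** (transpose P ** P) = mat 1" .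
  then show "inv_gram M c p = transpose P ** P"
    unfolding inv_gram_def using matrix_inv_works[of "gram M c p"]
    by (metis det_I det_mul matrix_mul_assoc matrix_mul_lid matrix_mul_rid mult_zero_left zero_neq_one)
qed

lemma det_gram_pos: "c \<in> charts M \<Longrightarrow> p \<in> fst c \<Longrightarrow> det (gram M c p) > 0"
  using gram_factor(1)[OF _ _ someI_ex[OF orthonormal_basis_ex],
      of c p "\<chi> k i. (SOME b. orthonormal_basis M p b) k (chart_coord c i)"] by simp

lemma det_smooth:
  fixes A :: "'m \<Rightarrow> real ^ 'n ^ 'n"
  assumes U: "open U" and A: "\<And>i j. smooth_fun M U (\<lambda>q. A q $ i $ j)"
  shows "smooth_fun M U (\<lambda>q. det (A q))"
  unfolding det_def
  by (intro smooth_fun_sum smooth_fun_mult smooth_fun_prod smooth_fun_const U A)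

lemma gram_smooth: "c \<in> charts M \<Longrightarrow> smooth_fun M (fst c) (\<lambda>p. gram M c p $ i $ j)"
  by (simp add: gram_def metric_smooth)

lemma inv_gram_smooth:
  assumes c: "c \<in> charts M"
  shows "smooth_fun M (fst c) (\<lambda>p. inv_gram M c p $ k $ j)"
proof (rule smooth_fun_cong[OF _ chart_open[OF c]])
  let ?A = "\<lambda>p. (\<chi> i l. if l = k then axis j 1 $ i else gram M c p $ i $ l) :: real ^ 'n ^ 'n"
  show "smooth_fun M (fst c) (\<lambda>p. det (?A p) * inverse (det (gram M c p)))"
  proof (intro smooth_fun_mult smooth_fun_inverse det_smooth chart_open[OF c] gram_smooth[OF c])
    show "smooth_fun M (fst c) (\<lambda>p. ?A p $ i $ l)" for i l
      using gram_smooth[OF c, of i l] by (cases "l = k") (auto simp: smooth_fun_const)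
    show "det (gram M c p) \<noteq> 0" if "p \<in> fst c" for p
      using det_gram_pos[OF c that] by simp
  qed
  show "det (?A p) * inverse (det (gram M c p)) = inv_gram M c p $ k $ j" if "p \<in> fst c" for p
    using matrix_inv_cramer[of "gram M c p" k j] det_gram_pos[OF c that]
    by (simp add: inv_gram_def divide_inverse)
qed

text \<open>Expanding both arguments in the coordinate frame produces the coefficients of
  \<open>transpose P ** P\<close>, which is the inverse Gram matrix. The module \<open>s\<close> is
  arbitrary because real pairings and vector-valued contractions are both rewritten this
  way.\<close>

lemma contraction_eq:
  fixes \<beta> :: "'m tvec \<Rightarrow> 'm tvec \<Rightarrow> 'x::ab_group_add"
  assumes s: "module s" and c: "c \<in> charts M" "p \<in> fst c" and b: "orthonormal_basis M p b"
    and add: "\<And>X Y Z. X \<in> tspace M p \<Longrightarrow> Y \<in> tspace M p \<Longrightarrow> Z \<in> tspace M p \<Longrightarrow> \<beta> (X + Y) Z = \<beta> X Z + \<beta> Y Z"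
      "\<And>X Y Z. X \<in> tspace M p \<Longrightarrow> Y \<in> tspace M p \<Longrightarrow> Z \<in> tspace M p \<Longrightarrow> \<beta> Z (X + Y) = \<beta> Z X + \<beta> Z Y"
    and scale: "\<And>X Z r. X \<in> tspace M p \<Longrightarrow> Z \<in> tspace M p \<Longrightarrow> \<beta> (tscale r X) Z = s r (\<beta> X Z)"
      "\<And>X Z r. X \<in> tspace M p \<Longrightarrow> Z \<in> tspace M p \<Longrightarrow> \<beta> Z (tscale r X) = s r (\<beta> Z X)"
  shows "(\<Sum>k\<in>UNIV. \<beta> (b k) (b k)) =
    (\<Sum>i\<in>UNIV. \<Sum>j\<in>UNIV. s (inv_gram M c p $ i $ j) (\<beta> (coord_vec M c (axis i 1) p) (coord_vec M c (axis j 1) p)))"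
proof -
  interpret module s by (rule s)
  let ?e = "\<lambda>i. coord_vec M c (axis i 1) p"
  define P :: "real ^ 'n ^ 'n" where "P = (\<chi> k i. b k (chart_coord c i))"
  have bi: "b k \<in> tspace M p" for k by (rule orthonormal_basis_in[OF b])
  have e: "?e i \<in> tspace M p" for i by (rule coord_vec_in[OF c])
  have "\<beta> (b k) (b k) = (\<Sum>i\<in>UNIV. \<Sum>j\<in>UNIV. s (P $ k $ i * P $ k $ j) (\<beta> (?e i) (?e j)))" for k
  proof -
    have "\<beta> (b k) (b k) = (\<Sum>i\<in>UNIV. s (P $ k $ i) (\<beta> (?e i) (b k)))"
      unfolding P_def by (simp, rule tspace_linear_expand[OF _ _ bi c]) (rule add scale; (assumption | rule bi))+
    also have "\<dots> = (\<Sum>i\<in>UNIV. s (P $ k $ i) (\<Sum>j\<in>UNIV. s (P $ k $ j) (\<beta> (?e i) (?e j))))"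
      unfolding P_def
      by (intro sum.cong refl arg_cong[where f = "s _"], simp, rule tspace_linear_expand[OF _ _ bi c]) (rule add scale; (assumption | rule e))+
    finally show ?thesis by (simp add: scale_sum_right)
  qed
  then have "(\<Sum>k\<in>UNIV. \<beta> (b k) (b k)) = (\<Sum>k\<in>UNIV. \<Sum>i\<in>UNIV. \<Sum>j\<in>UNIV. s (P $ k $ i * P $ k $ j) (\<beta> (?e i) (?e j)))"
    by simp
  also have "\<dots> = (\<Sum>i\<in>UNIV. \<Sum>k\<in>UNIV. \<Sum>j\<in>UNIV. s (P $ k $ i * P $ k $ j) (\<beta> (?e i) (?e j)))"
    by (rule sum.swap)
  also have "\<dots> = (\<Sum>i\<in>UNIV. \<Sum>j\<in>UNIV. \<Sum>k\<in>UNIV. s (P $ k $ i * P $ k $ j) (\<beta> (?e i) (?e j)))"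
    by (intro sum.cong refl sum.swap)
  also have "\<dots> = (\<Sum>i\<in>UNIV. \<Sum>j\<in>UNIV. s ((transpose P ** P) $ i $ j) (\<beta> (?e i) (?e j)))"
    by (simp add: matrix_matrix_mult_def transpose_def scale_sum_left)
  finally show ?thesis
    using gram_factor(2)[OF c b, of P] by (simp add: P_def)
qed

end

section \<open>Sections of Hermitian bundles\<close>

lemma sections_iff:
  "\<sigma> \<in> sections M F U \<longleftrightarrow> (\<forall>p\<in>U. \<sigma> p \<in> fibre F p) \<and>
     (\<forall>t\<in>frames F. \<exists>c. (\<forall>k<rank F. smooth_fun M (U \<inter> fst t) (c k :: 'm \<Rightarrow> complex)) \<and>
        (\<forall>p\<in>U \<inter> fst t. \<sigma> p = (\<Sum>k<rank F. scl F (c k p) (snd t k p))))"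
  by (simp add: sections_def case_prod_unfold)

lemma sections_fibre: "\<sigma> \<in> sections M F U \<Longrightarrow> p \<in> U \<Longrightarrow> \<sigma> p \<in> fibre F p"
  by (simp add: sections_iff)

lemma sections_coeff:
  assumes "\<sigma> \<in> sections M F U" "t \<in> frames F"
  shows "\<exists>c. (\<forall>k<rank F. smooth_fun M (U \<inter> fst t) (c k :: 'm \<Rightarrow> complex)) \<and>
        (\<forall>p\<in>U \<inter> fst t. \<sigma> p = (\<Sum>k<rank F. scl F (c k p) (snd t k p)))"
  using assms(1)[unfolded sections_iff, THEN conjunct2] assms(2) by (rule bspec)

lemma sections_subset:
  assumes "\<sigma> \<in> sections M F U" "V \<subseteq> U"
  shows "\<sigma> \<in> sections M F V"
  unfolding sections_iff
proof (intro conjI ballI)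
  show "\<sigma> p \<in> fibre F p" if "p \<in> V" for p
    using assms(2) that by (intro sections_fibre[OF assms(1)]) auto
  fix t assume "t \<in> frames F"
  then obtain c where "(\<forall>k<rank F. smooth_fun M (U \<inter> fst t) (c k)) \<and>
    (\<forall>p\<in>U \<inter> fst t. \<sigma> p = (\<Sum>k<rank F. scl F (c k p) (snd t k p)))"
    using sections_coeff[OF assms(1) \<open>t \<in> frames F\<close>] by (elim exE)
  note c = this[THEN conjunct1, rule_format] this[THEN conjunct2, rule_format]
  have V: "V \<inter> fst t \<subseteq> U \<inter> fst t" using assms(2) by blast
  show "\<exists>c. (\<forall>k<rank F. smooth_fun M (V \<inter> fst t) (c k)) \<and>
        (\<forall>p\<in>V \<inter> fst t. \<sigma> p = (\<Sum>k<rank F. scl F (c k p) (snd t k p)))"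
    using smooth_fun_subset[OF c(1) V] c(2)[OF subsetD[OF V]] by (intro exI[of _ c]) blast
qed

lemma sections_cong:
  assumes "\<sigma> \<in> sections M F U" "\<And>q. q \<in> U \<Longrightarrow> \<sigma> q = \<tau> q"
  shows "\<tau> \<in> sections M F U"
  using assms(1) unfolding sections_iff by (simp add: assms(2)[symmetric] cong: conj_cong)

lemma u_sections_fibre: "s \<in> u_sections M F U \<Longrightarrow> p \<in> U \<Longrightarrow> s p \<in> u_fibre F p"
  by (simp add: u_sections_def)

lemma u_sections_apply:
  "s \<in> u_sections M F U \<Longrightarrow> open V \<Longrightarrow> V \<subseteq> U \<Longrightarrow> \<sigma> \<in> sections M F V \<Longrightarrow> (\<lambda>p. s p (\<sigma> p)) \<in> sections M F V"
  by (simp add: u_sections_def)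

lemma
  assumes A: "A \<in> u_forms1 M F"
  shows u_forms1_fibre: "X \<in> tspace M p \<Longrightarrow> A p X \<in> u_fibre F p"
    and u_forms1_add: "X \<in> tspace M p \<Longrightarrow> Y \<in> tspace M p \<Longrightarrow> A p (X + Y) = A p X + A p Y"
    and u_forms1_scale: "X \<in> tspace M p \<Longrightarrow> A p (tscale r X) v = rscl F r (A p X v)"
    and u_forms1_zero: "X \<notin> tspace M p \<Longrightarrow> A p X = 0"
    and u_forms1_coord: "c \<in> charts M \<Longrightarrow> (\<lambda>p. A p (coord_vec M c w p)) \<in> u_sections M F (fst c)"
proof -
  note A = A[unfolded u_forms1_def, THEN CollectD]
  note A1 = A[THEN conjunct1, THEN spec, THEN bspec]
  show "X \<in> tspace M p \<Longrightarrow> A p X \<in> u_fibre F p"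
    by (rule A1[THEN conjunct1])
  show "X \<in> tspace M p \<Longrightarrow> Y \<in> tspace M p \<Longrightarrow> A p (X + Y) = A p X + A p Y"
    by (rule A1[THEN conjunct2, THEN conjunct1, THEN bspec])
  show "X \<in> tspace M p \<Longrightarrow> A p (tscale r X) v = rscl F r (A p X v)"
    by (rule A1[THEN conjunct2, THEN conjunct2, THEN spec, THEN spec])
  show "X \<notin> tspace M p \<Longrightarrow> A p X = 0"
    by (rule A[THEN conjunct2, THEN conjunct1, THEN spec, THEN spec, THEN mp])
  show "c \<in> charts M \<Longrightarrow> (\<lambda>p. A p (coord_vec M c w p)) \<in> u_sections M F (fst c)"
    by (rule A[THEN conjunct2, THEN conjunct2, THEN bspec, THEN spec])
qed

lemma
  assumes \<omega>: "\<omega> \<in> u_forms2 M F"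
  shows u_forms2_fibre: "X \<in> tspace M p \<Longrightarrow> Y \<in> tspace M p \<Longrightarrow> \<omega> p X Y \<in> u_fibre F p"
    and u_forms2_skew: "X \<in> tspace M p \<Longrightarrow> Y \<in> tspace M p \<Longrightarrow> \<omega> p Y X = - \<omega> p X Y"
    and u_forms2_add: "X \<in> tspace M p \<Longrightarrow> Y \<in> tspace M p \<Longrightarrow> Z \<in> tspace M p \<Longrightarrow>
      \<omega> p (X + Z) Y = \<omega> p X Y + \<omega> p Z Y"
    and u_forms2_scale: "X \<in> tspace M p \<Longrightarrow> Y \<in> tspace M p \<Longrightarrow>
      \<omega> p (tscale r X) Y v = rscl F r (\<omega> p X Y v)"
    and u_forms2_zero: "X \<notin> tspace M p \<or> Y \<notin> tspace M p \<Longrightarrow> \<omega> p X Y = 0"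
    and u_forms2_coord: "c \<in> charts M \<Longrightarrow>
      (\<lambda>p. \<omega> p (coord_vec M c x p) (coord_vec M c y p)) \<in> u_sections M F (fst c)"
proof -
  note W = \<omega>[unfolded u_forms2_def, THEN CollectD]
  note W1 = W[THEN conjunct1, THEN spec, THEN bspec, THEN bspec]
  show "X \<in> tspace M p \<Longrightarrow> Y \<in> tspace M p \<Longrightarrow> \<omega> p X Y \<in> u_fibre F p"
    by (rule W1[THEN conjunct1])
  show "X \<in> tspace M p \<Longrightarrow> Y \<in> tspace M p \<Longrightarrow> \<omega> p Y X = - \<omega> p X Y"
    by (rule W1[THEN conjunct2, THEN conjunct1])
  show "X \<in> tspace M p \<Longrightarrow> Y \<in> tspace M p \<Longrightarrow> Z \<in> tspace M p \<Longrightarrow> \<omega> p (X + Z) Y = \<omega> p X Y + \<omega> p Z Y"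
    by (rule W1[THEN conjunct2, THEN conjunct2, THEN conjunct1, THEN bspec])
  show "X \<in> tspace M p \<Longrightarrow> Y \<in> tspace M p \<Longrightarrow> \<omega> p (tscale r X) Y v = rscl F r (\<omega> p X Y v)"
    by (rule W1[THEN conjunct2, THEN conjunct2, THEN conjunct2, THEN spec, THEN spec])
  show "X \<notin> tspace M p \<or> Y \<notin> tspace M p \<Longrightarrow> \<omega> p X Y = 0"
    by (rule W[THEN conjunct2, THEN conjunct1, THEN spec, THEN spec, THEN spec, THEN mp])
  show "c \<in> charts M \<Longrightarrow>
      (\<lambda>p. \<omega> p (coord_vec M c x p) (coord_vec M c y p)) \<in> u_sections M F (fst c)"
    by (rule W[THEN conjunct2, THEN conjunct2, THEN bspec, THEN spec, THEN spec])
qed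

lemma
  assumes \<omega>: "\<omega> \<in> bundle_form1 M F U"
  shows bundle_form1_fibre: "p \<in> U \<Longrightarrow> X \<in> tspace M p \<Longrightarrow> \<omega> p X \<in> fibre F p"
    and bundle_form1_add: "p \<in> U \<Longrightarrow> X \<in> tspace M p \<Longrightarrow> Y \<in> tspace M p \<Longrightarrow> \<omega> p (X + Y) = \<omega> p X + \<omega> p Y"
    and bundle_form1_scale: "p \<in> U \<Longrightarrow> X \<in> tspace M p \<Longrightarrow> \<omega> p (tscale r X) = rscl F r (\<omega> p X)"
    and bundle_form1_coord: "c \<in> charts M \<Longrightarrow> (\<lambda>p. \<omega> p (coord_vec M c v p)) \<in> sections M F (U \<inter> fst c)"
proof -
  note W = \<omega>[unfolded bundle_form1_def, THEN CollectD]
  note W1 = W[THEN conjunct1, THEN bspec, THEN bspec]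
  show "p \<in> U \<Longrightarrow> X \<in> tspace M p \<Longrightarrow> \<omega> p X \<in> fibre F p"
    by (rule W1[THEN conjunct1])
  show "p \<in> U \<Longrightarrow> X \<in> tspace M p \<Longrightarrow> Y \<in> tspace M p \<Longrightarrow> \<omega> p (X + Y) = \<omega> p X + \<omega> p Y"
    by (rule W1[THEN conjunct2, THEN conjunct1, THEN bspec])
  show "p \<in> U \<Longrightarrow> X \<in> tspace M p \<Longrightarrow> \<omega> p (tscale r X) = rscl F r (\<omega> p X)"
    by (rule W1[THEN conjunct2, THEN conjunct2, THEN spec])
  show "c \<in> charts M \<Longrightarrow> (\<lambda>p. \<omega> p (coord_vec M c v p)) \<in> sections M F (U \<inter> fst c)"
    by (rule W[THEN conjunct2, THEN bspec, THEN spec])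
qed

lemma cderiv_of_real: "X (\<lambda>q. 0) = 0 \<Longrightarrow> cderiv X (\<lambda>q. complex_of_real (f q)) = of_real (X f)"
  by (simp add: cderiv_def complex_of_real_def)

locale hermitian_vb = riemannian M for M :: "('m::t2_space, 'n::finite) rmfd" +
  fixes F :: "('m, 'v::ab_group_add) hbundle"
  assumes hermitian: "hermitian_bundle M F"
begin

sublocale vs: vector_space "scl F"
  using hermitian unfolding hermitian_bundle_def by (elim conjE)

lemma fibre_subspace: "vs.subspace (fibre F p)"
  using hermitian unfolding hermitian_bundle_def by (elim conjE) (rule spec)

lemma frame_cover: obtains t where "t \<in> frames F" "p \<in> fst t"
proof -
  have "p \<in> (\<Union>t\<in>frames F. fst t)"
    using hermitian[unfolded hermitian_bundle_def, THEN conjunct2, THEN conjunct2, THEN conjunct1]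
    by (simp only: UNIV_I)
  then show thesis using that by blast
qed

lemma frame:
  assumes "t \<in> frames F"
  shows "open (fst t)" and "k < rank F \<Longrightarrow> snd t k \<in> sections M F (fst t)"
    and "p \<in> fst t \<Longrightarrow> v \<in> fibre F p \<Longrightarrow>
      \<exists>!c. (\<forall>k\<ge>rank F. c k = 0) \<and> v = (\<Sum>k<rank F. scl F (c k) (snd t k p))"
proof -
  have "\<forall>(W, e)\<in>frames F. open W \<and> (\<forall>k<rank F. e k \<in> sections M F W) \<and>
        (\<forall>p\<in>W. \<forall>v\<in>fibre F p. \<exists>!c. (\<forall>k\<ge>rank F. c k = 0) \<and>
           v = (\<Sum>k<rank F. scl F (c k) (e k p)))"
    by (rule hermitian[unfolded hermitian_bundle_def, THEN conjunct2, THEN conjunct2, THEN conjunct2, THEN conjunct1])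
  then have *: "open (fst t) \<and> (\<forall>k<rank F. snd t k \<in> sections M F (fst t)) \<and>
        (\<forall>p\<in>fst t. \<forall>v\<in>fibre F p. \<exists>!c. (\<forall>k\<ge>rank F. c k = 0) \<and>
           v = (\<Sum>k<rank F. scl F (c k) (snd t k p)))"
    by (drule_tac bspec[OF _ assms]) (simp add: case_prod_unfold)
  from * show "open (fst t)" by blast
  from * show "k < rank F \<Longrightarrow> snd t k \<in> sections M F (fst t)" by blast
  from * show "p \<in> fst t \<Longrightarrow> v \<in> fibre F p \<Longrightarrow>
      \<exists>!c. (\<forall>k\<ge>rank F. c k = 0) \<and> v = (\<Sum>k<rank F. scl F (c k) (snd t k p))"
    by (elim conjE) (drule (1) bspec, erule (1) bspec)
qed

lemma herm_laws:
  "\<forall>p. \<forall>v\<in>fibre F p. \<forall>w\<in>fibre F p.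
        (\<forall>u\<in>fibre F p. herm F p (v + w) u = herm F p v u + herm F p w u) \<and>
        (\<forall>z. herm F p (scl F z v) w = z * herm F p v w) \<and>
        herm F p w v = cnj (herm F p v w)"
  and herm_pos: "\<forall>p. \<forall>v\<in>fibre F p. v \<noteq> 0 \<longrightarrow> Re (herm F p v v) > 0"
  and herm_smooth': "\<forall>U. open U \<longrightarrow> (\<forall>\<sigma>\<in>sections M F U. \<forall>\<tau>\<in>sections M F U.
        smooth_fun M U (\<lambda>p. herm F p (\<sigma> p) (\<tau> p)))"
  by (rule hermitian[unfolded hermitian_bundle_def, THEN conjunct2, THEN conjunct2, THEN conjunct2, THEN conjunct2, THEN conjunct1],
      rule hermitian[unfolded hermitian_bundle_def, THEN conjunct2, THEN conjunct2, THEN conjunct2, THEN conjunct2, THEN conjunct2, THEN conjunct1],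
      rule hermitian[unfolded hermitian_bundle_def, THEN conjunct2, THEN conjunct2, THEN conjunct2, THEN conjunct2, THEN conjunct2, THEN conjunct2])

lemma herm_smooth:
  "open U \<Longrightarrow> \<sigma> \<in> sections M F U \<Longrightarrow> \<tau> \<in> sections M F U \<Longrightarrow> smooth_fun M U (\<lambda>p. herm F p (\<sigma> p) (\<tau> p))"
  using herm_smooth' by blast

lemma fibre_sesquilinear: "sesquilinear_space (scl F) (fibre F p) (herm F p) cnj"
proof unfold_locales
  show "\<exists>r. r \<noteq> 0 \<and> herm F p v v = r * cnj r" if "v \<in> fibre F p" "v \<noteq> 0" for v
  proof -
    have "herm F p v v = cnj (herm F p v v)" using herm_laws that(1) by blast
    then have "Im (herm F p v v) = 0" by (metis cnj.simps(2) neg_equal_zero)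
    then have "herm F p v v = of_real (sqrt (Re (herm F p v v))) * cnj (of_real (sqrt (Re (herm F p v v))))"
      using herm_pos[rule_format, OF that] by (simp add: complex_eq_iff)
    moreover have "complex_of_real (sqrt (Re (herm F p v v))) \<noteq> 0"
      using herm_pos that by force
    ultimately show ?thesis by blast
  qed
qed (use fibre_subspace herm_laws in \<open>blast | simp\<close>)+

sublocale fib: sesquilinear_space "scl F" "fibre F p" "herm F p" cnj for p
  by (rule fibre_sesquilinear)

lemma module_rscl: "module (rscl F)"
  by unfold_locales (simp_all add: vs.scale_right_distrib vs.scale_left_distrib)

sublocale rs: module "rscl F"
  by (rule module_rscl)

lemma herm_add_right:
  "u \<in> fibre F p \<Longrightarrow> v \<in> fibre F p \<Longrightarrow> w \<in> fibre F p \<Longrightarrow> herm F p u (v + w) = herm F p u v + herm F p u w"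
  using fib.h_cj[of u p] fib.S_add[of v p w] fib.h_add[of v p w u] by (metis complex_cnj_add fib.h_cj)

lemma herm_scale_right:
  "u \<in> fibre F p \<Longrightarrow> v \<in> fibre F p \<Longrightarrow> herm F p u (scl F z v) = cnj z * herm F p u v"
  using fib.S_scale[of v p z] fib.h_scale[of v p u z] by (metis complex_cnj_mult fib.h_cj)

lemma herm_zero_right: "u \<in> fibre F p \<Longrightarrow> herm F p u 0 = 0"
  using herm_scale_right[of u p 0 0] fib.S_zero by simp

lemma herm_diff_right:
  "u \<in> fibre F p \<Longrightarrow> v \<in> fibre F p \<Longrightarrow> w \<in> fibre F p \<Longrightarrow> herm F p u (v - w) = herm F p u v - herm F p u w"
  using herm_add_right[of u p "v - w" w] fib.S_diff[of v p w] by simp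

lemma frame_free:
  assumes "t \<in> frames F" "p \<in> fst t"
  shows "fib.free_family {..<rank F} (\<lambda>k. snd t k p)"
  unfolding fib.free_family_def
proof (intro allI impI ballI)
  fix c i assume c: "(\<Sum>i<rank F. scl F (c i) (snd t i p)) = 0" and i: "i \<in> {..<rank F}"
  \<comment> \<open>Uniqueness of frame coefficients is stated for functions that vanish from
    \<open>rank F\<close> on, so \<open>c\<close> is truncated before it is compared with the zero
    function.\<close>
  let ?c = "\<lambda>k. if k < rank F then c k else 0"
  have eq: "(\<Sum>i<rank F. scl F (?c i) (snd t i p)) = 0"
    using c by simp
  have "\<exists>!c. (\<forall>k\<ge>rank F. c k = 0) \<and> 0 = (\<Sum>k<rank F. scl F (c k) (snd t k p))"
    by (rule frame(3)[OF assms fib.S_zero])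
  then have "?c = (\<lambda>k. 0)"
  proof (rule ex1E)
    fix d assume *: "\<forall>c. (\<forall>k\<ge>rank F. c k = 0) \<and> 0 = (\<Sum>k<rank F. scl F (c k) (snd t k p)) \<longrightarrow> c = d"
    have "?c = d" by (rule *[THEN spec, THEN mp]) (use eq in simp)
    moreover have "(\<lambda>k. 0) = d" by (rule *[THEN spec, THEN mp]) simp
    ultimately show ?thesis by (simp only:)
  qed
  then have "?c i = 0" by (rule fun_cong)
  then show "c i = 0" using i by simp
qed

lemma frame_fibre: "t \<in> frames F \<Longrightarrow> p \<in> fst t \<Longrightarrow> k < rank F \<Longrightarrow> snd t k p \<in> fibre F p"
  by (rule sections_fibre[OF frame(2)])

lemma frame_expand:
  assumes "t \<in> frames F" "p \<in> fst t" "v \<in> fibre F p"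
  obtains c where "v = (\<Sum>k<rank F. scl F (c k) (snd t k p))"
  using frame(3)[OF assms] by blast

lemma unitary_basis_iff: "unitary_basis F p u \<longleftrightarrow> fib.orthonormal p {..<rank F} u"
  by (auto simp: unitary_basis_def fib.orthonormal_def)

lemma unitary_basis_ex: "\<exists>u. unitary_basis F p u"
proof -
  obtain t where t: "t \<in> frames F" "p \<in> fst t" by (rule frame_cover)
  show ?thesis
    using fib.gram_schmidt[OF finite_lessThan _ frame_free[OF t]] frame_fibre[OF t]
    unfolding unitary_basis_iff by (meson lessThan_iff)
qed

lemma unitary_basis_in: "unitary_basis F p u \<Longrightarrow> k < rank F \<Longrightarrow> u k \<in> fibre F p"
  by (simp add: unitary_basis_def)

lemma unitary_basis_expand:
  assumes u: "unitary_basis F p u" and v: "v \<in> fibre F p"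
  shows "v = (\<Sum>k<rank F. scl F (herm F p v (u k)) (u k))"
proof -
  obtain t where t: "t \<in> frames F" "p \<in> fst t" by (rule frame_cover)
  let ?T = "(\<lambda>k. snd t k p) ` {..<rank F}"
  have "fibre F p \<subseteq> vs.span ?T"
  proof
    fix x assume "x \<in> fibre F p"
    then obtain c where "x = (\<Sum>k<rank F. scl F (c k) (snd t k p))"
      using frame_expand[OF t] by blast
    then show "x \<in> vs.span ?T"
      by (simp only:) (rule vs.span_sum, rule vs.span_scale, rule vs.span_base, rule imageI)
  qed
  then show ?thesis
    using u v card_image_le[of "{..<rank F}"]
    by (intro fib.orthonormal_expand[of p "{..<rank F}" u ?T]) (auto simp: unitary_basis_iff)
qed

subsection \<open>Algebra of sections\<close>

lemma sections_add:
  assumes U: "open U" and s: "\<sigma> \<in> sections M F U" "\<tau> \<in> sections M F U"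
  shows "(\<lambda>q. \<sigma> q + \<tau> q) \<in> sections M F U"
  unfolding sections_iff
proof (intro conjI ballI)
  show "\<sigma> p + \<tau> p \<in> fibre F p" if "p \<in> U" for p
    using s that by (intro fib.S_add sections_fibre)
  fix t assume t: "t \<in> frames F"
  have o: "open (U \<inter> fst t)" using U frame(1)[OF t] by blast
  obtain c where "(\<forall>k<rank F. smooth_fun M (U \<inter> fst t) (c k)) \<and>
    (\<forall>p\<in>U \<inter> fst t. \<sigma> p = (\<Sum>k<rank F. scl F (c k p) (snd t k p)))"
    using sections_coeff[OF s(1) t] by (elim exE)
  note c = this[THEN conjunct1, rule_format] this[THEN conjunct2, rule_format]
  obtain d where "(\<forall>k<rank F. smooth_fun M (U \<inter> fst t) (d k)) \<and>
    (\<forall>p\<in>U \<inter> fst t. \<tau> p = (\<Sum>k<rank F. scl F (d k p) (snd t k p)))"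
    using sections_coeff[OF s(2) t] by (elim exE)
  note d = this[THEN conjunct1, rule_format] this[THEN conjunct2, rule_format]
  show "\<exists>c. (\<forall>k<rank F. smooth_fun M (U \<inter> fst t) (c k)) \<and>
        (\<forall>p\<in>U \<inter> fst t. \<sigma> p + \<tau> p = (\<Sum>k<rank F. scl F (c k p) (snd t k p)))"
    by (rule exI[of _ "\<lambda>k q. c k q + d k q"])
      (simp add: c d smooth_fun_add[OF o] vs.scale_left_distrib sum.distrib)
qed

lemma sections_scl:
  assumes U: "open U" and s: "\<sigma> \<in> sections M F U" and f: "smooth_fun M U f"
  shows "(\<lambda>q. scl F (f q) (\<sigma> q)) \<in> sections M F U"
  unfolding sections_iff
proof (intro conjI ballI)
  show "scl F (f p) (\<sigma> p) \<in> fibre F p" if "p \<in> U" for p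
    using s that by (intro fib.S_scale sections_fibre)
  fix t assume t: "t \<in> frames F"
  have o: "open (U \<inter> fst t)" using U frame(1)[OF t] by blast
  obtain c where "(\<forall>k<rank F. smooth_fun M (U \<inter> fst t) (c k)) \<and>
    (\<forall>p\<in>U \<inter> fst t. \<sigma> p = (\<Sum>k<rank F. scl F (c k p) (snd t k p)))"
    using sections_coeff[OF s t] by (elim exE)
  note c = this[THEN conjunct1, rule_format] this[THEN conjunct2, rule_format]
  show "\<exists>c. (\<forall>k<rank F. smooth_fun M (U \<inter> fst t) (c k)) \<and>
        (\<forall>p\<in>U \<inter> fst t. scl F (f p) (\<sigma> p) = (\<Sum>k<rank F. scl F (c k p) (snd t k p)))"
    by (rule exI[of _ "\<lambda>k q. f q * c k q"])
      (simp add: c smooth_fun_mult[OF o] smooth_fun_subset[OF f] vs.scale_sum_right)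
qed

lemma sections_zero: "(\<lambda>q. 0) \<in> sections M F U"
  unfolding sections_iff
  by (auto intro!: exI[of _ "\<lambda>k q. 0"] fib.S_zero smooth_fun_const)

lemma sections_rscl:
  "open U \<Longrightarrow> \<sigma> \<in> sections M F U \<Longrightarrow> smooth_fun M U f \<Longrightarrow> (\<lambda>q. rscl F (f q) (\<sigma> q)) \<in> sections M F U"
  by (rule sections_scl, assumption, assumption, rule smooth_fun_of_real)

lemma sections_sum:
  "open U \<Longrightarrow> (\<And>i. i \<in> I \<Longrightarrow> \<sigma> i \<in> sections M F U) \<Longrightarrow> (\<lambda>q. \<Sum>i\<in>I. \<sigma> i q) \<in> sections M F U"
proof (induction I rule: infinite_finite_induct)
  case (insert i I)
  have "(\<lambda>q. \<sigma> i q + (\<Sum>i\<in>I. \<sigma> i q)) \<in> sections M F U"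
    using insert by (intro sections_add) blast+
  then show ?case using insert.hyps by simp
qed (simp_all add: sections_zero)

lemma sections_minus: "open U \<Longrightarrow> \<sigma> \<in> sections M F U \<Longrightarrow> (\<lambda>q. - \<sigma> q) \<in> sections M F U"
  using sections_scl[OF _ _ smooth_fun_const[of M U "-1"], of \<sigma>] by simp

lemma sections_diff:
  "open U \<Longrightarrow> \<sigma> \<in> sections M F U \<Longrightarrow> \<tau> \<in> sections M F U \<Longrightarrow> (\<lambda>q. \<sigma> q - \<tau> q) \<in> sections M F U"
  using sections_add[OF _ _ sections_minus, of U \<sigma> \<tau>] by simp

text \<open>Constant coefficients in a local frame extend a vector to a section, which makes the
  descriptions over all extensions of a vector nonempty.\<close>

lemma section_through:
  assumes "v \<in> fibre F p"
  obtains U \<sigma> where "open U" "p \<in> U" "\<sigma> \<in> sections M F U" "\<sigma> p = v"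
proof -
  obtain t where t: "t \<in> frames F" "p \<in> fst t" by (rule frame_cover)
  obtain c where c: "v = (\<Sum>k<rank F. scl F (c k) (snd t k p))"
    using frame_expand[OF t assms] .
  have "(\<lambda>q. \<Sum>k<rank F. scl F (c k) (snd t k q)) \<in> sections M F (fst t)"
    using frame[OF t(1)] by (intro sections_sum sections_scl smooth_fun_const) auto
  with that[OF frame(1)[OF t(1)] t(2)] c show thesis by blast
qed

text \<open>Linearity over smooth functions for an operator that depends on the germ of a section at
  \<open>p\<close>: the usual criterion for depending on the value at \<open>p\<close>
  alone.\<close>

definition tensorial :: "'m \<Rightarrow> (('m \<Rightarrow> 'v) \<Rightarrow> 'v) \<Rightarrow> bool" where
  "tensorial p P \<longleftrightarrow> (\<forall>U \<sigma> \<tau>. open U \<longrightarrow> p \<in> U \<longrightarrow> \<sigma> \<in> sections M F U \<longrightarrow> \<tau> \<in> sections M F U \<longrightarrow>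
     P (\<lambda>q. \<sigma> q + \<tau> q) = P \<sigma> + P \<tau> \<and> ((\<forall>q\<in>U. \<sigma> q = \<tau> q) \<longrightarrow> P \<sigma> = P \<tau>) \<and>
     (\<forall>f. smooth_fun M U f \<longrightarrow> P (\<lambda>q. scl F (f q) (\<sigma> q)) = scl F (f p) (P \<sigma>)))"

lemma tensorialI:
  assumes "\<And>U \<sigma> \<tau>. open U \<Longrightarrow> p \<in> U \<Longrightarrow> \<sigma> \<in> sections M F U \<Longrightarrow> \<tau> \<in> sections M F U \<Longrightarrow>
      P (\<lambda>q. \<sigma> q + \<tau> q) = P \<sigma> + P \<tau>"
    and "\<And>U \<sigma> \<tau>. open U \<Longrightarrow> p \<in> U \<Longrightarrow> \<sigma> \<in> sections M F U \<Longrightarrow> \<tau> \<in> sections M F U \<Longrightarrow>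
      (\<And>q. q \<in> U \<Longrightarrow> \<sigma> q = \<tau> q) \<Longrightarrow> P \<sigma> = P \<tau>"
    and "\<And>U \<sigma> f. open U \<Longrightarrow> p \<in> U \<Longrightarrow> \<sigma> \<in> sections M F U \<Longrightarrow> smooth_fun M U f \<Longrightarrow>
      P (\<lambda>q. scl F (f q) (\<sigma> q)) = scl F (f p) (P \<sigma>)"
  shows "tensorial p P"
  unfolding tensorial_def
  by (intro allI impI conjI; rule assms; (assumption | erule (1) bspec))

lemma tensorial_add: "tensorial p P \<Longrightarrow> open U \<Longrightarrow> p \<in> U \<Longrightarrow> \<sigma> \<in> sections M F U \<Longrightarrow> \<tau> \<in> sections M F U \<Longrightarrow>
      P (\<lambda>q. \<sigma> q + \<tau> q) = P \<sigma> + P \<tau>"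
  and tensorial_cong: "tensorial p P \<Longrightarrow> open U \<Longrightarrow> p \<in> U \<Longrightarrow> \<sigma> \<in> sections M F U \<Longrightarrow>
      (\<And>q. q \<in> U \<Longrightarrow> \<sigma> q = \<tau> q) \<Longrightarrow> P \<sigma> = P \<tau>"
  and tensorial_scl: "tensorial p P \<Longrightarrow> open U \<Longrightarrow> p \<in> U \<Longrightarrow> \<sigma> \<in> sections M F U \<Longrightarrow> smooth_fun M U f \<Longrightarrow>
      P (\<lambda>q. scl F (f q) (\<sigma> q)) = scl F (f p) (P \<sigma>)"
  using sections_cong[of \<sigma> M F U \<tau>] unfolding tensorial_def by metis+

lemma tensorial_sum:
  assumes P: "tensorial p P" and U: "open U" "p \<in> U"
    and "finite I" "\<And>i. i \<in> I \<Longrightarrow> \<sigma> i \<in> sections M F U"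
  shows "P (\<lambda>q. \<Sum>i\<in>I. \<sigma> i q) = (\<Sum>i\<in>I. P (\<sigma> i))"
  using assms(4,5)
proof (induction I)
  case empty
  then show ?case using tensorial_scl[OF P U sections_zero smooth_fun_const[of M U 0]] by simp
next
  case (insert i I)
  have "P (\<lambda>q. \<sigma> i q + (\<Sum>i\<in>I. \<sigma> i q)) = P (\<sigma> i) + P (\<lambda>q. \<Sum>i\<in>I. \<sigma> i q)"
    using insert.prems by (intro tensorial_add[OF P U] sections_sum U(1)) blast+
  then show ?case using insert by simp
qed

text \<open>The difference of the two sections vanishes at \<open>p\<close>, hence so do its frame
  coefficients there; linearity over functions pulls these coefficients out of
  \<open>P\<close>.\<close>

lemma tensorial_eq:
  assumes P: "tensorial p P" and U: "open U" "p \<in> U" "\<sigma> \<in> sections M F U"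
    and U': "open U'" "p \<in> U'" "\<tau> \<in> sections M F U'" and eq: "\<sigma> p = \<tau> p"
  shows "P \<sigma> = P \<tau>"
proof -
  obtain t where t: "t \<in> frames F" "p \<in> fst t" by (rule frame_cover)
  let ?V = "U \<inter> U' \<inter> fst t"
  have V: "open ?V" "p \<in> ?V" using U U' t frame(1)[OF t(1)] by auto
  have s: "\<sigma> \<in> sections M F ?V" "\<tau> \<in> sections M F ?V"
    using sections_subset[OF U(3), of ?V] sections_subset[OF U'(3), of ?V] by auto
  let ?r = "\<lambda>q. \<sigma> q - \<tau> q"
  have r: "?r \<in> sections M F ?V" by (rule sections_diff[OF V(1) s])
  obtain c where "(\<forall>k<rank F. smooth_fun M (?V \<inter> fst t) (c k)) \<and>
    (\<forall>p\<in>?V \<inter> fst t. ?r p = (\<Sum>k<rank F. scl F (c k p) (snd t k p)))"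
    using sections_coeff[OF r t(1)] by (elim exE)
  note c = this[THEN conjunct1, rule_format] this[THEN conjunct2, rule_format]
  have VV: "?V \<inter> fst t = ?V" by blast
  have e: "snd t k \<in> sections M F ?V" if "k < rank F" for k
    using sections_subset[OF frame(2)[OF t(1) that], of ?V] by blast
  have c0: "c k p = 0" if "k < rank F" for k
  proof -
    have "(\<Sum>k<rank F. scl F (c k p) (snd t k p)) = 0" using c(2)[of p] eq V VV by simp
    then show ?thesis
      using frame_free[OF t, unfolded fib.free_family_def, THEN spec[of _ "\<lambda>k. c k p"]] that by blast
  qed
  have "P ?r = P (\<lambda>q. \<Sum>k<rank F. scl F (c k q) (snd t k q))"
    using c(2) VV by (intro tensorial_cong[OF P V r]) auto
  also have "\<dots> = (\<Sum>k<rank F. P (\<lambda>q. scl F (c k q) (snd t k q)))"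
    using c(1) VV e by (intro tensorial_sum[OF P V] sections_scl V) auto
  also have "\<dots> = 0"
    using tensorial_scl[OF P V e c(1)[unfolded VV]] c0 by simp
  finally have "P ?r = 0" .
  moreover have "P \<sigma> = P (\<lambda>q. \<tau> q + ?r q)"
    by (rule tensorial_cong[OF P V s(1)]) simp
  ultimately show ?thesis
    using tensorial_add[OF P V s(2) r] by simp
qed

subsection \<open>Antihermitian endomorphisms\<close>

lemma u_fibre_in: "a \<in> u_fibre F p \<Longrightarrow> v \<in> fibre F p \<Longrightarrow> a v \<in> fibre F p"
  and u_fibre_add: "a \<in> u_fibre F p \<Longrightarrow> v \<in> fibre F p \<Longrightarrow> w \<in> fibre F p \<Longrightarrow> a (v + w) = a v + a w"
  and u_fibre_scl: "a \<in> u_fibre F p \<Longrightarrow> v \<in> fibre F p \<Longrightarrow> a (scl F z v) = scl F z (a v)"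
  and u_fibre_off: "a \<in> u_fibre F p \<Longrightarrow> v \<notin> fibre F p \<Longrightarrow> a v = 0"
  and u_fibre_skew: "a \<in> u_fibre F p \<Longrightarrow> v \<in> fibre F p \<Longrightarrow> w \<in> fibre F p \<Longrightarrow>
    herm F p (a v) w + herm F p v (a w) = 0"
  unfolding u_fibre_def by blast+

lemma u_fibre_zero: "a \<in> u_fibre F p \<Longrightarrow> a 0 = 0"
  using u_fibre_scl[of a p 0 0] fib.S_zero by simp

lemma u_fibre_sum:
  "a \<in> u_fibre F p \<Longrightarrow> (\<And>i. i \<in> I \<Longrightarrow> f i \<in> fibre F p) \<Longrightarrow> a (\<Sum>i\<in>I. f i) = (\<Sum>i\<in>I. a (f i))"
  by (induction I rule: infinite_finite_induct) (auto simp: u_fibre_zero u_fibre_add fib.S_sum)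

lemma u_fibre_lincomb:
  assumes a: "a \<in> u_fibre F p" and f: "\<And>i. i \<in> I \<Longrightarrow> f i \<in> fibre F p"
  shows "a (\<Sum>i\<in>I. scl F (z i) (f i)) = (\<Sum>i\<in>I. scl F (z i) (a (f i)))"
  by (subst u_fibre_sum[OF a]) (auto simp: fib.S_scale f intro!: sum.cong u_fibre_scl[OF a])

lemma u_fibreI:
  assumes "\<And>v. v \<in> fibre F p \<Longrightarrow> a v \<in> fibre F p"
    and "\<And>v w. v \<in> fibre F p \<Longrightarrow> w \<in> fibre F p \<Longrightarrow> a (v + w) = a v + a w"
    and "\<And>v z. v \<in> fibre F p \<Longrightarrow> a (scl F z v) = scl F z (a v)"
    and "\<And>v. v \<notin> fibre F p \<Longrightarrow> a v = 0"
    and "\<And>v w. v \<in> fibre F p \<Longrightarrow> w \<in> fibre F p \<Longrightarrow> herm F p (a v) w + herm F p v (a w) = 0"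
  shows "a \<in> u_fibre F p"
  using assms unfolding u_fibre_def by blast

lemma u_fibre_zero_in: "0 \<in> u_fibre F p"
  by (rule u_fibreI) (auto simp: fib.S_zero fib.h_zero herm_zero_right)

lemma u_fibre_plus:
  assumes "a \<in> u_fibre F p" "b \<in> u_fibre F p"
  shows "a + b \<in> u_fibre F p"
proof (rule u_fibreI)
  show "herm F p ((a + b) v) w + herm F p v ((a + b) w) = 0" if "v \<in> fibre F p" "w \<in> fibre F p" for v w
    using u_fibre_skew[OF assms(1) that] u_fibre_skew[OF assms(2) that] that
      u_fibre_in[OF assms(1)] u_fibre_in[OF assms(2)]
    by (simp add: fib.h_add herm_add_right algebra_simps)
qed (use assms in \<open>auto simp: u_fibre_in u_fibre_add u_fibre_scl u_fibre_off fib.S_add vs.scale_right_distrib\<close>)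

lemma u_fibre_rscl:
  assumes "a \<in> u_fibre F p"
  shows "(\<lambda>v. rscl F r (a v)) \<in> u_fibre F p"
proof (rule u_fibreI)
  show "herm F p (rscl F r (a v)) w + herm F p v (rscl F r (a w)) = 0" if "v \<in> fibre F p" "w \<in> fibre F p" for v w
    using u_fibre_skew[OF assms(1) that] that u_fibre_in[OF assms(1)]
    by (simp add: fib.h_scale herm_scale_right distrib_left[symmetric])
qed (use assms in \<open>auto simp: u_fibre_in u_fibre_add u_fibre_scl u_fibre_off fib.S_scale vs.scale_right_distrib mult.commute\<close>)

lemma u_fibre_uminus:
  assumes "a \<in> u_fibre F p"
  shows "- a \<in> u_fibre F p"
proof -
  have "- a = (\<lambda>v. rscl F (-1) (a v))" by (rule ext) simp
  then show ?thesis using u_fibre_rscl[OF assms, of "-1"] by simp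
qed

text \<open>A composite of antihermitian maps is not antihermitian in general, but in the commutator
  the skewness identities of both factors combine. All forms below therefore take values in sums of
  commutators.\<close>

lemma u_fibre_commutator:
  assumes a: "a \<in> u_fibre F p" and b: "b \<in> u_fibre F p"
  shows "(\<lambda>v. a (b v) - b (a v)) \<in> u_fibre F p"
proof (rule u_fibreI)
  show "herm F p (a (b v) - b (a v)) w + herm F p v (a (b w) - b (a w)) = 0"
    if v: "v \<in> fibre F p" and w: "w \<in> fibre F p" for v w
    using u_fibre_skew[OF a u_fibre_in[OF b v] w] u_fibre_skew[OF b v u_fibre_in[OF a w]]
      u_fibre_skew[OF b u_fibre_in[OF a v] w] u_fibre_skew[OF a v u_fibre_in[OF b w]] v w
    by (simp add: fib.h_diff herm_diff_right u_fibre_in[OF a] u_fibre_in[OF b])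
      algebra
next
  show "a (b v) - b (a v) = 0" if "v \<notin> fibre F p" for v
    using that a b by (simp add: u_fibre_off u_fibre_zero)
qed (use a b in \<open>auto simp: u_fibre_in u_fibre_add u_fibre_scl fib.S_diff vs.scale_right_diff_distrib\<close>)

lemma u_forms1_apply:
  assumes A: "A \<in> u_forms1 M F" and c: "c \<in> charts M" and U: "open U" and s: "\<sigma> \<in> sections M F U"
  shows "(\<lambda>q. A q (coord_vec M c v q) (\<sigma> q)) \<in> sections M F (U \<inter> fst c)"
  using U chart_open[OF c]
  by (intro u_sections_apply[OF u_forms1_coord[OF A c]] sections_subset[OF s]) auto

lemma u_forms1_expand:
  assumes A: "A \<in> u_forms1 M F" and X: "X \<in> tspace M p" and c: "c \<in> charts M" "p \<in> fst c"
  shows "A p X v = (\<Sum>i\<in>UNIV. rscl F (X (chart_coord c i)) (A p (coord_vec M c (axis i 1) p) v))"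
  by (rule tspace_linear_expand[where L = "\<lambda>X. A p X v", OF _ _ X c])
    (simp_all only: u_forms1_add[OF A] u_forms1_scale[OF A] plus_fun_apply)

end

section \<open>Connections in local coordinates\<close>

definition scale_form1 :: "('m, 'v) hbundle \<Rightarrow> real \<Rightarrow> ('m, 'v) uform1 \<Rightarrow> ('m, 'v) uform1" where
  "scale_form1 F r A = (\<lambda>p X v. rscl F r (A p X v))"

definition scale_form2 :: "('m, 'v) hbundle \<Rightarrow> real \<Rightarrow> ('m, 'v) uform2 \<Rightarrow> ('m, 'v) uform2" where
  "scale_form2 F r \<omega> = (\<lambda>p X Y v. rscl F r (\<omega> p X Y v))"

text \<open>The polarisation \<open>A \<and> B + B \<and> A\<close> of the quadratic expression
  \<open>A \<and> A\<close>. Unlike \<open>A \<and> B\<close> alone it is built from commutators and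
  so stays antihermitian.\<close>

definition wedge_bracket :: "('m::topological_space, 'n::finite) rmfd \<Rightarrow>
    ('m, 'v::ab_group_add) hbundle \<Rightarrow> ('m, 'v) uform1 \<Rightarrow> ('m, 'v) uform1 \<Rightarrow> ('m, 'v) uform2" where
  "wedge_bracket M F A B p X Y v =
     (if X \<in> tspace M p \<and> Y \<in> tspace M p \<and> v \<in> fibre F p
      then (A p X (B p Y v) - B p Y (A p X v)) - (A p Y (B p X v) - B p X (A p Y v)) else 0)"

text \<open>Evaluates a definite description over decompositions once some decomposition exists and
  all of them give the same value.\<close>

lemma the_representation:
  assumes "\<exists>x y z. P x y z" and "\<And>x y z. P x y z \<Longrightarrow> f x y z = r"
  shows "(THE w. \<exists>x y z. P x y z \<and> w = f x y z) = r"
proof (rule the_equality)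
  show "\<exists>x y z. P x y z \<and> r = f x y z" using assms by metis
  show "w = r" if "\<exists>x y z. P x y z \<and> w = f x y z" for w using that assms(2) by auto
qed

text \<open>Equations between endomorphisms are asked for after application to a vector, and
  smoothness after application to a section over an open part of a chart; these are the shapes in
  which the operators are computed.\<close>

lemma u_forms1I:
  assumes "\<And>p X. X \<in> tspace M p \<Longrightarrow> A p X \<in> u_fibre F p"
    and "\<And>p X Y v. X \<in> tspace M p \<Longrightarrow> Y \<in> tspace M p \<Longrightarrow> A p (X + Y) v = A p X v + A p Y v"
    and "\<And>p X r v. X \<in> tspace M p \<Longrightarrow> A p (tscale r X) v = rscl F r (A p X v)"
    and "\<And>p X v. X \<notin> tspace M p \<Longrightarrow> A p X v = 0"
    and "\<And>c v U \<sigma>. c \<in> charts M \<Longrightarrow> open U \<Longrightarrow> U \<subseteq> fst c \<Longrightarrow> \<sigma> \<in> sections M F U \<Longrightarrow>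
      (\<lambda>p. A p (coord_vec M c v p) (\<sigma> p)) \<in> sections M F U"
    and coord: "\<And>c v p. c \<in> charts M \<Longrightarrow> p \<in> fst c \<Longrightarrow> coord_vec M c v p \<in> tspace M p"
  shows "A \<in> u_forms1 M F"
  unfolding u_forms1_def u_sections_def
proof (intro CollectI conjI allI ballI impI)
  show "A p (X + Y) = A p X + A p Y" if "X \<in> tspace M p" "Y \<in> tspace M p" for p X Y
    by (rule ext) (simp only: plus_fun_apply assms(2)[OF that])
  show "A p X = 0" if "X \<notin> tspace M p" for p X
    by (rule ext) (simp only: zero_fun_apply assms(4)[OF that])
  fix c v
  assume c: "c \<in> charts M"
  show "A p (coord_vec M c v p) \<in> u_fibre F p" if "p \<in> fst c" for p
    by (rule assms(1)[OF coord[OF c that]])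
  show "(\<lambda>p. A p (coord_vec M c v p) (\<sigma> p)) \<in> sections M F U"
    if "open U \<and> U \<subseteq> fst c" "\<sigma> \<in> sections M F U" for U \<sigma>
    using that by (intro assms(5)[OF c]) auto
qed (rule assms; assumption)+

lemma u_forms2I:
  assumes "\<And>p X Y. X \<in> tspace M p \<Longrightarrow> Y \<in> tspace M p \<Longrightarrow> \<omega> p X Y \<in> u_fibre F p"
    and "\<And>p X Y v. X \<in> tspace M p \<Longrightarrow> Y \<in> tspace M p \<Longrightarrow> \<omega> p Y X v = - \<omega> p X Y v"
    and "\<And>p X Y Z v. X \<in> tspace M p \<Longrightarrow> Y \<in> tspace M p \<Longrightarrow> Z \<in> tspace M p \<Longrightarrow>
      \<omega> p (X + Z) Y v = \<omega> p X Y v + \<omega> p Z Y v"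
    and "\<And>p X Y r v. X \<in> tspace M p \<Longrightarrow> Y \<in> tspace M p \<Longrightarrow> \<omega> p (tscale r X) Y v = rscl F r (\<omega> p X Y v)"
    and "\<And>p X Y v. X \<notin> tspace M p \<or> Y \<notin> tspace M p \<Longrightarrow> \<omega> p X Y v = 0"
    and "\<And>c v w U \<sigma>. c \<in> charts M \<Longrightarrow> open U \<Longrightarrow> U \<subseteq> fst c \<Longrightarrow> \<sigma> \<in> sections M F U \<Longrightarrow>
      (\<lambda>p. \<omega> p (coord_vec M c v p) (coord_vec M c w p) (\<sigma> p)) \<in> sections M F U"
    and coord: "\<And>c v p. c \<in> charts M \<Longrightarrow> p \<in> fst c \<Longrightarrow> coord_vec M c v p \<in> tspace M p"
  shows "\<omega> \<in> u_forms2 M F"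
  unfolding u_forms2_def u_sections_def
proof (intro CollectI conjI allI ballI impI)
  show "\<omega> p Y X = - \<omega> p X Y" if "X \<in> tspace M p" "Y \<in> tspace M p" for p X Y
    by (rule ext) (simp only: fun_Compl_def uminus_apply assms(2)[OF that])
  show "\<omega> p (X + Z) Y = \<omega> p X Y + \<omega> p Z Y" if "X \<in> tspace M p" "Y \<in> tspace M p" "Z \<in> tspace M p" for p X Y Z
    by (rule ext) (simp only: plus_fun_apply assms(3)[OF that])
  show "\<omega> p X Y = 0" if "X \<notin> tspace M p \<or> Y \<notin> tspace M p" for p X Y
    by (rule ext) (simp only: zero_fun_apply assms(5)[OF that])
  fix c v w
  assume c: "c \<in> charts M"
  show "\<omega> p (coord_vec M c v p) (coord_vec M c w p) \<in> u_fibre F p" if "p \<in> fst c" for p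
    by (rule assms(1)[OF coord[OF c that] coord[OF c that]])
  show "(\<lambda>p. \<omega> p (coord_vec M c v p) (coord_vec M c w p) (\<sigma> p)) \<in> sections M F U"
    if "open U \<and> U \<subseteq> fst c" "\<sigma> \<in> sections M F U" for U \<sigma>
    using that by (intro assms(6)[OF c]) auto
qed (rule assms; assumption)+

section \<open>Sums and real multiples of endomorphism-valued forms\<close>

context hermitian_vb
begin

lemma u_forms1_plus:
  assumes A: "A \<in> u_forms1 M F" and B: "B \<in> u_forms1 M F"
  shows "A + B \<in> u_forms1 M F"
proof (rule u_forms1I)
  show "(A + B) p X \<in> u_fibre F p" if "X \<in> tspace M p" for p X
    using u_fibre_plus[OF u_forms1_fibre[OF A that] u_forms1_fibre[OF B that]] by simp
  show "(\<lambda>p. (A + B) p (coord_vec M c v p) (\<sigma> p)) \<in> sections M F U"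
    if "c \<in> charts M" "open U" "U \<subseteq> fst c" "\<sigma> \<in> sections M F U" for c v U \<sigma>
    using sections_add[OF that(2) u_sections_apply[OF u_forms1_coord[OF A that(1)] that(2-4)]
        u_sections_apply[OF u_forms1_coord[OF B that(1)] that(2-4)]]
    by (simp only: plus_fun_apply)
qed (simp_all only: plus_fun_apply u_forms1_add[OF A] u_forms1_add[OF B] u_forms1_scale[OF A]
    u_forms1_scale[OF B] u_forms1_zero[OF A] u_forms1_zero[OF B] vs.scale_right_distrib zero_fun_apply
    coord_vec_in ac_simps add_0 simp_thms)

lemma u_forms1_scale_form1:
  assumes A: "A \<in> u_forms1 M F"
  shows "scale_form1 F r A \<in> u_forms1 M F"
  unfolding scale_form1_def
proof (rule u_forms1I)
  show "(\<lambda>v. rscl F r (A p X v)) \<in> u_fibre F p" if "X \<in> tspace M p" for p X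
    by (rule u_fibre_rscl[OF u_forms1_fibre[OF A that]])
  show "(\<lambda>p. rscl F r (A p (coord_vec M c v p) (\<sigma> p))) \<in> sections M F U"
    if "c \<in> charts M" "open U" "U \<subseteq> fst c" "\<sigma> \<in> sections M F U" for c v U \<sigma>
    by (rule sections_scl[OF that(2) u_sections_apply[OF u_forms1_coord[OF A that(1)] that(2-4)] smooth_fun_const])
qed (simp_all only: plus_fun_apply u_forms1_add[OF A] u_forms1_scale[OF A] u_forms1_zero[OF A]
    vs.scale_right_distrib zero_fun_apply coord_vec_in vs.scale_scale vs.scale_zero_right mult.commute simp_thms)

lemma u_forms2_scale_form2:
  assumes A: "\<omega> \<in> u_forms2 M F"
  shows "scale_form2 F r \<omega> \<in> u_forms2 M F"
  unfolding scale_form2_def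
proof (rule u_forms2I)
  show "(\<lambda>v. rscl F r (\<omega> p X Y v)) \<in> u_fibre F p" if "X \<in> tspace M p" "Y \<in> tspace M p" for p X Y
    by (rule u_fibre_rscl[OF u_forms2_fibre[OF A that]])
  show "(\<lambda>p. rscl F r (\<omega> p (coord_vec M c v p) (coord_vec M c w p) (\<sigma> p))) \<in> sections M F U"
    if "c \<in> charts M" "open U" "U \<subseteq> fst c" "\<sigma> \<in> sections M F U" for c v w U \<sigma>
    by (rule sections_scl[OF that(2) u_sections_apply[OF u_forms2_coord[OF A that(1)] that(2-4)] smooth_fun_const])
  show "rscl F r (\<omega> p Y X v) = - rscl F r (\<omega> p X Y v)" if "X \<in> tspace M p" "Y \<in> tspace M p" for p X Y v
    using u_forms2_skew[OF A that] by simp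
qed (simp_all only: plus_fun_apply u_forms2_add[OF A] u_forms2_scale[OF A] u_forms2_zero[OF A]
    vs.scale_right_distrib zero_fun_apply coord_vec_in vs.scale_scale vs.scale_zero_right mult.commute simp_thms)

lemma u_forms2_plus:
  assumes A: "\<omega> \<in> u_forms2 M F" and B: "\<omega>' \<in> u_forms2 M F"
  shows "\<omega> + \<omega>' \<in> u_forms2 M F"
proof (rule u_forms2I)
  show "(\<omega> + \<omega>') p X Y \<in> u_fibre F p" if "X \<in> tspace M p" "Y \<in> tspace M p" for p X Y
    using u_fibre_plus[OF u_forms2_fibre[OF A that] u_forms2_fibre[OF B that]] by simp
  show "(\<lambda>p. (\<omega> + \<omega>') p (coord_vec M c v p) (coord_vec M c w p) (\<sigma> p)) \<in> sections M F U"
    if "c \<in> charts M" "open U" "U \<subseteq> fst c" "\<sigma> \<in> sections M F U" for c v w U \<sigma>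
    using sections_add[OF that(2) u_sections_apply[OF u_forms2_coord[OF A that(1)] that(2-4)]
        u_sections_apply[OF u_forms2_coord[OF B that(1)] that(2-4)]]
    by (simp only: plus_fun_apply)
  show "(\<omega> + \<omega>') p Y X v = - (\<omega> + \<omega>') p X Y v" if "X \<in> tspace M p" "Y \<in> tspace M p" for p X Y v
    using u_forms2_skew[OF A that] u_forms2_skew[OF B that] by simp
qed (simp_all only: plus_fun_apply u_forms2_add[OF A] u_forms2_scale[OF A] u_forms2_zero[OF A]
    u_forms2_add[OF B] u_forms2_scale[OF B] u_forms2_zero[OF B]
    vs.scale_right_distrib zero_fun_apply coord_vec_in ac_simps add_0 simp_thms)

lemma u_forms1_apply_sum:
  assumes A: "A \<in> u_forms1 M F" and "finite I" and X: "\<And>i. i \<in> I \<Longrightarrow> X i \<in> tspace M p"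
  shows "A p (\<Sum>i\<in>I. tscale (a i) (X i)) v = (\<Sum>i\<in>I. rscl F (a i) (A p (X i) v))"
proof -
  have "A p (\<Sum>i\<in>I. tscale (a i) (X i)) v = (\<Sum>i\<in>I. A p (tscale (a i) (X i)) v)"
    by (rule tspace_additive_sum[where L = "\<lambda>X. A p X v" and p = p])
      (simp_all only: u_forms1_add[OF A] plus_fun_apply tspace_scale X)
  then show ?thesis by (simp add: u_forms1_scale[OF A] X)
qed

lemma u_forms2_apply_sum:
  assumes A: "\<omega> \<in> u_forms2 M F" and "finite I" and X: "\<And>i. i \<in> I \<Longrightarrow> X i \<in> tspace M p" and Y: "Y \<in> tspace M p"
  shows "\<omega> p (\<Sum>i\<in>I. tscale (a i) (X i)) Y v = (\<Sum>i\<in>I. rscl F (a i) (\<omega> p (X i) Y v))"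
proof -
  have "\<omega> p (\<Sum>i\<in>I. tscale (a i) (X i)) Y v = (\<Sum>i\<in>I. \<omega> p (tscale (a i) (X i)) Y v)"
    by (rule tspace_additive_sum[where L = "\<lambda>X. \<omega> p X Y v" and p = p])
      (simp_all only: u_forms2_add[OF A _ Y] plus_fun_apply tspace_scale X)
  then show ?thesis by (simp add: u_forms2_scale[OF A _ Y] X)
qed

lemma u_forms2_add_right:
  assumes A: "\<omega> \<in> u_forms2 M F" and "X \<in> tspace M p" "Y \<in> tspace M p" "Z \<in> tspace M p"
  shows "\<omega> p X (Y + Z) v = \<omega> p X Y v + \<omega> p X Z v"
  using u_forms2_skew[OF A assms(2) tspace_add[OF assms(3,4)]] u_forms2_skew[OF A assms(2,3)]
    u_forms2_skew[OF A assms(2,4)] u_forms2_add[OF A assms(3,2,4)]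
  by (metis (no_types, lifting) minus_add_distrib minus_minus plus_fun_apply uminus_apply)

lemma u_forms2_scale_right:
  assumes A: "\<omega> \<in> u_forms2 M F" and "X \<in> tspace M p" "Y \<in> tspace M p"
  shows "\<omega> p X (tscale r Y) v = rscl F r (\<omega> p X Y v)"
  using u_forms2_skew[OF A tspace_scale[OF assms(3), of r] assms(2)] u_forms2_skew[OF A assms(3,2)]
    u_forms2_scale[OF A assms(3,2), of r v]
  by simp

subsection \<open>The algebraic operations on forms\<close>

text \<open>The coordinate differentials paired with the values of \<open>A\<close> on the
  coordinate vectors give a decomposition.\<close>

lemma tensor_rep_ex:
  assumes A: "A \<in> u_forms1 M F"
  shows "\<exists>N \<eta> e. tensor_rep M F p (A p) N \<eta> e"
proof -
  obtain c where c: "c \<in> charts M" "p \<in> fst c" by (rule chart_cover)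
  have "tensor_rep M F p (A p) CARD('n) (\<lambda>a Z. Z (chart_coord c (enum_UNIV a)))
      (\<lambda>a. A p (coord_vec M c (axis (enum_UNIV a) 1) p))"
    unfolding tensor_rep_def
  proof (intro conjI allI impI ballI)
    fix X v assume X: "X \<in> tspace M p"
    show "A p X v = (\<Sum>a<CARD('n). rscl F (X (chart_coord c (enum_UNIV a))) (A p (coord_vec M c (axis (enum_UNIV a) 1) p) v))"
      using u_forms1_expand[OF A X c, of v]
        sum_enum_UNIV[of "\<lambda>i. rscl F (X (chart_coord c i)) (A p (coord_vec M c (axis i 1) p) v)"] by simp
  qed (rule covector_eval, rule u_forms1_fibre[OF A coord_vec_in[OF c]])
  then show ?thesis by blast
qed

lemma tensor_rep_fibre: "tensor_rep M F p A N \<eta> e \<Longrightarrow> a < N \<Longrightarrow> e a \<in> u_fibre F p"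
  and tensor_rep_covector: "tensor_rep M F p A N \<eta> e \<Longrightarrow> a < N \<Longrightarrow> covector M p (\<eta> a)"
  and tensor_rep_eq: "tensor_rep M F p A N \<eta> e \<Longrightarrow> X \<in> tspace M p \<Longrightarrow> v \<in> fibre F p \<Longrightarrow>
    A X v = (\<Sum>a<N. rscl F (\<eta> a X) (e a v))"
  by (simp_all add: tensor_rep_def)

text \<open>Composing the representation of \<open>A p X\<close> with that of \<open>A p Y\<close>
  reproduces one half of the double sum; the outcome no longer mentions the decomposition.\<close>

lemma wedge_self_eq:
  assumes A: "A \<in> u_forms1 M F" and X: "X \<in> tspace M p" and Y: "Y \<in> tspace M p" and v: "v \<in> fibre F p"
  shows "wedge_self M F A p X Y v = A p X (A p Y v) - A p Y (A p X v)"
proof -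
  have uniq: "(\<Sum>a<N. \<Sum>b<N. rscl F (\<eta> a X * \<eta> b Y - \<eta> a Y * \<eta> b X) (e a (e b v))) =
      A p X (A p Y v) - A p Y (A p X v)" if r: "tensor_rep M F p (A p) N \<eta> e" for N \<eta> e
  proof -
    have *: "A p X (A p Y v) = (\<Sum>a<N. \<Sum>b<N. rscl F (\<eta> a X * \<eta> b Y) (e a (e b v)))"
      if X: "X \<in> tspace M p" and Y: "Y \<in> tspace M p" for X Y
    proof -
      have "A p X (A p Y v) = (\<Sum>a<N. rscl F (\<eta> a X) (e a (\<Sum>b<N. rscl F (\<eta> b Y) (e b v))))"
        unfolding tensor_rep_eq[OF r Y v, symmetric]
        by (rule tensor_rep_eq[OF r X u_fibre_in[OF u_forms1_fibre[OF A Y] v]])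
      also have "e a (\<Sum>b<N. rscl F (\<eta> b Y) (e b v)) = (\<Sum>b<N. rscl F (\<eta> b Y) (e a (e b v)))" if "a < N" for a
        using u_fibre_in[OF tensor_rep_fibre[OF r] v]
        by (intro u_fibre_lincomb[OF tensor_rep_fibre[OF r that]]) simp
      then have "(\<Sum>a<N. rscl F (\<eta> a X) (e a (\<Sum>b<N. rscl F (\<eta> b Y) (e b v)))) =
          (\<Sum>a<N. rscl F (\<eta> a X) (\<Sum>b<N. rscl F (\<eta> b Y) (e a (e b v))))"
        by simp
      finally show ?thesis by (simp add: vs.scale_sum_right)
    qed
    show ?thesis
      unfolding *[OF X Y] *[OF Y X] sum_subtractf[symmetric]
      by (simp add: vs.scale_left_diff_distrib)
  qed
  show ?thesis
    unfolding wedge_self_def using X Y v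
    by (simp only: simp_thms if_True) (rule the_representation[OF tensor_rep_ex[OF A]], erule uniq)
qed

text \<open>Once \<open>sharp\<close> is written in an orthonormal basis, the sum over
  \<open>a\<close> with coefficients \<open>\<eta> a (b i)\<close> reassembles
  \<open>A p (b i)\<close>, and the decomposition disappears.\<close>

lemma dagger_eq:
  assumes A: "A \<in> u_forms1 M F" and \<omega>: "\<omega> \<in> u_forms2 M F" and Y: "Y \<in> tspace M p" and v: "v \<in> fibre F p"
    and b: "orthonormal_basis M p b"
  shows "dagger M F A \<omega> p Y v = (\<Sum>i\<in>UNIV. \<omega> p (b i) Y (A p (b i) v) - A p (b i) (\<omega> p (b i) Y v))"
proof -
  note bi = orthonormal_basis_in[OF b]
  have uniq: "(\<Sum>a<N. \<omega> p (sharp M p (\<eta> a)) Y (e a v) - e a (\<omega> p (sharp M p (\<eta> a)) Y v)) =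
      (\<Sum>i\<in>UNIV. \<omega> p (b i) Y (A p (b i) v) - A p (b i) (\<omega> p (b i) Y v))" (is "?L = ?R")
    if r: "tensor_rep M F p (A p) N \<eta> e" for N \<eta> e
  proof -
    have wf: "\<omega> p (b i) Y u \<in> fibre F p" if "u \<in> fibre F p" for i u
      by (rule u_fibre_in[OF u_forms2_fibre[OF \<omega> bi Y] that])
    have "?L = (\<Sum>a<N. (\<Sum>i\<in>UNIV. rscl F (\<eta> a (b i)) (\<omega> p (b i) Y (e a v))) -
        (\<Sum>i\<in>UNIV. rscl F (\<eta> a (b i)) (e a (\<omega> p (b i) Y v))))"
    proof (rule sum.cong[OF refl])
      fix a assume "a \<in> {..<N}"
      then have a: "e a \<in> u_fibre F p" "covector M p (\<eta> a)"
        using tensor_rep_fibre[OF r] tensor_rep_covector[OF r] by auto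
      show "\<omega> p (sharp M p (\<eta> a)) Y (e a v) - e a (\<omega> p (sharp M p (\<eta> a)) Y v) =
        (\<Sum>i\<in>UNIV. rscl F (\<eta> a (b i)) (\<omega> p (b i) Y (e a v))) -
        (\<Sum>i\<in>UNIV. rscl F (\<eta> a (b i)) (e a (\<omega> p (b i) Y v)))"
        unfolding sharp_eq[OF a(2) b] u_forms2_apply_sum[OF \<omega> finite bi Y]
        using v by (simp add: u_fibre_sum[OF a(1)] u_fibre_scl[OF a(1)] wf fib.S_scale)
    qed
    also have "\<dots> = (\<Sum>a<N. \<Sum>i\<in>UNIV. rscl F (\<eta> a (b i)) (\<omega> p (b i) Y (e a v))) -
        (\<Sum>a<N. \<Sum>i\<in>UNIV. rscl F (\<eta> a (b i)) (e a (\<omega> p (b i) Y v)))"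
      by (rule sum_subtractf)
    also have "\<dots> = (\<Sum>i\<in>UNIV. \<Sum>a<N. rscl F (\<eta> a (b i)) (\<omega> p (b i) Y (e a v))) -
        (\<Sum>i\<in>UNIV. \<Sum>a<N. rscl F (\<eta> a (b i)) (e a (\<omega> p (b i) Y v)))"
      by (intro arg_cong2[where f = minus] sum.swap)
    also have "\<dots> = (\<Sum>i\<in>UNIV. \<omega> p (b i) Y (A p (b i) v)) - (\<Sum>i\<in>UNIV. A p (b i) (\<omega> p (b i) Y v))"
    proof (intro arg_cong2[where f = minus] sum.cong refl)
      fix i
      have w: "\<omega> p (b i) Y \<in> u_fibre F p" by (rule u_forms2_fibre[OF \<omega> bi Y])
      show "(\<Sum>a<N. rscl F (\<eta> a (b i)) (\<omega> p (b i) Y (e a v))) = \<omega> p (b i) Y (A p (b i) v)"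
        unfolding tensor_rep_eq[OF r bi v] using u_fibre_in[OF tensor_rep_fibre[OF r] v]
        by (intro u_fibre_lincomb[OF w, symmetric]) simp
      show "(\<Sum>a<N. rscl F (\<eta> a (b i)) (e a (\<omega> p (b i) Y v))) = A p (b i) (\<omega> p (b i) Y v)"
        by (rule tensor_rep_eq[OF r bi wf[OF v], symmetric])
    qed
    finally show ?thesis by (simp add: sum_subtractf)
  qed
  show ?thesis
    unfolding dagger_def using Y v
    by (simp only: simp_thms if_True) (rule the_representation[OF tensor_rep_ex[OF A]], erule uniq)
qed

lemma dagger_in:
  assumes A: "A \<in> u_forms1 M F" and \<omega>: "\<omega> \<in> u_forms2 M F"
  shows "dagger M F A \<omega> \<in> u_forms1 M F"
proof (rule u_forms1I)
  have off: "dagger M F A \<omega> p Y v = 0" if "v \<notin> fibre F p" for p Y v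
    using that by (simp add: dagger_def)
  show fib: "dagger M F A \<omega> p Y \<in> u_fibre F p" if Y: "Y \<in> tspace M p" for p Y
  proof -
    obtain b where b: "orthonormal_basis M p b" using orthonormal_basis_ex by blast
    \<comment> \<open>At a single point the value is a finite sum of commutators of antihermitian
      maps.\<close>
    let ?g = "\<lambda>i v. \<omega> p (b i) Y (A p (b i) v) - A p (b i) (\<omega> p (b i) Y v)"
    have g: "?g i \<in> u_fibre F p" for i
      by (rule u_fibre_commutator[OF u_forms2_fibre[OF \<omega> orthonormal_basis_in[OF b] Y]
            u_forms1_fibre[OF A orthonormal_basis_in[OF b]]])
    have "(\<Sum>i\<in>I. ?g i) \<in> u_fibre F p" for I
      by (induction I rule: infinite_finite_induct) (simp_all only: sum.infinite sum.empty sum.insert u_fibre_zero_in u_fibre_plus g not_False_eq_True)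
    moreover have "(\<Sum>i\<in>I. ?g i) v = (\<Sum>i\<in>I. ?g i v)" for I v
      by (induction I rule: infinite_finite_induct) simp_all
    moreover have "dagger M F A \<omega> p Y v = (\<Sum>i\<in>UNIV. ?g i v)" for v
      using dagger_eq[OF A \<omega> Y _ b, of v] off[of v p Y] u_fibre_off[OF g] by (cases "v \<in> fibre F p") simp_all
    ultimately have "dagger M F A \<omega> p Y = (\<Sum>i\<in>UNIV. ?g i)" by (intro ext) simp
    with \<open>(\<Sum>i\<in>UNIV. ?g i) \<in> u_fibre F p\<close> show ?thesis by simp
  qed
  show "dagger M F A \<omega> p (X + Y) v = dagger M F A \<omega> p X v + dagger M F A \<omega> p Y v"
    if X: "X \<in> tspace M p" and Y: "Y \<in> tspace M p" for p X Y v
  proof (cases "v \<in> fibre F p")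
    case True
    obtain b where b: "orthonormal_basis M p b" using orthonormal_basis_ex by blast
    note bi = orthonormal_basis_in[OF b]
    have "\<omega> p (b i) (X + Y) (A p (b i) v) - A p (b i) (\<omega> p (b i) (X + Y) v) =
      (\<omega> p (b i) X (A p (b i) v) - A p (b i) (\<omega> p (b i) X v)) +
      (\<omega> p (b i) Y (A p (b i) v) - A p (b i) (\<omega> p (b i) Y v))" for i
      unfolding u_forms2_add_right[OF \<omega> bi X Y]
      by (simp add: u_fibre_add[OF u_forms1_fibre[OF A bi]] u_fibre_in[OF u_forms2_fibre[OF \<omega> bi]] X Y True)
    then show ?thesis
      by (simp only: dagger_eq[OF A \<omega> _ True b] X Y tspace_add sum.distrib)
  qed (simp add: off)
  show "dagger M F A \<omega> p (tscale r X) v = rscl F r (dagger M F A \<omega> p X v)"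
    if X: "X \<in> tspace M p" for p X r v
  proof (cases "v \<in> fibre F p")
    case True
    obtain b where b: "orthonormal_basis M p b" using orthonormal_basis_ex by blast
    note bi = orthonormal_basis_in[OF b]
    show ?thesis
      by (simp add: dagger_eq[OF A \<omega> _ True b] X tspace_scale u_forms2_scale_right[OF \<omega> bi X] vs.scale_sum_right
          u_fibre_scl[OF u_forms1_fibre[OF A bi]] u_fibre_in[OF u_forms2_fibre[OF \<omega> bi]] True vs.scale_right_diff_distrib)
  qed (simp add: off)
  show "dagger M F A \<omega> p X v = 0" if "X \<notin> tspace M p" for p X v
    using that by (simp add: dagger_def)
  fix c w U \<sigma>
  assume c: "c \<in> charts M" and U: "open U" "U \<subseteq> fst c" and s: "\<sigma> \<in> sections M F U"
  let ?e = "\<lambda>p i. coord_vec M c (axis i 1) p" and ?w = "\<lambda>p. coord_vec M c w p"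
  \<comment> \<open>Only fixed coordinate fields and smooth coefficients occur here, so this is
    visibly a section; the comparison with \<open>dagger\<close> is made point by point, with a
    basis chosen at that point.\<close>
  let ?s = "\<lambda>p. \<Sum>i\<in>UNIV. \<Sum>j\<in>UNIV. rscl F (inv_gram M c p $ i $ j)
    (\<omega> p (?e p i) (?w p) (A p (?e p j) (\<sigma> p)) - A p (?e p j) (\<omega> p (?e p i) (?w p) (\<sigma> p)))"
  have "?s \<in> sections M F U"
    by (intro sections_sum sections_rscl sections_diff U(1) smooth_fun_subset[OF inv_gram_smooth[OF c] U(2)]
        u_sections_apply[OF u_forms1_coord[OF A c] U] u_sections_apply[OF u_forms2_coord[OF \<omega> c] U] s)
  then show "(\<lambda>p. dagger M F A \<omega> p (?w p) (\<sigma> p)) \<in> sections M F U"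
  proof (rule sections_cong)
    fix p assume p: "p \<in> U"
    then have cp: "p \<in> fst c" using U by blast
    obtain b where b: "orthonormal_basis M p b" using orthonormal_basis_ex by blast
    note sp = sections_fibre[OF s p] and w = coord_vec_in[OF c cp, of w]
    have Af: "A p X u \<in> fibre F p" if "X \<in> tspace M p" "u \<in> fibre F p" for X u
      by (rule u_fibre_in[OF u_forms1_fibre[OF A that(1)] that(2)])
    have wf: "\<omega> p X (?w p) u \<in> fibre F p" if "X \<in> tspace M p" "u \<in> fibre F p" for X u
      by (rule u_fibre_in[OF u_forms2_fibre[OF \<omega> that(1) w] that(2)])
    show "?s p = dagger M F A \<omega> p (?w p) (\<sigma> p)"
      unfolding dagger_eq[OF A \<omega> w sp b]
    proof (rule contraction_eq[OF module_rscl c cp b,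
          where \<beta> = "\<lambda>X Y. \<omega> p X (?w p) (A p Y (\<sigma> p)) - A p Y (\<omega> p X (?w p) (\<sigma> p))", symmetric])
      fix X Y Z r assume X: "X \<in> tspace M p" and Y: "Y \<in> tspace M p" and Z: "Z \<in> tspace M p"
      show "\<omega> p (X + Y) (?w p) (A p Z (\<sigma> p)) - A p Z (\<omega> p (X + Y) (?w p) (\<sigma> p)) =
        \<omega> p X (?w p) (A p Z (\<sigma> p)) - A p Z (\<omega> p X (?w p) (\<sigma> p)) +
        (\<omega> p Y (?w p) (A p Z (\<sigma> p)) - A p Z (\<omega> p Y (?w p) (\<sigma> p)))"
        unfolding u_forms2_add[OF \<omega> X w Y] plus_fun_apply
        by (simp add: u_fibre_add[OF u_forms1_fibre[OF A Z]] wf X Y sp)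
      show "\<omega> p Z (?w p) (A p (X + Y) (\<sigma> p)) - A p (X + Y) (\<omega> p Z (?w p) (\<sigma> p)) =
        \<omega> p Z (?w p) (A p X (\<sigma> p)) - A p X (\<omega> p Z (?w p) (\<sigma> p)) +
        (\<omega> p Z (?w p) (A p Y (\<sigma> p)) - A p Y (\<omega> p Z (?w p) (\<sigma> p)))"
        unfolding u_forms1_add[OF A X Y] plus_fun_apply
        by (simp add: u_fibre_add[OF u_forms2_fibre[OF \<omega> Z w]] Af X Y sp)
    next
      fix X Z r assume X: "X \<in> tspace M p" and Z: "Z \<in> tspace M p"
      show "\<omega> p (tscale r X) (?w p) (A p Z (\<sigma> p)) - A p Z (\<omega> p (tscale r X) (?w p) (\<sigma> p)) =
        rscl F r (\<omega> p X (?w p) (A p Z (\<sigma> p)) - A p Z (\<omega> p X (?w p) (\<sigma> p)))"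
        by (simp add: u_forms2_scale[OF \<omega> X w] u_fibre_scl[OF u_forms1_fibre[OF A Z]] wf X sp vs.scale_right_diff_distrib)
      show "\<omega> p Z (?w p) (A p (tscale r X) (\<sigma> p)) - A p (tscale r X) (\<omega> p Z (?w p) (\<sigma> p)) =
        rscl F r (\<omega> p Z (?w p) (A p X (\<sigma> p)) - A p X (\<omega> p Z (?w p) (\<sigma> p)))"
        by (simp add: u_forms1_scale[OF A X] u_fibre_scl[OF u_forms2_fibre[OF \<omega> Z w]] Af X sp vs.scale_right_diff_distrib)
    qed
  qed
qed (rule coord_vec_in)

lemma wedge_bracket_eq:
  "X \<in> tspace M p \<Longrightarrow> Y \<in> tspace M p \<Longrightarrow> v \<in> fibre F p \<Longrightarrow> wedge_bracket M F A B p X Y v =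
    (A p X (B p Y v) - B p Y (A p X v)) - (A p Y (B p X v) - B p X (A p Y v))"
  by (simp add: wedge_bracket_def)

lemma wedge_bracket_in:
  assumes A: "A \<in> u_forms1 M F" and B: "B \<in> u_forms1 M F"
  shows "wedge_bracket M F A B \<in> u_forms2 M F"
proof (rule u_forms2I)
  have off: "wedge_bracket M F A B p X Y v = 0" if "v \<notin> fibre F p" for p X Y v
    using that by (simp add: wedge_bracket_def)
  show "wedge_bracket M F A B p X Y \<in> u_fibre F p" if X: "X \<in> tspace M p" and Y: "Y \<in> tspace M p" for p X Y
  proof -
    let ?g = "\<lambda>X Y v. A p X (B p Y v) - B p Y (A p X v)"
    have g: "?g X Y \<in> u_fibre F p" if "X \<in> tspace M p" "Y \<in> tspace M p" for X Y
      by (rule u_fibre_commutator[OF u_forms1_fibre[OF A that(1)] u_forms1_fibre[OF B that(2)]])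
    have "wedge_bracket M F A B p X Y = ?g X Y + - ?g Y X"
    proof
      fix v show "wedge_bracket M F A B p X Y v = (?g X Y + - ?g Y X) v"
        using u_fibre_off[OF g[OF X Y], of v] u_fibre_off[OF g[OF Y X], of v]
        by (cases "v \<in> fibre F p") (simp_all add: wedge_bracket_eq[OF X Y] off)
    qed
    then show ?thesis using u_fibre_plus[OF g[OF X Y] u_fibre_uminus[OF g[OF Y X]]] by simp
  qed
  have AB: "A p X v \<in> fibre F p" "B p X v \<in> fibre F p" if "X \<in> tspace M p" "v \<in> fibre F p" for p X v
    using that by (auto intro: u_fibre_in u_forms1_fibre[OF A] u_forms1_fibre[OF B])
  show "wedge_bracket M F A B p Y X v = - wedge_bracket M F A B p X Y v"
    if X: "X \<in> tspace M p" and Y: "Y \<in> tspace M p" for p X Y v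
    using X Y by (simp add: wedge_bracket_def)
  show "wedge_bracket M F A B p (X + Z) Y v = wedge_bracket M F A B p X Y v + wedge_bracket M F A B p Z Y v"
    if X: "X \<in> tspace M p" and Y: "Y \<in> tspace M p" and Z: "Z \<in> tspace M p" for p X Y Z v
  proof (cases "v \<in> fibre F p")
    case True
    show ?thesis
      unfolding wedge_bracket_eq[OF tspace_add[OF X Z] Y True] wedge_bracket_eq[OF X Y True]
        wedge_bracket_eq[OF Z Y True] u_forms1_add[OF A X Z] u_forms1_add[OF B X Z] plus_fun_apply
      by (simp add: u_fibre_add[OF u_forms1_fibre[OF A Y]] u_fibre_add[OF u_forms1_fibre[OF B Y]] AB X Z True)
  qed (simp add: off)
  show "wedge_bracket M F A B p (tscale r X) Y v = rscl F r (wedge_bracket M F A B p X Y v)"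
    if X: "X \<in> tspace M p" and Y: "Y \<in> tspace M p" for p X Y r v
  proof (cases "v \<in> fibre F p")
    case True
    show ?thesis
      by (simp add: wedge_bracket_eq[OF tspace_scale[OF X] Y True] wedge_bracket_eq[OF X Y True]
        u_forms1_scale[OF A X] u_forms1_scale[OF B X] AB X Y True vs.scale_right_diff_distrib
        u_fibre_scl[OF u_forms1_fibre[OF A Y]] u_fibre_scl[OF u_forms1_fibre[OF B Y]])
  qed (simp add: off)
  show "wedge_bracket M F A B p X Y v = 0" if "X \<notin> tspace M p \<or> Y \<notin> tspace M p" for p X Y v
    using that by (auto simp: wedge_bracket_def)
  fix c v w U \<sigma>
  assume c: "c \<in> charts M" and U: "open U" "U \<subseteq> fst c" and s: "\<sigma> \<in> sections M F U"
  let ?v = "coord_vec M c v" and ?w = "coord_vec M c w"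
  have "(\<lambda>p. (A p (?v p) (B p (?w p) (\<sigma> p)) - B p (?w p) (A p (?v p) (\<sigma> p))) -
      (A p (?w p) (B p (?v p) (\<sigma> p)) - B p (?v p) (A p (?w p) (\<sigma> p)))) \<in> sections M F U"
    by (intro sections_diff U(1) u_sections_apply[OF u_forms1_coord[OF A c] U]
        u_sections_apply[OF u_forms1_coord[OF B c] U] s)
  then show "(\<lambda>p. wedge_bracket M F A B p (?v p) (?w p) (\<sigma> p)) \<in> sections M F U"
  proof (rule sections_cong)
    fix q assume "q \<in> U"
    then show "(A q (?v q) (B q (?w q) (\<sigma> q)) - B q (?w q) (A q (?v q) (\<sigma> q))) -
      (A q (?w q) (B q (?v q) (\<sigma> q)) - B q (?v q) (A q (?w q) (\<sigma> q))) = wedge_bracket M F A B q (?v q) (?w q) (\<sigma> q)"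
      using U sections_fibre[OF s] by (subst wedge_bracket_eq) (auto intro: coord_vec_in[OF c])
  qed
qed (rule coord_vec_in)

text \<open>The bracket of a form with itself counts the wedge square twice. Membership of
  \<open>wedge_self\<close> in \<open>u_forms2\<close> is thereby inherited from the
  bracket.\<close>

lemma wedge_self_bracket:
  assumes A: "A \<in> u_forms1 M F"
  shows "wedge_self M F A = scale_form2 F (1 / 2) (wedge_bracket M F A A)"
proof (intro ext)
  fix p X Y v
  show "wedge_self M F A p X Y v = scale_form2 F (1 / 2) (wedge_bracket M F A A) p X Y v"
  proof (cases "X \<in> tspace M p \<and> Y \<in> tspace M p \<and> v \<in> fibre F p")
    case True
    let ?x = "A p X (A p Y v) - A p Y (A p X v)"
    have "rscl F (1 / 2) (?x + ?x) = rscl F (1 / 2 + 1 / 2) ?x"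
      unfolding of_real_add vs.scale_left_distrib vs.scale_right_distrib ..
    then show ?thesis
      using True by (simp add: wedge_self_eq[OF A] wedge_bracket_eq scale_form2_def algebra_simps)
  next
    case False
    then show ?thesis
      unfolding wedge_self_def wedge_bracket_def scale_form2_def by (simp only: if_False vs.scale_zero_right)
  qed
qed

lemma wedge_self_in: "A \<in> u_forms1 M F \<Longrightarrow> wedge_self M F A \<in> u_forms2 M F"
  by (simp add: wedge_self_bracket u_forms2_scale_form2 wedge_bracket_in)

end

text \<open>Existence may be shown with a witness of unknown value, since the second premise
  identifies every admissible value with \<open>r\<close>. The explicit decompositions below thus
  never have to be evaluated.\<close>

lemma the_eqI: "\<exists>w. Q w \<Longrightarrow> (\<And>w. Q w \<Longrightarrow> w = r) \<Longrightarrow> The Q = r"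
  by (metis the_equality)

context riemannian
begin

lemma smooth_fun_cderiv:
  assumes c: "c \<in> charts M" and U: "open U" and f: "smooth_fun M U f"
  shows "smooth_fun M (U \<inter> fst c) (\<lambda>q. cderiv (coord_vec M c v q) f)"
  unfolding cderiv_def Complex_eq
  by (intro smooth_fun_add smooth_fun_mult smooth_fun_const smooth_fun_of_real smooth_fun_coord_vec c U
      smooth_fun_Re smooth_fun_Im f open_Int chart_open[OF c])

lemma cderiv_commute:
  assumes c: "c \<in> charts M" "p \<in> fst c" and U: "open U" "p \<in> U" and f: "smooth_fun M U f"
  shows "cderiv (coord_vec M c v p) (\<lambda>q. cderiv (coord_vec M c w q) f) =
    cderiv (coord_vec M c w p) (\<lambda>q. cderiv (coord_vec M c v q) f)"
  using coord_vec_commute[OF c U smooth_fun_Re[OF U(1) f], of v w] coord_vec_commute[OF c U smooth_fun_Im[OF U(1) f], of v w]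
  by (simp add: cderiv_def)

end

section \<open>Covariant derivatives, curvature and the induced operator in coordinates\<close>

locale vb_connection = hermitian_vb M F
  for M :: "('m::t2_space, 'n::finite) rmfd" and F :: "('m, 'v::ab_group_add) hbundle" +
  fixes D :: "('m, 'v) connection"
  assumes is_conn: "is_connection M F D"
begin

lemma
  assumes U: "open U" and s: "\<sigma> \<in> sections M F U"
  shows D_form: "D \<sigma> \<in> bundle_form1 M F U"
    and D_cong: "\<tau> \<in> sections M F U \<Longrightarrow> p \<in> U \<Longrightarrow> X \<in> tspace M p \<Longrightarrow> \<forall>q\<in>U. \<sigma> q = \<tau> q \<Longrightarrow> D \<sigma> p X = D \<tau> p X"
    and D_add: "\<tau> \<in> sections M F U \<Longrightarrow> p \<in> U \<Longrightarrow> X \<in> tspace M p \<Longrightarrow>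
      D (\<lambda>q. \<sigma> q + \<tau> q) p X = D \<sigma> p X + D \<tau> p X"
    and D_scl: "smooth_fun M U f \<Longrightarrow> p \<in> U \<Longrightarrow> X \<in> tspace M p \<Longrightarrow>
      D (\<lambda>q. scl F (f q) (\<sigma> q)) p X = scl F (cderiv X f) (\<sigma> p) + scl F (f p) (D \<sigma> p X)"
proof -
  note H = is_conn[unfolded is_connection_def, THEN spec, THEN mp, OF U, THEN bspec, OF s]
  show "D \<sigma> \<in> bundle_form1 M F U" by (rule H[THEN conjunct1])
  note H1 = H[THEN conjunct2, THEN conjunct1, THEN bspec, THEN bspec, THEN bspec]
  show "\<tau> \<in> sections M F U \<Longrightarrow> p \<in> U \<Longrightarrow> X \<in> tspace M p \<Longrightarrow> \<forall>q\<in>U. \<sigma> q = \<tau> q \<Longrightarrow> D \<sigma> p X = D \<tau> p X"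
    by (rule H1[THEN conjunct1, THEN mp])
  show "\<tau> \<in> sections M F U \<Longrightarrow> p \<in> U \<Longrightarrow> X \<in> tspace M p \<Longrightarrow> D (\<lambda>q. \<sigma> q + \<tau> q) p X = D \<sigma> p X + D \<tau> p X"
    by (rule H1[THEN conjunct2])
  show "smooth_fun M U f \<Longrightarrow> p \<in> U \<Longrightarrow> X \<in> tspace M p \<Longrightarrow>
      D (\<lambda>q. scl F (f q) (\<sigma> q)) p X = scl F (cderiv X f) (\<sigma> p) + scl F (f p) (D \<sigma> p X)"
    by (rule H[THEN conjunct2, THEN conjunct2, THEN spec, THEN mp, THEN bspec, THEN bspec])
qed

lemma D_local:
  assumes U: "open U" and s: "\<sigma> \<in> sections M F U" and "p \<in> U" "X \<in> tspace M p" and eq: "\<And>q. q \<in> U \<Longrightarrow> \<sigma> q = \<tau> q"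
  shows "D \<sigma> p X = D \<tau> p X"
  by (rule D_cong[OF U s sections_cong[OF s eq] assms(3,4)]) (auto simp: eq)

lemma D_fibre: "open U \<Longrightarrow> \<sigma> \<in> sections M F U \<Longrightarrow> p \<in> U \<Longrightarrow> X \<in> tspace M p \<Longrightarrow> D \<sigma> p X \<in> fibre F p"
  by (rule bundle_form1_fibre[OF D_form])

lemma D_section:
  "open U \<Longrightarrow> \<sigma> \<in> sections M F U \<Longrightarrow> c \<in> charts M \<Longrightarrow> (\<lambda>q. D \<sigma> q (coord_vec M c v q)) \<in> sections M F (U \<inter> fst c)"
  by (rule bundle_form1_coord[OF D_form])

lemma D_rscl:
  assumes U: "open U" and s: "\<sigma> \<in> sections M F U" and f: "smooth_fun M U f" and p: "p \<in> U" "X \<in> tspace M p"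
  shows "D (\<lambda>q. rscl F (f q) (\<sigma> q)) p X = rscl F (X f) (\<sigma> p) + rscl F (f p) (D \<sigma> p X)"
  using D_scl[OF U s smooth_fun_of_real[OF U f] p] cderiv_of_real[where X = X and f = f, OF tvec_const[OF p(2)]] by simp

lemma D_scl_const:
  assumes U: "open U" and s: "\<sigma> \<in> sections M F U" and p: "p \<in> U" "X \<in> tspace M p"
  shows "D (\<lambda>q. scl F z (\<sigma> q)) p X = scl F z (D \<sigma> p X)"
  using D_scl[OF U s smooth_fun_const p, of z] p by (simp add: cderiv_def Complex_eq)

lemma D_sum:
  assumes U: "open U" and "finite I" and "\<And>i. i \<in> I \<Longrightarrow> \<sigma> i \<in> sections M F U" and p: "p \<in> U" "X \<in> tspace M p"
  shows "D (\<lambda>q. \<Sum>i\<in>I. \<sigma> i q) p X = (\<Sum>i\<in>I. D (\<sigma> i) p X)"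
  using assms(2,3)
proof (induction I)
  case empty
  show ?case using D_scl_const[OF U sections_zero p, of 0] by simp
next
  case (insert i I)
  have "D (\<lambda>q. \<sigma> i q + (\<Sum>i\<in>I. \<sigma> i q)) p X = D (\<sigma> i) p X + D (\<lambda>q. \<Sum>i\<in>I. \<sigma> i q) p X"
    by (intro D_add[OF U] sections_sum U p insert.prems insertI1 insertI2)
  then show ?case using insert by simp
qed

abbreviation cov :: "'m set \<times> ('m \<Rightarrow> real ^ 'n) \<Rightarrow> real ^ 'n \<Rightarrow> ('m \<Rightarrow> 'v) \<Rightarrow> 'm \<Rightarrow> 'v" where
  "cov c v \<sigma> \<equiv> \<lambda>q. D \<sigma> q (coord_vec M c v q)"

text \<open>By the Leibniz rule the derivative of each summand splits in two: the derivatives of the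
  scalar components form the exterior derivative by \<open>ext_d_coord\<close>, and the rest forms
  the wedge with the derivative of the section.\<close>

lemma nabla1_coord:
  assumes \<omega>: "\<omega> \<in> bundle_form1 M F U" and U: "open U" "p \<in> U" and c: "c \<in> charts M" "p \<in> fst c"
  shows "nabla1 M F D \<omega> p (coord_vec M c v p) (coord_vec M c w p) =
    cov c v (\<lambda>q. \<omega> q (coord_vec M c w q)) p - cov c w (\<lambda>q. \<omega> q (coord_vec M c v q)) p"
  unfolding nabla1_def
proof (rule the_eqI)
  let ?v = "coord_vec M c v" and ?w = "coord_vec M c w"
  let ?Q = "\<lambda>r. \<exists>U (N::nat) \<beta> \<sigma>. open U \<and> p \<in> U \<and>
     (\<forall>a<N. \<beta> a \<in> real_form1 M U \<and> \<sigma> a \<in> sections M F U) \<and>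
     (\<forall>q\<in>U. \<forall>Z\<in>tspace M q. \<omega> q Z = (\<Sum>a<N. rscl F (\<beta> a q Z) (\<sigma> a q))) \<and>
     r = (\<Sum>a<N. rscl F (ext_d M (\<beta> a) p (?v p) (?w p)) (\<sigma> a p)
        - (rscl F (\<beta> a p (?v p)) (D (\<sigma> a) p (?w p)) - rscl F (\<beta> a p (?w p)) (D (\<sigma> a) p (?v p))))"
  let ?V = "U \<inter> fst c"
  have V: "open ?V" "p \<in> ?V" using U c chart_open[OF c(1)] by auto
  \<comment> \<open>The witness pairs the coordinate differentials with the values of \<omega> on
    the coordinate fields.\<close>
  let ?\<beta> = "\<lambda>a q Z. Z (chart_coord c (enum_UNIV a))" and ?\<sigma> = "\<lambda>a q. \<omega> q (coord_vec M c (axis (enum_UNIV a) 1) q)"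
  show "\<exists>w. ?Q w"
  proof (rule exI, rule exI[of _ ?V], rule exI[of _ "CARD('n)"], rule exI[of _ ?\<beta>], rule exI[of _ ?\<sigma>],
      intro conjI allI impI ballI V)
    show "?\<beta> a \<in> real_form1 M ?V" for a by (rule coord_form_in[OF c(1) V(1)]) simp
    show "?\<sigma> a \<in> sections M F ?V" for a by (rule bundle_form1_coord[OF \<omega> c(1)])
    fix q Z assume q: "q \<in> ?V" and Z: "Z \<in> tspace M q"
    have "\<omega> q Z = (\<Sum>i\<in>UNIV. rscl F (Z (chart_coord c i)) (\<omega> q (coord_vec M c (axis i 1) q)))"
      using q by (intro tspace_linear_expand[OF _ _ Z c(1)])
        (auto simp del: plus_fun_apply intro: bundle_form1_add[OF \<omega>] bundle_form1_scale[OF \<omega>])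
    then show "\<omega> q Z = (\<Sum>a<CARD('n). rscl F (?\<beta> a q Z) (?\<sigma> a q))"
      using sum_enum_UNIV[of "\<lambda>i. rscl F (Z (chart_coord c i)) (\<omega> q (coord_vec M c (axis i 1) q))"] by simp
  qed (rule refl)
next
  let ?v = "coord_vec M c v" and ?w = "coord_vec M c w"
  let ?Q = "\<lambda>r. \<exists>U (N::nat) \<beta> \<sigma>. open U \<and> p \<in> U \<and>
     (\<forall>a<N. \<beta> a \<in> real_form1 M U \<and> \<sigma> a \<in> sections M F U) \<and>
     (\<forall>q\<in>U. \<forall>Z\<in>tspace M q. \<omega> q Z = (\<Sum>a<N. rscl F (\<beta> a q Z) (\<sigma> a q))) \<and>
     r = (\<Sum>a<N. rscl F (ext_d M (\<beta> a) p (?v p) (?w p)) (\<sigma> a p)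
        - (rscl F (\<beta> a p (?v p)) (D (\<sigma> a) p (?w p)) - rscl F (\<beta> a p (?w p)) (D (\<sigma> a) p (?v p))))"
  fix r
  assume "?Q r"
  then show "r = cov c v (\<lambda>q. \<omega> q (?w q)) p - cov c w (\<lambda>q. \<omega> q (?v q)) p"
  proof (elim exE conjE)
    fix V :: "'m set" and N :: nat and \<beta> \<sigma>
    assume V: "open V" "p \<in> V" and bs: "\<forall>a<N. \<beta> a \<in> real_form1 M V \<and> \<sigma> a \<in> sections M F V"
      and rep: "\<forall>q\<in>V. \<forall>Z\<in>tspace M q. \<omega> q Z = (\<Sum>a<N. rscl F (\<beta> a q Z) (\<sigma> a q))"
      and r: "r = (\<Sum>a<N. rscl F (ext_d M (\<beta> a) p (?v p) (?w p)) (\<sigma> a p)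
        - (rscl F (\<beta> a p (?v p)) (D (\<sigma> a) p (?w p)) - rscl F (\<beta> a p (?w p)) (D (\<sigma> a) p (?v p))))"
    let ?W = "U \<inter> V \<inter> fst c"
    have W: "open ?W" "p \<in> ?W" using U V c chart_open[OF c(1)] by auto
    have b: "\<beta> a \<in> real_form1 M V" and s: "\<sigma> a \<in> sections M F V" if "a < N" for a using bs that by auto
    have sW: "\<sigma> a \<in> sections M F ?W" if "a < N" for a by (rule sections_subset[OF s[OF that]]) blast
    have bW: "smooth_fun M ?W (\<lambda>q. \<beta> a q (coord_vec M c w q))" if "a < N" for a w
      by (rule smooth_fun_subset[OF real_form1_coord[OF b[OF that] c(1)]]) blast
    have *: "cov c v (\<lambda>q. \<omega> q (coord_vec M c w q)) p = (\<Sum>a<N. rscl F (coord_vec M c v p (\<lambda>q. \<beta> a q (coord_vec M c w q))) (\<sigma> a p)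
       + rscl F (\<beta> a p (coord_vec M c w p)) (D (\<sigma> a) p (coord_vec M c v p)))" for v w
    proof -
      have "cov c v (\<lambda>q. \<omega> q (coord_vec M c w q)) p = cov c v (\<lambda>q. \<Sum>a<N. rscl F (\<beta> a q (coord_vec M c w q)) (\<sigma> a q)) p"
        by (rule D_local[OF W(1) sections_subset[OF bundle_form1_coord[OF \<omega> c(1)]] W(2) coord_vec_in[OF c]])
          (use rep coord_vec_in[OF c(1)] in auto)
      also have "\<dots> = (\<Sum>a<N. cov c v (\<lambda>q. rscl F (\<beta> a q (coord_vec M c w q)) (\<sigma> a q)) p)"
        by (rule D_sum[OF W(1) _ _ W(2) coord_vec_in[OF c]]) (auto intro!: sections_rscl W(1) sW bW)
      finally show ?thesis
        using D_rscl[OF W(1) sW bW W(2) coord_vec_in[OF c]] by simp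
    qed
    show ?thesis
      unfolding r *[of v w] *[of w v] sum_subtractf[symmetric]
      by (intro sum.cong) (simp_all add: ext_d_coord[OF b V c] vs.scale_left_diff_distrib algebra_simps)
  qed
qed

text \<open>The right-hand side is tensorial in the section, so by \<open>tensorial_eq\<close> all
  extensions of the vector \<open>\<sigma> p\<close> give one value and the description in
  \<open>curvature\<close> is justified.\<close>

lemma curvature_coord:
  assumes U: "open U" "p \<in> U" and s: "\<sigma> \<in> sections M F U" and c: "c \<in> charts M" "p \<in> fst c"
  shows "curvature M F D p (coord_vec M c v p) (coord_vec M c w p) (\<sigma> p) =
    cov c v (cov c w \<sigma>) p - cov c w (cov c v \<sigma>) p"
proof -
  let ?v = "coord_vec M c v" and ?w = "coord_vec M c w"
  let ?P = "\<lambda>\<sigma>. cov c v (cov c w \<sigma>) p - cov c w (cov c v \<sigma>) p"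
  have eq: "nabla1 M F D (D \<tau>) p (?v p) (?w p) = ?P \<tau>" if "open V" "p \<in> V" "\<tau> \<in> sections M F V" for V \<tau>
    by (rule nabla1_coord[OF D_form[OF that(1,3)] that(1,2) c])
  have tens: "tensorial p ?P"
  proof (rule tensorialI)
    fix V \<sigma> \<tau> assume V: "open V" "p \<in> V" and s: "\<sigma> \<in> sections M F V" and t: "\<tau> \<in> sections M F V"
    let ?W = "V \<inter> fst c"
    have W: "open ?W" "p \<in> ?W" using V c chart_open[OF c(1)] by auto
    have "cov c v (cov c w (\<lambda>q. \<sigma> q + \<tau> q)) p = cov c v (cov c w \<sigma>) p + cov c v (cov c w \<tau>) p" for v w
    proof -
      have "cov c v (cov c w (\<lambda>q. \<sigma> q + \<tau> q)) p = cov c v (\<lambda>q. cov c w \<sigma> q + cov c w \<tau> q) p"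
        by (rule D_local[OF W(1) D_section[OF V(1) sections_add[OF V(1) s t] c(1)] W(2) coord_vec_in[OF c]])
          (auto intro!: D_add[OF V(1) s t] coord_vec_in c)
      also have "\<dots> = cov c v (cov c w \<sigma>) p + cov c v (cov c w \<tau>) p"
        by (rule D_add[OF W(1) D_section[OF V(1) s c(1)] D_section[OF V(1) t c(1)] W(2) coord_vec_in[OF c]])
      finally show ?thesis .
    qed
    then show "?P (\<lambda>q. \<sigma> q + \<tau> q) = ?P \<sigma> + ?P \<tau>" by simp
    assume st: "\<And>q. q \<in> V \<Longrightarrow> \<sigma> q = \<tau> q"
    have "cov c v (cov c w \<sigma>) p = cov c v (cov c w \<tau>) p" for v w
      by (rule D_local[OF W(1) D_section[OF V(1) s c(1)] W(2) coord_vec_in[OF c]])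
        (auto intro!: D_local[OF V(1) s _ _ st] coord_vec_in c)
    then show "?P \<sigma> = ?P \<tau>" by simp
  next
    fix V \<sigma> and f :: "'m \<Rightarrow> complex"
    assume V: "open V" "p \<in> V" and s: "\<sigma> \<in> sections M F V" and f: "smooth_fun M V f"
    let ?W = "V \<inter> fst c"
    have W: "open ?W" "p \<in> ?W" using V c chart_open[OF c(1)] by auto
    have sW: "\<sigma> \<in> sections M F ?W" by (rule sections_subset[OF s]) blast
    have fW: "smooth_fun M ?W f" by (rule smooth_fun_subset[OF f]) blast
    \<comment> \<open>Exchanging \<open>v\<close> and \<open>w\<close> permutes the two terms with
      one derivative on \<open>f\<close>, and the first term is symmetric by
      \<open>cderiv_commute\<close>. Only the last term survives in the difference.\<close>
    have "cov c v (cov c w (\<lambda>q. scl F (f q) (\<sigma> q))) p =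
       scl F (cderiv (coord_vec M c v p) (\<lambda>q. cderiv (coord_vec M c w q) f)) (\<sigma> p) +
       scl F (cderiv (coord_vec M c w p) f) (cov c v \<sigma> p) +
       (scl F (cderiv (coord_vec M c v p) f) (cov c w \<sigma> p) + scl F (f p) (cov c v (cov c w \<sigma>) p))" for v w
    proof -
      have cs: "smooth_fun M ?W (\<lambda>q. cderiv (coord_vec M c w q) f)" by (rule smooth_fun_cderiv[OF c(1) V(1) f])
      note ds = D_section[OF V(1) s c(1), of w]
      have "cov c v (cov c w (\<lambda>q. scl F (f q) (\<sigma> q))) p =
        cov c v (\<lambda>q. scl F (cderiv (coord_vec M c w q) f) (\<sigma> q) + scl F (f q) (cov c w \<sigma> q)) p"
        by (rule D_local[OF W(1) D_section[OF V(1) sections_scl[OF V(1) s f] c(1)] W(2) coord_vec_in[OF c]])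
          (auto intro!: D_scl[OF V(1) s f] coord_vec_in c)
      also have "\<dots> = cov c v (\<lambda>q. scl F (cderiv (coord_vec M c w q) f) (\<sigma> q)) p + cov c v (\<lambda>q. scl F (f q) (cov c w \<sigma> q)) p"
        by (rule D_add[OF W(1) sections_scl[OF W(1) sW cs] sections_scl[OF W(1) ds fW] W(2) coord_vec_in[OF c]])
      finally show ?thesis
        using D_scl[OF W(1) sW cs W(2) coord_vec_in[OF c], of v] D_scl[OF W(1) ds fW W(2) coord_vec_in[OF c], of v] by simp
    qed
    then show "?P (\<lambda>q. scl F (f q) (\<sigma> q)) = scl F (f p) (?P \<sigma>)"
      using cderiv_commute[OF c V f, of v w] by (simp add: vs.scale_right_diff_distrib)
  qed
  have "(THE r. \<exists>V \<tau>. open V \<and> p \<in> V \<and> \<tau> \<in> sections M F V \<and> \<tau> p = \<sigma> p \<and>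
      r = nabla1 M F D (D \<tau>) p (?v p) (?w p)) = ?P \<sigma>"
  proof (rule the_eqI)
    show "\<exists>r V \<tau>. open V \<and> p \<in> V \<and> \<tau> \<in> sections M F V \<and> \<tau> p = \<sigma> p \<and>
      r = nabla1 M F D (D \<tau>) p (?v p) (?w p)"
      by (rule exI, rule exI[of _ U], rule exI[of _ \<sigma>], intro conjI U s, rule refl, rule refl)
    fix r assume "\<exists>V \<tau>. open V \<and> p \<in> V \<and> \<tau> \<in> sections M F V \<and> \<tau> p = \<sigma> p \<and>
      r = nabla1 M F D (D \<tau>) p (?v p) (?w p)"
    then show "r = ?P \<sigma>"
    proof (elim exE conjE)
      fix V \<tau> assume V: "open V" "p \<in> V" "\<tau> \<in> sections M F V" "\<tau> p = \<sigma> p"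
        and r: "r = nabla1 M F D (D \<tau>) p (?v p) (?w p)"
      show "r = ?P \<sigma>" unfolding r eq[OF V(1-3)]
        by (rule tensorial_eq[OF tens V(1-3) U s V(4)])
    qed
  qed
  then show ?thesis
    unfolding curvature_def
    using coord_vec_in[OF c] sections_fibre[OF s U(2)] by simp
qed

text \<open>The derivative of a scalar factor enters both terms in the same way, because
  \<open>h\<close> commutes with scalars; it cancels in the difference, which is therefore
  tensorial.\<close>

lemma conn_comm_eq:
  assumes h: "h \<in> u_sections M F V" "open V" "p \<in> V" and U: "open U" "p \<in> U" and s: "\<sigma> \<in> sections M F U"
    and X: "X \<in> tspace M p"
  shows "conn_comm M F D h p X (\<sigma> p) = D (\<lambda>q. h q (\<sigma> q)) p X - h p (D \<sigma> p X)"
proof -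
  let ?P = "\<lambda>\<sigma>. D (\<lambda>q. h q (\<sigma> q)) p X - h p (D \<sigma> p X)"
  have hp: "h p \<in> u_fibre F p" by (rule u_sections_fibre[OF h(1,3)])
  have tens: "tensorial p ?P"
  proof (rule tensorialI)
    fix U \<sigma> \<tau> assume U: "open U" "p \<in> U" and s: "\<sigma> \<in> sections M F U" and t: "\<tau> \<in> sections M F U"
    let ?W = "U \<inter> V"
    have W: "open ?W" "p \<in> ?W" "?W \<subseteq> V" "?W \<subseteq> U" using U h by auto
    note sW = sections_subset[OF s W(4)] and tW = sections_subset[OF t W(4)]
    note hs = u_sections_apply[OF h(1) W(1,3) sW] and ht = u_sections_apply[OF h(1) W(1,3) tW]
    have "D (\<lambda>q. h q (\<sigma> q) + h q (\<tau> q)) p X = D (\<lambda>q. h q (\<sigma> q + \<tau> q)) p X"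
      by (rule D_local[OF W(1) sections_add[OF W(1) hs ht] W(2) X], rule u_fibre_add[symmetric, OF u_sections_fibre[OF h(1)]])
        (use sections_fibre[OF sW] sections_fibre[OF tW] in auto)
    then show "?P (\<lambda>q. \<sigma> q + \<tau> q) = ?P \<sigma> + ?P \<tau>"
      using D_add[OF W(1) hs ht W(2) X] D_add[OF U(1) s t U(2) X]
      by (simp add: u_fibre_add[OF hp] D_fibre[OF U(1) s U(2) X] D_fibre[OF U(1) t U(2) X])
    assume st: "\<And>q. q \<in> U \<Longrightarrow> \<sigma> q = \<tau> q"
    have "D (\<lambda>q. h q (\<sigma> q)) p X = D (\<lambda>q. h q (\<tau> q)) p X"
      by (rule D_local[OF W(1) hs W(2) X]) (use st in auto)
    then show "?P \<sigma> = ?P \<tau>"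
      using D_local[OF U(1) s U(2) X st] by simp
  next
    fix U \<sigma> and f :: "'m \<Rightarrow> complex"
    assume U: "open U" "p \<in> U" and s: "\<sigma> \<in> sections M F U" and f: "smooth_fun M U f"
    let ?W = "U \<inter> V"
    have W: "open ?W" "p \<in> ?W" "?W \<subseteq> V" "?W \<subseteq> U" using U h by auto
    note sW = sections_subset[OF s W(4)] and fW = smooth_fun_subset[OF f W(4)]
    note hs = u_sections_apply[OF h(1) W(1,3) sW]
    have "D (\<lambda>q. scl F (f q) (h q (\<sigma> q))) p X = D (\<lambda>q. h q (scl F (f q) (\<sigma> q))) p X"
      by (rule D_local[OF W(1) sections_scl[OF W(1) hs fW] W(2) X], rule u_fibre_scl[symmetric, OF u_sections_fibre[OF h(1)]])
        (use sections_fibre[OF sW] in auto)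
    then have 1: "D (\<lambda>q. h q (scl F (f q) (\<sigma> q))) p X =
        scl F (cderiv X f) (h p (\<sigma> p)) + scl F (f p) (D (\<lambda>q. h q (\<sigma> q)) p X)"
      using D_scl[OF W(1) hs fW W(2) X] by simp
    show "?P (\<lambda>q. scl F (f q) (\<sigma> q)) = scl F (f p) (?P \<sigma>)"
      unfolding 1 D_scl[OF U(1) s f U(2) X]
      by (simp add: u_fibre_add[OF hp] u_fibre_scl[OF hp] fib.S_scale D_fibre[OF U(1) s U(2) X]
          sections_fibre[OF s U(2)] vs.scale_right_diff_distrib)
  qed
  have "(THE r. \<exists>U \<tau>. open U \<and> p \<in> U \<and> \<tau> \<in> sections M F U \<and> \<tau> p = \<sigma> p \<and> r = ?P \<tau>) = ?P \<sigma>"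
  proof (rule the_eqI)
    show "\<exists>r U \<tau>. open U \<and> p \<in> U \<and> \<tau> \<in> sections M F U \<and> \<tau> p = \<sigma> p \<and> r = ?P \<tau>"
      by (rule exI, rule exI[of _ U], rule exI[of _ \<sigma>], intro conjI U s, rule refl, rule refl)
    fix r assume "\<exists>U \<tau>. open U \<and> p \<in> U \<and> \<tau> \<in> sections M F U \<and> \<tau> p = \<sigma> p \<and> r = ?P \<tau>"
    then show "r = ?P \<sigma>"
    proof (elim exE conjE)
      fix V \<tau> assume V: "open V" "p \<in> V" "\<tau> \<in> sections M F V" "\<tau> p = \<sigma> p" and r: "r = ?P \<tau>"
      show "r = ?P \<sigma>" unfolding r by (rule tensorial_eq[OF tens V(1-3) U s V(4)])
    qed
  qed
  then show ?thesis
    unfolding conn_comm_def using X sections_fibre[OF s U(2)] by simp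
qed

text \<open>The commutator of the covariant derivative along \<open>v\<close> with the component of
  \<open>A\<close> along \<open>w\<close>, applied to a section.\<close>

abbreviation cov_end where
  "cov_end A c v w \<sigma> \<equiv> \<lambda>p. cov c v (\<lambda>q. A q (coord_vec M c w q) (\<sigma> q)) p - A p (coord_vec M c w p) (cov c v \<sigma> p)"

text \<open>The computation of \<open>nabla1_coord\<close> with endomorphisms in place of sections:
  derivatives of the scalar parts give the exterior derivative, and subtracting \<open>A\<close>
  after the covariant derivative turns the remainder into \<open>conn_comm\<close>.\<close>

lemma nabla_u_coord:
  assumes A: "A \<in> u_forms1 M F" and U: "open U" "p \<in> U" and s: "\<sigma> \<in> sections M F U" and c: "c \<in> charts M" "p \<in> fst c"
  shows "nabla_u M F D A p (coord_vec M c v p) (coord_vec M c w p) (\<sigma> p) = cov_end A c v w \<sigma> p - cov_end A c w v \<sigma> p"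
proof -
  let ?v = "coord_vec M c v" and ?w = "coord_vec M c w"
  let ?Q = "\<lambda>r. \<exists>U (N::nat) \<beta> h. open U \<and> p \<in> U \<and>
         (\<forall>a<N. \<beta> a \<in> real_form1 M U \<and> h a \<in> u_sections M F U) \<and>
         (\<forall>q\<in>U. \<forall>Z\<in>tspace M q. \<forall>u\<in>fibre F q. A q Z u = (\<Sum>a<N. rscl F (\<beta> a q Z) (h a q u))) \<and>
         r = (\<Sum>a<N. rscl F (ext_d M (\<beta> a) p (?v p) (?w p)) (h a p (\<sigma> p))
            - (rscl F (\<beta> a p (?v p)) (conn_comm M F D (h a) p (?w p) (\<sigma> p))
               - rscl F (\<beta> a p (?w p)) (conn_comm M F D (h a) p (?v p) (\<sigma> p))))"
  have "(THE r. ?Q r) =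
     cov_end A c v w \<sigma> p - cov_end A c w v \<sigma> p"
  proof (rule the_eqI)
    let ?\<beta> = "\<lambda>a q Z. Z (chart_coord c (enum_UNIV a))" and ?h = "\<lambda>a q. A q (coord_vec M c (axis (enum_UNIV a) 1) q)"
    show "\<exists>r. ?Q r"
    proof (rule exI, rule exI[of _ "fst c"], rule exI[of _ "CARD('n)"], rule exI[of _ ?\<beta>], rule exI[of _ ?h],
        intro conjI allI impI ballI c(2) chart_open[OF c(1)])
      show "?\<beta> a \<in> real_form1 M (fst c)" for a by (rule coord_form_in[OF c(1) chart_open[OF c(1)]]) simp
      show "?h a \<in> u_sections M F (fst c)" for a by (rule u_forms1_coord[OF A c(1)])
      fix q Z u assume q: "q \<in> fst c" and Z: "Z \<in> tspace M q"
      show "A q Z u = (\<Sum>a<CARD('n). rscl F (?\<beta> a q Z) (?h a q u))"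
        using u_forms1_expand[OF A Z c(1) q, of u]
          sum_enum_UNIV[of "\<lambda>i. rscl F (Z (chart_coord c i)) (A q (coord_vec M c (axis i 1) q) u)"] by simp
    qed (rule refl)
  next
    fix r
    assume "?Q r"
    then show "r = cov_end A c v w \<sigma> p - cov_end A c w v \<sigma> p"
    proof (elim exE conjE)
      fix V :: "'m set" and N :: nat and \<beta> h
      assume V: "open V" "p \<in> V" and bs: "\<forall>a<N. \<beta> a \<in> real_form1 M V \<and> h a \<in> u_sections M F V"
        and rep: "\<forall>q\<in>V. \<forall>Z\<in>tspace M q. \<forall>u\<in>fibre F q. A q Z u = (\<Sum>a<N. rscl F (\<beta> a q Z) (h a q u))"
        and r: "r = (\<Sum>a<N. rscl F (ext_d M (\<beta> a) p (?v p) (?w p)) (h a p (\<sigma> p))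
            - (rscl F (\<beta> a p (?v p)) (conn_comm M F D (h a) p (?w p) (\<sigma> p))
               - rscl F (\<beta> a p (?w p)) (conn_comm M F D (h a) p (?v p) (\<sigma> p))))"
      let ?W = "U \<inter> V \<inter> fst c"
      have W: "open ?W" "p \<in> ?W" using U V c chart_open[OF c(1)] by auto
      have b: "\<beta> a \<in> real_form1 M V" and h: "h a \<in> u_sections M F V" if "a < N" for a using bs that by auto
      have sW: "\<sigma> \<in> sections M F ?W" by (rule sections_subset[OF s]) blast
      have hW: "(\<lambda>q. h a q (\<sigma> q)) \<in> sections M F ?W" if "a < N" for a
        by (rule u_sections_apply[OF h[OF that] W(1) _ sW]) blast
      have bW: "smooth_fun M ?W (\<lambda>q. \<beta> a q (coord_vec M c w q))" if "a < N" for a w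
        by (rule smooth_fun_subset[OF real_form1_coord[OF b[OF that] c(1)]]) blast
      have *: "cov_end A c v w \<sigma> p = (\<Sum>a<N. rscl F (coord_vec M c v p (\<lambda>q. \<beta> a q (coord_vec M c w q))) (h a p (\<sigma> p))
         + rscl F (\<beta> a p (coord_vec M c w p)) (conn_comm M F D (h a) p (coord_vec M c v p) (\<sigma> p)))" for v w
      proof -
        have "cov c v (\<lambda>q. A q (coord_vec M c w q) (\<sigma> q)) p = cov c v (\<lambda>q. \<Sum>a<N. rscl F (\<beta> a q (coord_vec M c w q)) (h a q (\<sigma> q))) p"
        proof (rule D_local[OF W(1) _ W(2) coord_vec_in[OF c]])
          show "(\<lambda>q. A q (coord_vec M c w q) (\<sigma> q)) \<in> sections M F ?W"
            by (rule sections_subset[OF u_forms1_apply[OF A c(1) U(1) s]]) blast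
          show "A q (coord_vec M c w q) (\<sigma> q) = (\<Sum>a<N. rscl F (\<beta> a q (coord_vec M c w q)) (h a q (\<sigma> q)))" if "q \<in> ?W" for q
            using rep sections_fibre[OF s] coord_vec_in[OF c(1)] that by auto
        qed
        also have "\<dots> = (\<Sum>a<N. cov c v (\<lambda>q. rscl F (\<beta> a q (coord_vec M c w q)) (h a q (\<sigma> q))) p)"
          by (rule D_sum[OF W(1) _ _ W(2) coord_vec_in[OF c]]) (auto intro!: sections_rscl W(1) hW bW)
        also have "\<dots> = (\<Sum>a<N. rscl F (coord_vec M c v p (\<lambda>q. \<beta> a q (coord_vec M c w q))) (h a p (\<sigma> p))
         + rscl F (\<beta> a p (coord_vec M c w p)) (cov c v (\<lambda>q. h a q (\<sigma> q)) p))"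
          using D_rscl[OF W(1) hW bW W(2) coord_vec_in[OF c]] by simp
        finally have 1: "cov c v (\<lambda>q. A q (coord_vec M c w q) (\<sigma> q)) p = \<dots>" .
        \<comment> \<open>The decomposition holds on every vector of the fibre, in particular on the
          derivative of \<sigma> at \<open>p\<close>.\<close>
        have 2: "A p (coord_vec M c w p) (cov c v \<sigma> p) = (\<Sum>a<N. rscl F (\<beta> a p (coord_vec M c w p)) (h a p (cov c v \<sigma> p)))"
          using rep[THEN bspec, OF V(2), THEN bspec, OF coord_vec_in[OF c], THEN bspec, OF D_fibre[OF U(1) s U(2) coord_vec_in[OF c]]] .
        show ?thesis
          unfolding 1 2 sum_subtractf[symmetric]
          by (intro sum.cong)
            (simp_all add: conn_comm_eq[OF h V U s coord_vec_in[OF c]] vs.scale_right_diff_distrib algebra_simps)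
      qed
      show ?thesis
        unfolding r *[of v w] *[of w v] sum_subtractf[symmetric]
        by (intro sum.cong) (simp_all add: ext_d_coord[OF b V c] vs.scale_left_diff_distrib algebra_simps)
    qed
  qed
  then show ?thesis
    unfolding nabla_u_def
    using coord_vec_in[OF c] sections_fibre[OF s U(2)] by simp
qed

end

section \<open>Adding an endomorphism-valued form to a connection\<close>

lemma bundle_form1I:
  assumes "\<And>p X. p \<in> U \<Longrightarrow> X \<in> tspace M p \<Longrightarrow> \<omega> p X \<in> fibre F p"
    and "\<And>p X Y. p \<in> U \<Longrightarrow> X \<in> tspace M p \<Longrightarrow> Y \<in> tspace M p \<Longrightarrow> \<omega> p (X + Y) = \<omega> p X + \<omega> p Y"
    and "\<And>p X r. p \<in> U \<Longrightarrow> X \<in> tspace M p \<Longrightarrow> \<omega> p (tscale r X) = rscl F r (\<omega> p X)"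
    and "\<And>c v. c \<in> charts M \<Longrightarrow> (\<lambda>p. \<omega> p (coord_vec M c v p)) \<in> sections M F (U \<inter> fst c)"
  shows "\<omega> \<in> bundle_form1 M F U"
  unfolding bundle_form1_def by (intro CollectI conjI ballI allI) (rule assms; assumption)+

context riemannian
begin

lemma cderiv_cong:
  assumes X: "X \<in> tspace M p" and U: "open U" "p \<in> U" and f: "smooth_fun M U f" and eq: "\<And>q. q \<in> U \<Longrightarrow> f q = g q"
  shows "cderiv X f = cderiv X g"
proof -
  have "X (\<lambda>q. Re (f q)) = X (\<lambda>q. Re (g q))"
    by (rule tvec_cong[OF X U smooth_fun_Re[OF U(1) f]]) (simp add: eq)
  moreover have "X (\<lambda>q. Im (f q)) = X (\<lambda>q. Im (g q))"
    by (rule tvec_cong[OF X U smooth_fun_Im[OF U(1) f]]) (simp add: eq)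
  ultimately show ?thesis by (simp add: cderiv_def)
qed

lemma cderiv_add:
  assumes X: "X \<in> tspace M p" and U: "open U" "p \<in> U" and f: "smooth_fun M U f" and g: "smooth_fun M U g"
  shows "cderiv X (\<lambda>q. f q + g q) = cderiv X f + cderiv X g"
  using tvec_add[OF X U smooth_fun_Re[OF U(1) f] smooth_fun_Re[OF U(1) g]]
    tvec_add[OF X U smooth_fun_Im[OF U(1) f] smooth_fun_Im[OF U(1) g]]
  by (simp add: cderiv_def complex_eq_iff)

end

context vb_connection
begin

text \<open>The added term is linear over functions, so the Leibniz rule of \<open>D\<close> is
  inherited unchanged.\<close>

lemma is_connection_plus:
  assumes A: "A \<in> u_forms1 M F"
  shows "is_connection M F (D + morphism_of A)"
  unfolding is_connection_def
proof (intro allI impI ballI conjI)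
  have ap: "(D + morphism_of A) \<sigma> p X = D \<sigma> p X + A p X (\<sigma> p)" for \<sigma> p X
    by (simp add: morphism_of_def)
  fix U \<sigma> assume U: "open U" and s: "\<sigma> \<in> sections M F U"
  note Af = u_forms1_fibre[OF A]
  show "(D + morphism_of A) \<sigma> \<in> bundle_form1 M F U"
  proof (rule bundle_form1I)
    fix p X Y r assume p: "p \<in> U" and X: "X \<in> tspace M p"
    show "(D + morphism_of A) \<sigma> p X \<in> fibre F p"
      unfolding ap by (rule fib.S_add[OF D_fibre[OF U s p X] u_fibre_in[OF Af[OF X] sections_fibre[OF s p]]])
    show "(D + morphism_of A) \<sigma> p (tscale r X) = rscl F r ((D + morphism_of A) \<sigma> p X)"
      unfolding ap by (simp only: bundle_form1_scale[OF D_form[OF U s] p X] u_forms1_scale[OF A X] vs.scale_right_distrib)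
    assume Y: "Y \<in> tspace M p"
    show "(D + morphism_of A) \<sigma> p (X + Y) = (D + morphism_of A) \<sigma> p X + (D + morphism_of A) \<sigma> p Y"
      unfolding ap bundle_form1_add[OF D_form[OF U s] p X Y] u_forms1_add[OF A X Y] by simp
  next
    fix c v assume c: "c \<in> charts M"
    show "(\<lambda>p. (D + morphism_of A) \<sigma> p (coord_vec M c v p)) \<in> sections M F (U \<inter> fst c)"
      unfolding ap using U chart_open[OF c]
      by (intro sections_add D_section[OF U s c] u_forms1_apply[OF A c U s]) auto
  qed
  show "(D + morphism_of A) \<sigma> p X = (D + morphism_of A) \<tau> p X"
    if "\<tau> \<in> sections M F U" "p \<in> U" "X \<in> tspace M p" "\<forall>q\<in>U. \<sigma> q = \<tau> q" for \<tau> p X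
    unfolding ap using D_cong[OF U s that] that by simp
  show "(D + morphism_of A) (\<lambda>q. \<sigma> q + \<tau> q) p X = (D + morphism_of A) \<sigma> p X + (D + morphism_of A) \<tau> p X"
    if t: "\<tau> \<in> sections M F U" and p: "p \<in> U" and X: "X \<in> tspace M p" for \<tau> p X
    unfolding ap D_add[OF U s t p X] u_fibre_add[OF Af[OF X] sections_fibre[OF s p] sections_fibre[OF t p]]
    by simp
  show "(D + morphism_of A) (\<lambda>q. scl F (f q) (\<sigma> q)) p X =
      scl F (cderiv X f) (\<sigma> p) + scl F (f p) ((D + morphism_of A) \<sigma> p X)"
    if f: "smooth_fun M U f" and p: "p \<in> U" and X: "X \<in> tspace M p" for f p X
    unfolding ap D_scl[OF U s f p X] u_fibre_scl[OF Af[OF X] sections_fibre[OF s p]]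
    by (simp add: vs.scale_right_distrib)
qed

lemma nabla_u_off: "X \<notin> tspace M p \<or> Y \<notin> tspace M p \<or> v \<notin> fibre F p \<Longrightarrow> nabla_u M F D A p X Y v = 0"
  unfolding nabla_u_def by (rule if_not_P) blast

text \<open>The definition does not show linearity, as the two forms come with unrelated
  decompositions. In coordinates it is the linearity of \<open>D\<close> under constant
  scalars.\<close>

lemma nabla_u_linear:
  assumes A: "A \<in> u_forms1 M F" and B: "B \<in> u_forms1 M F"
  shows "nabla_u M F D (A + scale_form1 F r B) = nabla_u M F D A + scale_form2 F r (nabla_u M F D B)"
proof (intro ext)
  fix p X Y v
  define C where "C = A + scale_form1 F r B"
  have C: "C \<in> u_forms1 M F" unfolding C_def by (intro u_forms1_plus u_forms1_scale_form1 A B)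
  have Cap: "C q Z u = A q Z u + rscl F r (B q Z u)" for q Z u
    by (simp add: C_def scale_form1_def)
  have "nabla_u M F D C p X Y v = nabla_u M F D A p X Y v + rscl F r (nabla_u M F D B p X Y v)"
  proof (cases "X \<in> tspace M p \<and> Y \<in> tspace M p \<and> v \<in> fibre F p")
    case False
    then show ?thesis by (simp add: nabla_u_off)
  next
    case True
    obtain c where c: "c \<in> charts M" "p \<in> fst c" by (rule chart_cover)
    obtain x y where X: "X = coord_vec M c x p" and Y: "Y = coord_vec M c y p"
      using True tspace_obtain[OF _ c] by metis
    obtain U \<sigma> where U: "open U" "p \<in> U" and s: "\<sigma> \<in> sections M F U" and v: "\<sigma> p = v"
      using True by (elim conjE) (rule section_through)
    let ?W = "U \<inter> fst c"
    have W: "open ?W" "p \<in> ?W" using U c chart_open[OF c(1)] by auto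
    have k: "cov_end C c x y \<sigma> p = cov_end A c x y \<sigma> p + rscl F r (cov_end B c x y \<sigma> p)" for x y
    proof -
      let ?y = "coord_vec M c y"
      note As = u_forms1_apply[OF A c(1) U(1) s, of y] and Bs = u_forms1_apply[OF B c(1) U(1) s, of y]
      have "cov c x (\<lambda>q. A q (?y q) (\<sigma> q) + rscl F r (B q (?y q) (\<sigma> q))) p =
          cov c x (\<lambda>q. A q (?y q) (\<sigma> q)) p + rscl F r (cov c x (\<lambda>q. B q (?y q) (\<sigma> q)) p)"
        using D_add[OF W(1) As sections_scl[OF W(1) Bs smooth_fun_const] W(2) coord_vec_in[OF c]]
          D_scl_const[OF W(1) Bs W(2) coord_vec_in[OF c]] by simp
      then show ?thesis by (simp add: Cap vs.scale_right_diff_distrib)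
    qed
    show ?thesis
      unfolding X Y v[symmetric] nabla_u_coord[OF C U s c] nabla_u_coord[OF A U s c] nabla_u_coord[OF B U s c] k
      by (simp add: vs.scale_right_diff_distrib)
  qed
  then show "nabla_u M F D (A + scale_form1 F r B) p X Y v = (nabla_u M F D A + scale_form2 F r (nabla_u M F D B)) p X Y v"
    unfolding C_def[symmetric] by (simp add: scale_form2_def)
qed

text \<open>Two successive derivatives by the perturbed connection give four terms. After
  antisymmetrisation the two mixed ones pair up into the commutators of
  \<open>nabla_u_coord\<close>, and the term quadratic in \<open>A\<close> becomes the wedge
  square.\<close>

lemma curvature_plus:
  assumes A: "A \<in> u_forms1 M F"
  shows "curvature M F (D + morphism_of A) = curvature M F D + nabla_u M F D A + wedge_self M F A"
proof (intro ext)
  fix p X Y v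
  interpret hat: vb_connection M F "D + morphism_of A"
    by unfold_locales (rule is_connection_plus[OF A])
  show "curvature M F (D + morphism_of A) p X Y v = (curvature M F D + nabla_u M F D A + wedge_self M F A) p X Y v"
  proof (cases "X \<in> tspace M p \<and> Y \<in> tspace M p \<and> v \<in> fibre F p")
    case False
    then show ?thesis unfolding plus_fun_apply curvature_def wedge_self_def nabla_u_def by (simp only: if_False add_0)
  next
    case True
    obtain c where c: "c \<in> charts M" "p \<in> fst c" by (rule chart_cover)
    obtain x y where X: "X = coord_vec M c x p" and Y: "Y = coord_vec M c y p"
      using True tspace_obtain[OF _ c] by metis
    obtain U \<sigma> where U: "open U" "p \<in> U" and s: "\<sigma> \<in> sections M F U" and v: "\<sigma> p = v"
      using True by (elim conjE) (rule section_through)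
    let ?W = "U \<inter> fst c"
    have W: "open ?W" "p \<in> ?W" using U c chart_open[OF c(1)] by auto
    have "hat.cov c x (hat.cov c y \<sigma>) p = cov c x (cov c y \<sigma>) p + cov c x (\<lambda>q. A q (coord_vec M c y q) (\<sigma> q)) p
        + (A p (coord_vec M c x p) (cov c y \<sigma> p) + A p (coord_vec M c x p) (A p (coord_vec M c y p) (\<sigma> p)))" for x y
    proof -
      have "hat.cov c x (hat.cov c y \<sigma>) p =
        cov c x (\<lambda>q. cov c y \<sigma> q + A q (coord_vec M c y q) (\<sigma> q)) p +
        A p (coord_vec M c x p) (cov c y \<sigma> p + A p (coord_vec M c y p) (\<sigma> p))"
        by (simp add: morphism_of_def)
      also have "cov c x (\<lambda>q. cov c y \<sigma> q + A q (coord_vec M c y q) (\<sigma> q)) p =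
        cov c x (cov c y \<sigma>) p + cov c x (\<lambda>q. A q (coord_vec M c y q) (\<sigma> q)) p"
        by (rule D_add[OF W(1) D_section[OF U(1) s c(1)] u_forms1_apply[OF A c(1) U(1) s] W(2) coord_vec_in[OF c]])
      also have "A p (coord_vec M c x p) (cov c y \<sigma> p + A p (coord_vec M c y p) (\<sigma> p)) =
        A p (coord_vec M c x p) (cov c y \<sigma> p) + A p (coord_vec M c x p) (A p (coord_vec M c y p) (\<sigma> p))"
        by (intro u_fibre_add[OF u_forms1_fibre[OF A coord_vec_in[OF c]]] D_fibre[OF U(1) s U(2) coord_vec_in[OF c]]
            u_fibre_in[OF u_forms1_fibre[OF A coord_vec_in[OF c]]] sections_fibre[OF s U(2)])
      finally show ?thesis .
    qed
    then show ?thesis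
      unfolding plus_fun_apply[of "_ + _"] plus_fun_apply X Y v[symmetric]
      by (simp add: hat.curvature_coord[OF U s c, unfolded plus_fun_apply] curvature_coord[OF U s c] nabla_u_coord[OF A U s c]
          wedge_self_eq[OF A coord_vec_in[OF c] coord_vec_in[OF c] sections_fibre[OF s U(2)]] algebra_simps)
  qed
qed

lemma cov_end_in:
  assumes A: "A \<in> u_forms1 M F" and U: "open U" and s: "\<sigma> \<in> sections M F U" and c: "c \<in> charts M"
  shows "cov_end A c v w \<sigma> \<in> sections M F (U \<inter> fst c)"
proof -
  have W: "open (U \<inter> fst c)" using U chart_open[OF c] by blast
  have "cov c v (\<lambda>q. A q (coord_vec M c w q) (\<sigma> q)) \<in> sections M F (U \<inter> fst c)"
    using D_section[OF W u_forms1_apply[OF A c U s, of w] c, of v] by (simp add: Int_assoc)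
  moreover have "(\<lambda>p. A p (coord_vec M c w p) (cov c v \<sigma> p)) \<in> sections M F (U \<inter> fst c)"
    using u_forms1_apply[OF A c W D_section[OF U s c, of v], of w] by (simp add: Int_assoc)
  ultimately show ?thesis by (rule sections_diff[OF W])
qed

lemma cov_end_add:
  assumes A: "A \<in> u_forms1 M F" and U: "open U" "p \<in> U" and s: "\<sigma> \<in> sections M F U" and c: "c \<in> charts M" "p \<in> fst c"
  shows "cov_end A c (v + v') w \<sigma> p = cov_end A c v w \<sigma> p + cov_end A c v' w \<sigma> p"
    and "cov_end A c w (v + v') \<sigma> p = cov_end A c w v \<sigma> p + cov_end A c w v' \<sigma> p"
proof -
  let ?W = "U \<inter> fst c"
  have W: "open ?W" "p \<in> ?W" using U c chart_open[OF c(1)] by auto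
  note T = coord_vec_in[OF c] and As = u_forms1_apply[OF A c(1) U(1) s]
  note Ap = u_forms1_fibre[OF A T]
  have "cov c (v + v') \<tau> p = cov c v \<tau> p + cov c v' \<tau> p" if "open V" "p \<in> V" "\<tau> \<in> sections M F V" for V \<tau>
    unfolding coord_vec_add[OF c] by (rule bundle_form1_add[OF D_form[OF that(1,3)] that(2) T T])
  from this[OF W As] this[OF U s]
  show "cov_end A c (v + v') w \<sigma> p = cov_end A c v w \<sigma> p + cov_end A c v' w \<sigma> p"
    using u_fibre_add[OF Ap D_fibre[OF U(1) s U(2) T] D_fibre[OF U(1) s U(2) T]] by simp
  have "cov c w (\<lambda>q. A q (coord_vec M c (v + v') q) (\<sigma> q)) p =
      cov c w (\<lambda>q. A q (coord_vec M c v q) (\<sigma> q) + A q (coord_vec M c v' q) (\<sigma> q)) p"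
    by (rule D_local[OF W(1) As W(2) T])
      (simp only: coord_vec_add[OF c(1)] u_forms1_add[OF A coord_vec_in[OF c(1)] coord_vec_in[OF c(1)]] plus_fun_apply Int_iff)
  also have "\<dots> = cov c w (\<lambda>q. A q (coord_vec M c v q) (\<sigma> q)) p + cov c w (\<lambda>q. A q (coord_vec M c v' q) (\<sigma> q)) p"
    by (rule D_add[OF W(1) As As W(2) T])
  finally show "cov_end A c w (v + v') \<sigma> p = cov_end A c w v \<sigma> p + cov_end A c w v' \<sigma> p"
    unfolding coord_vec_add[OF c] u_forms1_add[OF A T T] plus_fun_apply by simp
qed

lemma cov_end_scale:
  assumes A: "A \<in> u_forms1 M F" and U: "open U" "p \<in> U" and s: "\<sigma> \<in> sections M F U" and c: "c \<in> charts M" "p \<in> fst c"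
  shows "cov_end A c (r *\<^sub>R v) w \<sigma> p = rscl F r (cov_end A c v w \<sigma> p)"
    and "cov_end A c w (r *\<^sub>R v) \<sigma> p = rscl F r (cov_end A c w v \<sigma> p)"
proof -
  let ?W = "U \<inter> fst c"
  have W: "open ?W" "p \<in> ?W" using U c chart_open[OF c(1)] by auto
  note T = coord_vec_in[OF c] and As = u_forms1_apply[OF A c(1) U(1) s]
  note Ap = u_forms1_fibre[OF A T]
  have "cov c (r *\<^sub>R v) \<tau> p = rscl F r (cov c v \<tau> p)" if "open V" "p \<in> V" "\<tau> \<in> sections M F V" for V \<tau>
    unfolding coord_vec_scale[OF c] by (rule bundle_form1_scale[OF D_form[OF that(1,3)] that(2) T])
  from this[OF W As] this[OF U s]
  show "cov_end A c (r *\<^sub>R v) w \<sigma> p = rscl F r (cov_end A c v w \<sigma> p)"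
    using u_fibre_scl[OF Ap D_fibre[OF U(1) s U(2) T]] by (simp add: vs.scale_right_diff_distrib)
  have "cov c w (\<lambda>q. A q (coord_vec M c (r *\<^sub>R v) q) (\<sigma> q)) p =
      cov c w (\<lambda>q. rscl F r (A q (coord_vec M c v q) (\<sigma> q))) p"
    by (rule D_local[OF W(1) As W(2) T])
      (simp only: coord_vec_scale[OF c(1)] u_forms1_scale[OF A coord_vec_in[OF c(1)]] Int_iff)
  also have "\<dots> = rscl F r (cov c w (\<lambda>q. A q (coord_vec M c v q) (\<sigma> q)) p)"
    by (rule D_scl_const[OF W(1) As W(2) T])
  finally show "cov_end A c w (r *\<^sub>R v) \<sigma> p = rscl F r (cov_end A c w v \<sigma> p)"
    unfolding coord_vec_scale[OF c] u_forms1_scale[OF A T] by (simp add: vs.scale_right_diff_distrib)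
qed

text \<open>Constant scalars suffice here: \<open>nabla_u_coord\<close> already shows that the
  resulting value depends on the section only through its value at \<open>p\<close>, so sums and
  multiples of vectors may be extended by sums and multiples of sections.\<close>

lemma cov_end_linear:
  assumes A: "A \<in> u_forms1 M F" and U: "open U" "p \<in> U" and s: "\<sigma> \<in> sections M F U" and t: "\<tau> \<in> sections M F U"
    and c: "c \<in> charts M" "p \<in> fst c"
  shows "cov_end A c v w (\<lambda>q. \<sigma> q + \<tau> q) p = cov_end A c v w \<sigma> p + cov_end A c v w \<tau> p"
    and "cov_end A c v w (\<lambda>q. scl F z (\<sigma> q)) p = scl F z (cov_end A c v w \<sigma> p)"
proof -
  let ?W = "U \<inter> fst c" and ?w = "coord_vec M c w"
  have W: "open ?W" "p \<in> ?W" using U c chart_open[OF c(1)] by auto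
  note T = coord_vec_in[OF c] and As = u_forms1_apply[OF A c(1) U(1) s] and At = u_forms1_apply[OF A c(1) U(1) t]
  note Ap = u_forms1_fibre[OF A T] and Aq = u_forms1_fibre[OF A coord_vec_in[OF c(1)]]
  have "cov c v (\<lambda>q. A q (?w q) (\<sigma> q) + A q (?w q) (\<tau> q)) p = cov c v (\<lambda>q. A q (?w q) (\<sigma> q + \<tau> q)) p"
    by (rule D_local[OF W(1) sections_add[OF W(1) As At] W(2) T], rule u_fibre_add[OF Aq, symmetric])
      (use sections_fibre[OF s] sections_fibre[OF t] in auto)
  then show "cov_end A c v w (\<lambda>q. \<sigma> q + \<tau> q) p = cov_end A c v w \<sigma> p + cov_end A c v w \<tau> p"
    using D_add[OF W(1) As At W(2) T] D_add[OF U(1) s t U(2) T]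
      u_fibre_add[OF Ap D_fibre[OF U(1) s U(2) T] D_fibre[OF U(1) t U(2) T]]
    by simp
  have "cov c v (\<lambda>q. scl F z (A q (?w q) (\<sigma> q))) p = cov c v (\<lambda>q. A q (?w q) (scl F z (\<sigma> q))) p"
    by (rule D_local[OF W(1) sections_scl[OF W(1) As smooth_fun_const] W(2) T], rule u_fibre_scl[OF Aq, symmetric])
      (use sections_fibre[OF s] in auto)
  then show "cov_end A c v w (\<lambda>q. scl F z (\<sigma> q)) p = scl F z (cov_end A c v w \<sigma> p)"
    using D_scl_const[OF W(1) As W(2) T] D_scl_const[OF U(1) s U(2) T]
      u_fibre_scl[OF Ap D_fibre[OF U(1) s U(2) T]]
    by (simp add: vs.scale_right_diff_distrib)
qed

end

section \<open>Connections compatible with the metric\<close>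

locale herm_connection = hermitian_vb M F
  for M :: "('m::t2_space, 'n::finite) rmfd" and F :: "('m, 'v::ab_group_add) hbundle" +
  fixes D :: "('m, 'v) connection"
  assumes herm_conn: "hermitian_connection M F D"
begin

sublocale vb_connection M F D
  by unfold_locales (use herm_conn in \<open>simp add: hermitian_connection_def\<close>)

lemma compatible:
  assumes "open U" "\<sigma> \<in> sections M F U" "\<tau> \<in> sections M F U" "p \<in> U" "X \<in> tspace M p"
  shows "herm F p (D \<sigma> p X) (\<tau> p) + herm F p (\<sigma> p) (D \<tau> p X) = cderiv X (\<lambda>q. herm F q (\<sigma> q) (\<tau> q))"
  by (rule herm_conn[unfolded hermitian_connection_def, THEN conjunct2, THEN spec, THEN mp, THEN bspec, THEN bspec,
        THEN bspec, THEN bspec, OF assms])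

text \<open>The contribution of \<open>A\<close> to the compatibility identity is exactly the sum
  that vanishes for an antihermitian endomorphism.\<close>

lemma hermitian_connection_plus:
  assumes A: "A \<in> u_forms1 M F"
  shows "hermitian_connection M F (D + morphism_of A)"
  unfolding hermitian_connection_def
proof (intro conjI allI impI ballI)
  show "is_connection M F (D + morphism_of A)" by (rule is_connection_plus[OF A])
  fix U \<sigma> \<tau> p X assume U: "open U" and s: "\<sigma> \<in> sections M F U" and t: "\<tau> \<in> sections M F U"
    and p: "p \<in> U" and X: "X \<in> tspace M p"
  have f: "\<sigma> p \<in> fibre F p" "\<tau> p \<in> fibre F p" "D \<sigma> p X \<in> fibre F p" "D \<tau> p X \<in> fibre F p"
    by (rule sections_fibre[OF s p] sections_fibre[OF t p] D_fibre[OF U _ p X] s t)+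
  note Ap = u_forms1_fibre[OF A X]
  have "herm F p (D \<sigma> p X + A p X (\<sigma> p)) (\<tau> p) + herm F p (\<sigma> p) (D \<tau> p X + A p X (\<tau> p)) =
      (herm F p (D \<sigma> p X) (\<tau> p) + herm F p (\<sigma> p) (D \<tau> p X)) +
      (herm F p (A p X (\<sigma> p)) (\<tau> p) + herm F p (\<sigma> p) (A p X (\<tau> p)))"
    by (simp add: fib.h_add herm_add_right f u_fibre_in[OF Ap])
  then show "herm F p ((D + morphism_of A) \<sigma> p X) (\<tau> p) + herm F p (\<sigma> p) ((D + morphism_of A) \<tau> p X) =
        cderiv X (\<lambda>q. herm F q (\<sigma> q) (\<tau> q))"
    using compatible[OF U s t p X] u_fibre_skew[OF Ap f(1,2)] by (simp add: morphism_of_def)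
qed

text \<open>Differentiating the skewness identity of \<open>A\<close> along \<open>v\<close> with
  the help of compatibility produces the claim together with terms in which \<open>A\<close> meets
  the derivative of one section; the latter cancel by skewness again.\<close>

lemma cov_end_skew:
  assumes A: "A \<in> u_forms1 M F" and U: "open U" "p \<in> U" and s: "\<sigma> \<in> sections M F U" and t: "\<tau> \<in> sections M F U"
    and c: "c \<in> charts M" "p \<in> fst c"
  shows "herm F p (cov_end A c v w \<sigma> p) (\<tau> p) + herm F p (\<sigma> p) (cov_end A c v w \<tau> p) = 0"
proof -
  let ?W = "U \<inter> fst c" and ?w = "coord_vec M c w" and ?v = "coord_vec M c v p"
  have W: "open ?W" "p \<in> ?W" using U c chart_open[OF c(1)] by auto
  note T = coord_vec_in[OF c] and As = u_forms1_apply[OF A c(1) U(1) s, of w] and At = u_forms1_apply[OF A c(1) U(1) t, of w]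
  note Ap = u_forms1_fibre[OF A T] and Aq = u_forms1_fibre[OF A coord_vec_in[OF c(1)]]
  have sW: "\<sigma> \<in> sections M F ?W" and tW: "\<tau> \<in> sections M F ?W"
    using sections_subset[OF s, of ?W] sections_subset[OF t, of ?W] by auto
  have f: "\<sigma> p \<in> fibre F p" "\<tau> p \<in> fibre F p" "D \<sigma> p ?v \<in> fibre F p" "D \<tau> p ?v \<in> fibre F p"
    by (rule sections_fibre[OF s U(2)] sections_fibre[OF t U(2)] D_fibre[OF U(1) _ U(2) T] s t)+
  have g: "cov c v (\<lambda>q. A q (?w q) (\<sigma> q)) p \<in> fibre F p" "cov c v (\<lambda>q. A q (?w q) (\<tau> q)) p \<in> fibre F p"
    by (rule D_fibre[OF W(1) _ W(2) T] As At)+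
  have "cderiv ?v (\<lambda>q. herm F q (A q (?w q) (\<sigma> q)) (\<tau> q)) + cderiv ?v (\<lambda>q. herm F q (\<sigma> q) (A q (?w q) (\<tau> q))) =
      cderiv ?v (\<lambda>q. herm F q (A q (?w q) (\<sigma> q)) (\<tau> q) + herm F q (\<sigma> q) (A q (?w q) (\<tau> q)))"
    by (rule cderiv_add[OF T W herm_smooth[OF W(1) As tW] herm_smooth[OF W(1) sW At], symmetric])
  also have "\<dots> = cderiv ?v (\<lambda>q. 0)"
    by (rule cderiv_cong[OF T W smooth_fun_add[OF W(1) herm_smooth[OF W(1) As tW] herm_smooth[OF W(1) sW At]]],
        rule u_fibre_skew[OF Aq]) (use sections_fibre[OF s] sections_fibre[OF t] in auto)
  also have "\<dots> = 0" by (simp add: cderiv_def Complex_eq tvec_const[OF T])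
  finally have "herm F p (cov c v (\<lambda>q. A q (?w q) (\<sigma> q)) p) (\<tau> p) + herm F p (A p (?w p) (\<sigma> p)) (D \<tau> p ?v) +
      (herm F p (D \<sigma> p ?v) (A p (?w p) (\<tau> p)) + herm F p (\<sigma> p) (cov c v (\<lambda>q. A q (?w q) (\<tau> q)) p)) = 0"
    using compatible[OF W(1) As tW W(2) T, of v] compatible[OF W(1) sW At W(2) T, of v] by simp
  then show ?thesis
    using u_fibre_skew[OF Ap f(3,2), of w] u_fibre_skew[OF Ap f(1,4), of w]
    by (simp add: fib.h_diff herm_diff_right f g u_fibre_in[OF Ap]) algebra
qed

text \<open>Everything is read off from \<open>nabla_u_coord\<close>. Compatibility of
  \<open>D\<close> with the metric enters through \<open>cov_end_skew\<close>, for the antihermitian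
  values.\<close>

lemma nabla_u_in:
  assumes A: "A \<in> u_forms1 M F"
  shows "nabla_u M F D A \<in> u_forms2 M F"
proof (rule u_forms2I)
  have off: "nabla_u M F D A p X Y v = 0" if "v \<notin> fibre F p" for p X Y v
    using that by (simp add: nabla_u_off)
  show "nabla_u M F D A p X Y \<in> u_fibre F p" if XT: "X \<in> tspace M p" and YT: "Y \<in> tspace M p" for p X Y
  proof -
    obtain c where c: "c \<in> charts M" "p \<in> fst c" by (rule chart_cover)
    obtain x y where X: "X = coord_vec M c x p" and Y: "Y = coord_vec M c y p"
      using XT YT tspace_obtain[OF _ c] by metis
    show ?thesis unfolding X Y
    proof (rule u_fibreI)
      fix u v and z :: complex
      assume u: "u \<in> fibre F p"
      then obtain U \<sigma> where U: "open U" "p \<in> U" and s: "\<sigma> \<in> sections M F U" and su: "\<sigma> p = u" by (rule section_through)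
      let ?W = "U \<inter> fst c"
      have W: "open ?W" "p \<in> ?W" using U c chart_open[OF c(1)] by auto
      show "nabla_u M F D A p (coord_vec M c x p) (coord_vec M c y p) u \<in> fibre F p"
        unfolding su[symmetric] nabla_u_coord[OF A U s c]
        by (intro fib.S_diff[of _ p] sections_fibre[OF cov_end_in[OF A U(1) s c(1)] W(2)])
      show "nabla_u M F D A p (coord_vec M c x p) (coord_vec M c y p) (scl F z u) =
          scl F z (nabla_u M F D A p (coord_vec M c x p) (coord_vec M c y p) u)"
        using nabla_u_coord[OF A U sections_scl[OF U(1) s smooth_fun_const] c, of x y z]
        unfolding cov_end_linear(2)[OF A U s s c] su
        by (simp add: nabla_u_coord[OF A U s c, unfolded su] vs.scale_right_diff_distrib)
      assume "v \<in> fibre F p"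
      then obtain V \<tau> where V: "open V" "p \<in> V" and t: "\<tau> \<in> sections M F V" and tv: "\<tau> p = v" by (rule section_through)
      \<comment> \<open>Two vectors come with extensions over different neighbourhoods; additivity
        and skewness need both on one domain.\<close>
      let ?V = "U \<inter> V"
      have UV: "open ?V" "p \<in> ?V" using U V by auto
      have s': "\<sigma> \<in> sections M F ?V" and t': "\<tau> \<in> sections M F ?V"
        using sections_subset[OF s, of ?V] sections_subset[OF t, of ?V] by auto
      show "nabla_u M F D A p (coord_vec M c x p) (coord_vec M c y p) (u + v) =
          nabla_u M F D A p (coord_vec M c x p) (coord_vec M c y p) u +
          nabla_u M F D A p (coord_vec M c x p) (coord_vec M c y p) v"
        using nabla_u_coord[OF A UV sections_add[OF UV(1) s' t'] c, of x y]
        unfolding cov_end_linear(1)[OF A UV s' t' c] su tv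
        by (simp add: nabla_u_coord[OF A UV s' c, unfolded su] nabla_u_coord[OF A UV t' c, unfolded tv])
      have f: "cov_end A c v w \<rho> p \<in> fibre F p" if "\<rho> \<in> sections M F ?V" for v w \<rho>
        by (rule sections_fibre[OF cov_end_in[OF A UV(1) that c(1)]]) (use UV c in auto)
      show "herm F p (nabla_u M F D A p (coord_vec M c x p) (coord_vec M c y p) u) v +
          herm F p u (nabla_u M F D A p (coord_vec M c x p) (coord_vec M c y p) v) = 0"
        using cov_end_skew[OF A UV s' t' c, of x y] cov_end_skew[OF A UV s' t' c, of y x]
        unfolding su[symmetric] tv[symmetric] nabla_u_coord[OF A UV s' c] nabla_u_coord[OF A UV t' c]
        using fib.h_diff[OF f[OF s', of y x] f[OF s', of x y] sections_fibre[OF t' UV(2)]]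
          herm_diff_right[OF sections_fibre[OF s' UV(2)] f[OF t', of y x] f[OF t', of x y]]
        by (simp only:) algebra
    qed (rule off)
  qed
  show "nabla_u M F D A p Y X v = - nabla_u M F D A p X Y v"
    if XT: "X \<in> tspace M p" and YT: "Y \<in> tspace M p" for p X Y v
  proof (cases "v \<in> fibre F p")
    case True
    then obtain U \<sigma> where U: "open U" "p \<in> U" and s: "\<sigma> \<in> sections M F U" and v: "\<sigma> p = v" by (rule section_through)
    obtain c where c: "c \<in> charts M" "p \<in> fst c" by (rule chart_cover)
    obtain x y where X: "X = coord_vec M c x p" and Y: "Y = coord_vec M c y p"
      using XT YT tspace_obtain[OF _ c] by metis
    show ?thesis unfolding X Y v[symmetric] nabla_u_coord[OF A U s c] by simp
  qed (simp add: off)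
  show "nabla_u M F D A p (X + Z) Y v = nabla_u M F D A p X Y v + nabla_u M F D A p Z Y v"
    if XT: "X \<in> tspace M p" and YT: "Y \<in> tspace M p" and ZT: "Z \<in> tspace M p" for p X Y Z v
  proof (cases "v \<in> fibre F p")
    case True
    then obtain U \<sigma> where U: "open U" "p \<in> U" and s: "\<sigma> \<in> sections M F U" and v: "\<sigma> p = v" by (rule section_through)
    obtain c where c: "c \<in> charts M" "p \<in> fst c" by (rule chart_cover)
    obtain x y z where X: "X = coord_vec M c x p" and Y: "Y = coord_vec M c y p" and Z: "Z = coord_vec M c z p"
      using XT YT ZT tspace_obtain[OF _ c] by metis
    show ?thesis
      unfolding X Y Z v[symmetric] coord_vec_add[OF c, symmetric] nabla_u_coord[OF A U s c] cov_end_add[OF A U s c]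
      by simp
  qed (simp add: off)
  show "nabla_u M F D A p (tscale r X) Y v = rscl F r (nabla_u M F D A p X Y v)"
    if XT: "X \<in> tspace M p" and YT: "Y \<in> tspace M p" for p X Y r v
  proof (cases "v \<in> fibre F p")
    case True
    then obtain U \<sigma> where U: "open U" "p \<in> U" and s: "\<sigma> \<in> sections M F U" and v: "\<sigma> p = v" by (rule section_through)
    obtain c where c: "c \<in> charts M" "p \<in> fst c" by (rule chart_cover)
    obtain x y where X: "X = coord_vec M c x p" and Y: "Y = coord_vec M c y p"
      using XT YT tspace_obtain[OF _ c] by metis
    show ?thesis
      unfolding X Y v[symmetric] coord_vec_scale[OF c, symmetric] nabla_u_coord[OF A U s c] cov_end_scale[OF A U s c]
      by (simp add: vs.scale_right_diff_distrib)
  qed (simp add: off)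
  show "nabla_u M F D A p X Y v = 0" if "X \<notin> tspace M p \<or> Y \<notin> tspace M p" for p X Y v
    using that by (intro nabla_u_off) blast
  fix c v w U \<sigma>
  assume c: "c \<in> charts M" and U: "open U" "U \<subseteq> fst c" and s: "\<sigma> \<in> sections M F U"
  have W: "U \<inter> fst c = U" using U by blast
  show "(\<lambda>p. nabla_u M F D A p (coord_vec M c v p) (coord_vec M c w p) (\<sigma> p)) \<in> sections M F U"
  proof (rule sections_cong[OF sections_diff[OF U(1)]])
    show "cov_end A c v w \<sigma> \<in> sections M F U" "cov_end A c w v \<sigma> \<in> sections M F U"
      using cov_end_in[OF A U(1) s c] unfolding W by auto
    fix q assume q: "q \<in> U"
    then have "q \<in> fst c" using U by blast
    from nabla_u_coord[OF A U(1) q s c this, of v w]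
    show "cov_end A c v w \<sigma> q - cov_end A c w v \<sigma> q = nabla_u M F D A q (coord_vec M c v q) (coord_vec M c w q) (\<sigma> q)"
      by (rule sym)
  qed
qed (rule coord_vec_in)

end

section \<open>The fibrewise products\<close>

text \<open>The integrands of the two products are named so that algebra and continuity can be
  treated fibrewise before integrating.\<close>

definition pair1 :: "('m::topological_space, 'n::finite) rmfd \<Rightarrow> ('m, 'v) hbundle \<Rightarrow>
    ('m, 'v) uform1 \<Rightarrow> ('m, 'v) uform1 \<Rightarrow> 'm \<Rightarrow> real" where
  "pair1 M F \<alpha> \<beta> p = (let b = SOME b. orthonormal_basis M p b in
     \<Sum>i\<in>UNIV. u_inner F p (\<alpha> p (b i)) (\<beta> p (b i)))"

definition pair2 :: "('m::topological_space, 'n::finite) rmfd \<Rightarrow> ('m, 'v) hbundle \<Rightarrow>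
    ('m, 'v) uform2 \<Rightarrow> ('m, 'v) uform2 \<Rightarrow> 'm \<Rightarrow> real" where
  "pair2 M F \<alpha> \<beta> p = (let b = SOME b. orthonormal_basis M p b in
     (1 / 2) * (\<Sum>i\<in>UNIV. \<Sum>j\<in>UNIV. u_inner F p (\<alpha> p (b i) (b j)) (\<beta> p (b i) (b j))))"

lemma inner_form1_eq: "inner_form1 M F \<alpha> \<beta> = vol_integral M (pair1 M F \<alpha> \<beta>)"
  unfolding inner_form1_def pair1_def ..

lemma inner_form2_eq: "inner_form2 M F \<alpha> \<beta> = vol_integral M (pair2 M F \<alpha> \<beta>)"
  unfolding inner_form2_def pair2_def ..

context hermitian_vb
begin

definition some_basis :: "'m \<Rightarrow> nat \<Rightarrow> 'v" where
  "some_basis p = (SOME u. unitary_basis F p u)"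

lemma some_basis: "unitary_basis F p (some_basis p)"
  unfolding some_basis_def by (rule someI_ex[OF unitary_basis_ex])

lemma u_inner_eq: "u_inner F p a b = Re (\<Sum>k<rank F. herm F p (a (some_basis p k)) (b (some_basis p k)))"
  unfolding u_inner_def some_basis_def Let_def ..

lemma some_basis_in: "k < rank F \<Longrightarrow> some_basis p k \<in> fibre F p"
  by (rule unitary_basis_in[OF some_basis])

lemma u_inner_cong:
  assumes "\<And>v. v \<in> fibre F p \<Longrightarrow> a v = a' v" "\<And>v. v \<in> fibre F p \<Longrightarrow> b v = b' v"
  shows "u_inner F p a b = u_inner F p a' b'"
  unfolding u_inner_eq using assms some_basis_in by simp

lemma u_inner_add:
  assumes "a \<in> u_fibre F p" "b \<in> u_fibre F p" "d \<in> u_fibre F p"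
  shows "u_inner F p (\<lambda>v. a v + b v) d = u_inner F p a d + u_inner F p b d"
  unfolding u_inner_eq using some_basis_in u_fibre_in[OF assms(1)] u_fibre_in[OF assms(2)] u_fibre_in[OF assms(3)]
  by (simp add: fib.h_add sum.distrib)

lemma u_inner_rscl:
  assumes "a \<in> u_fibre F p" "d \<in> u_fibre F p"
  shows "u_inner F p (\<lambda>v. rscl F r (a v)) d = r * u_inner F p a d"
  unfolding u_inner_eq using some_basis_in u_fibre_in[OF assms(1)] u_fibre_in[OF assms(2)]
  by (simp add: fib.h_scale sum_distrib_left)

lemma u_inner_sym:
  assumes "a \<in> u_fibre F p" "d \<in> u_fibre F p"
  shows "u_inner F p a d = u_inner F p d a"
proof -
  have "Re (herm F p (a (some_basis p k)) (d (some_basis p k))) = Re (herm F p (d (some_basis p k)) (a (some_basis p k)))"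
    if "k < rank F" for k
    using fib.h_cj[OF u_fibre_in[OF assms(1) some_basis_in[OF that]] u_fibre_in[OF assms(2) some_basis_in[OF that]]]
    by simp
  then show ?thesis unfolding u_inner_eq by simp
qed

lemma herm_self_nonneg: "v \<in> fibre F p \<Longrightarrow> Re (herm F p v v) \<ge> 0"
  using herm_pos fib.h_zero[OF fib.S_zero, of p] by (cases "v = 0") (auto intro: less_imp_le)

lemma u_inner_nonneg:
  assumes "a \<in> u_fibre F p"
  shows "u_inner F p a a \<ge> 0"
  unfolding u_inner_eq Re_sum
  by (intro sum_nonneg herm_self_nonneg u_fibre_in[OF assms] some_basis_in) simp

lemma u_inner_zero_imp:
  assumes a: "a \<in> u_fibre F p" and z: "u_inner F p a a = 0"
  shows "a = 0"
proof
  fix v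
  have "\<forall>k\<in>{..<rank F}. Re (herm F p (a (some_basis p k)) (a (some_basis p k))) = 0"
    using z unfolding u_inner_eq Re_sum
    by (subst (asm) sum_nonneg_eq_0_iff) (auto intro!: herm_self_nonneg u_fibre_in[OF a] some_basis_in)
  then have z: "a (some_basis p k) = 0" if "k < rank F" for k
    using herm_pos u_fibre_in[OF a some_basis_in[OF that]] that by (metis lessThan_iff less_irrefl)
  show "a v = 0 v"
  proof (cases "v \<in> fibre F p")
    case True
    have "a v = a (\<Sum>k<rank F. scl F (herm F p v (some_basis p k)) (some_basis p k))"
      using unitary_basis_expand[OF some_basis True] by simp
    also have "\<dots> = (\<Sum>k<rank F. scl F (herm F p v (some_basis p k)) (a (some_basis p k)))"
      by (rule u_fibre_lincomb[OF a]) (simp add: some_basis_in)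
    finally show ?thesis using z by simp
  qed (simp add: u_fibre_off[OF a])
qed

lemma u_inner_zero_left: "u_inner F p 0 d = 0" if "d \<in> u_fibre F p"
  unfolding u_inner_eq using u_fibre_in[OF that some_basis_in] by (simp add: fib.h_zero)

lemma u_inner_sum_left:
  assumes "finite I" "\<And>i. i \<in> I \<Longrightarrow> f i \<in> u_fibre F p" "d \<in> u_fibre F p"
  shows "u_inner F p (\<lambda>v. \<Sum>i\<in>I. f i v) d = (\<Sum>i\<in>I. u_inner F p (f i) d)"
proof -
  have "herm F p (\<Sum>i\<in>I. f i v) (d v) = (\<Sum>i\<in>I. herm F p (f i v) (d v))" if "v \<in> fibre F p" for v
    by (rule fib.h_sum[OF u_fibre_in[OF assms(3) that] u_fibre_in[OF assms(2) that]])
  then have "u_inner F p (\<lambda>v. \<Sum>i\<in>I. f i v) d =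
      Re (\<Sum>k<rank F. \<Sum>i\<in>I. herm F p (f i (some_basis p k)) (d (some_basis p k)))"
    unfolding u_inner_eq using some_basis_in by simp
  also have "\<dots> = (\<Sum>i\<in>I. u_inner F p (f i) d)"
    unfolding u_inner_eq by (subst sum.swap) simp
  finally show ?thesis .
qed

text \<open>The matrix of \<open>c\<close> in the unitary basis is antihermitian, so the terms in which \<open>c\<close> acts first cancel.\<close>

lemma u_inner_bracket:
  assumes a: "a \<in> u_fibre F p" and b: "b \<in> u_fibre F p" and c: "c \<in> u_fibre F p"
  shows "u_inner F p (\<lambda>v. c (a v) - a (c v)) b = - u_inner F p a (\<lambda>v. c (b v) - b (c v))"
proof -
  let ?u = "some_basis p" and ?h = "herm F p"
  let ?I = "{..<rank F}"
  have u: "?u k \<in> fibre F p" if "k \<in> ?I" for k using that some_basis_in by simp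
  note af = u_fibre_in[OF a] and bf = u_fibre_in[OF b] and cf = u_fibre_in[OF c]
  define C where "C k l = ?h (c (?u k)) (?u l)" for k l
  have cu: "c (?u k) = (\<Sum>l\<in>?I. scl F (C k l) (?u l))" if "k \<in> ?I" for k
    unfolding C_def by (rule unitary_basis_expand[OF some_basis cf[OF u[OF that]]])
  have Cs: "cnj (C k l) = - C l k" if "k \<in> ?I" "l \<in> ?I" for k l
    using fib.h_cj[OF cf[OF u[OF that(1)]] u[OF that(2)]] u_fibre_skew[OF c u[OF that(2)] u[OF that(1)]]
    unfolding C_def by (metis add_eq_0_iff add.commute minus_minus)
  have 1: "?h (a (c (?u k))) (b (?u k)) = (\<Sum>l\<in>?I. C k l * ?h (a (?u l)) (b (?u k)))" if k: "k \<in> ?I" for k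
  proof -
    have "a (c (?u k)) = (\<Sum>l\<in>?I. scl F (C k l) (a (?u l)))"
      unfolding cu[OF k] by (rule u_fibre_lincomb[OF a u])
    then show ?thesis using fib.h_lincomb[OF bf[OF u[OF k]] af[OF u], where I = ?I] by simp
  qed
  \<comment> \<open>The second slot is conjugate linear, so the coefficient appears as
    \<open>cnj (C k l)\<close>, which \<open>Cs\<close> turns into \<open>- C l k\<close>; this
    transposition makes the double sum match that of \<open>1\<close>.\<close>
  have 2: "?h (a (?u k)) (b (c (?u k))) = (\<Sum>l\<in>?I. - C l k * ?h (a (?u k)) (b (?u l)))" if k: "k \<in> ?I" for k
  proof -
    have "b (c (?u k)) = (\<Sum>l\<in>?I. scl F (C k l) (b (?u l)))"
      unfolding cu[OF k] by (rule u_fibre_lincomb[OF b u])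
    then have "?h (b (c (?u k))) (a (?u k)) = (\<Sum>l\<in>?I. C k l * ?h (b (?u l)) (a (?u k)))"
      using fib.h_lincomb[OF af[OF u[OF k]] bf[OF u], where I = ?I] by simp
    then have "?h (a (?u k)) (b (c (?u k))) = (\<Sum>l\<in>?I. cnj (C k l) * cnj (?h (b (?u l)) (a (?u k))))"
      using fib.h_cj[OF bf[OF cf[OF u[OF k]]] af[OF u[OF k]]] by simp
    also have "\<dots> = (\<Sum>l\<in>?I. - C l k * ?h (a (?u k)) (b (?u l)))"
      using Cs[OF k] fib.h_cj[OF bf[OF u] af[OF u[OF k]]] by (intro sum.cong) auto
    finally show ?thesis .
  qed
  have "(\<Sum>k\<in>?I. ?h (a (c (?u k))) (b (?u k))) + (\<Sum>k\<in>?I. ?h (a (?u k)) (b (c (?u k)))) =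
      (\<Sum>k\<in>?I. \<Sum>l\<in>?I. C k l * ?h (a (?u l)) (b (?u k))) - (\<Sum>k\<in>?I. \<Sum>l\<in>?I. C l k * ?h (a (?u k)) (b (?u l)))"
    using 1 2 by (simp add: sum_negf)
  also have "(\<Sum>k\<in>?I. \<Sum>l\<in>?I. C l k * ?h (a (?u k)) (b (?u l))) = (\<Sum>l\<in>?I. \<Sum>k\<in>?I. C l k * ?h (a (?u k)) (b (?u l)))"
    by (rule sum.swap)
  finally have 3: "(\<Sum>k\<in>?I. ?h (a (c (?u k))) (b (?u k))) + (\<Sum>k\<in>?I. ?h (a (?u k)) (b (c (?u k)))) = 0"
    by simp
  \<comment> \<open>The terms in which \<open>c\<close> acts last cancel for each \<open>k\<close>
    separately, directly by the skewness of \<open>c\<close>.\<close>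
  have 4: "?h (c (a (?u k)) - a (c (?u k))) (b (?u k)) + ?h (a (?u k)) (c (b (?u k)) - b (c (?u k))) =
      - (?h (a (c (?u k))) (b (?u k)) + ?h (a (?u k)) (b (c (?u k))))" if k: "k \<in> ?I" for k
    using u_fibre_skew[OF c af[OF u[OF k]] bf[OF u[OF k]]]
      fib.h_diff[OF cf[OF af[OF u[OF k]]] af[OF cf[OF u[OF k]]] bf[OF u[OF k]]]
      herm_diff_right[OF af[OF u[OF k]] cf[OF bf[OF u[OF k]]] bf[OF cf[OF u[OF k]]]]
    by simp
  have "(\<Sum>k\<in>?I. ?h (c (a (?u k)) - a (c (?u k))) (b (?u k))) + (\<Sum>k\<in>?I. ?h (a (?u k)) (c (b (?u k)) - b (c (?u k)))) = 0"
  proof -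
    have "(\<Sum>k\<in>?I. ?h (c (a (?u k)) - a (c (?u k))) (b (?u k)) + ?h (a (?u k)) (c (b (?u k)) - b (c (?u k)))) =
        (\<Sum>k\<in>?I. - (?h (a (c (?u k))) (b (?u k)) + ?h (a (?u k)) (b (c (?u k)))))"
      by (rule sum.cong[OF refl 4])
    then show ?thesis using 3 unfolding sum_negf sum.distrib by simp
  qed
  from arg_cong[where f = Re, OF this] show ?thesis
    unfolding u_inner_eq plus_complex.sel zero_complex.sel by linarith
qed

text \<open>For antihermitian endomorphisms the product is minus the trace of the composite, and a
  trace may be computed in the smooth local frame although the unitary basis is chosen pointwise
  without any regularity.\<close>

lemma u_inner_smooth:
  assumes s: "s \<in> u_sections M F U" and s': "s' \<in> u_sections M F U" and U: "open U" and t: "t \<in> frames F"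
  shows "smooth_fun M (U \<inter> fst t) (\<lambda>p. u_inner F p (s p) (s' p))"
proof -
  let ?W = "U \<inter> fst t" and ?r = "rank F" and ?e = "\<lambda>p k. snd t k p"
  have W: "open ?W" "?W \<subseteq> U" using U frame(1)[OF t] by auto
  \<comment> \<open>The composite maps frame sections to sections, so its matrix \<open>m\<close> in
    the frame has smooth entries.\<close>
  have "\<forall>k. \<exists>c. k < ?r \<longrightarrow> (\<forall>l<?r. smooth_fun M ?W (c l :: 'm \<Rightarrow> complex)) \<and>
      (\<forall>p\<in>?W. s' p (s p (?e p k)) = (\<Sum>l<?r. scl F (c l p) (?e p l)))"
  proof
    fix k
    show "\<exists>c. k < ?r \<longrightarrow> (\<forall>l<?r. smooth_fun M ?W (c l :: 'm \<Rightarrow> complex)) \<and>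
      (\<forall>p\<in>?W. s' p (s p (?e p k)) = (\<Sum>l<?r. scl F (c l p) (?e p l)))"
    proof (cases "k < ?r")
      case True
      have "snd t k \<in> sections M F ?W"
        by (rule sections_subset[OF frame(2)[OF t True]]) blast
      then have "(\<lambda>p. s' p (s p (?e p k))) \<in> sections M F ?W"
        by (intro u_sections_apply[OF s' W] u_sections_apply[OF s W])
      from sections_coeff[OF this t] show ?thesis by (simp add: Int_assoc)
    qed simp
  qed
  from choice[OF this] obtain m where m0: "\<forall>k. k < ?r \<longrightarrow> (\<forall>l<?r. smooth_fun M ?W (m k l :: 'm \<Rightarrow> complex)) \<and>
      (\<forall>p\<in>?W. s' p (s p (?e p k)) = (\<Sum>l<?r. scl F (m k l p) (?e p l)))" by (elim exE)
  have "smooth_fun M ?W (\<lambda>p. - Re (\<Sum>k<?r. m k k p))"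
    by (intro smooth_fun_minus smooth_fun_Re smooth_fun_sum W(1)) (use m0 in auto)
  then show ?thesis
  proof (rule smooth_fun_cong[OF _ W(1)])
    fix p assume p: "p \<in> ?W"
    then have pt: "p \<in> fst t" and pU: "p \<in> U" by auto
    note a = u_sections_fibre[OF s pU] and b = u_sections_fibre[OF s' pU]
    let ?u = "some_basis p"
    have "\<forall>l. \<exists>c. l < ?r \<longrightarrow> ?u l = (\<Sum>k<?r. scl F (c k) (?e p k))"
      using frame_expand[OF t pt some_basis_in] by metis
    from choice[OF this] obtain B where B: "\<forall>l. l < ?r \<longrightarrow> ?u l = (\<Sum>k<?r. scl F (B l k) (?e p k))" by (elim exE)
    have "(\<Sum>k<?r. herm F p (s' p (s p (?u k))) (?u k)) = (\<Sum>k<?r. m k k p)"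
    proof (rule fib.trace_eq[where f = "\<lambda>v. s' p (s p v)" and u = ?u and m = "\<lambda>k l. m k l p" and B = B, OF finite_lessThan _ frame_free[OF t pt]])
      show "fib.orthonormal p {..<?r} ?u" using some_basis unfolding unitary_basis_iff .
      show "v = (\<Sum>i<?r. scl F (herm F p v (?u i)) (?u i))" if "v \<in> fibre F p" for v
        by (rule unitary_basis_expand[OF some_basis that])
    qed (use B m0 p frame_fibre[OF t pt] in \<open>simp_all add: u_fibre_add[OF a] u_fibre_add[OF b] u_fibre_scl[OF a] u_fibre_scl[OF b] u_fibre_in[OF a]\<close>)
    moreover
    \<comment> \<open>Moving \<open>s'\<close> to the other argument costs a sign and turns the
      product into the trace of the composite.\<close>
    have S2: "herm F p (s p (?u k)) (s' p (?u k)) = - herm F p (s' p (s p (?u k))) (?u k)" if "k < ?r" for k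
      using u_fibre_skew[OF b u_fibre_in[OF a some_basis_in[OF that]] some_basis_in[OF that]]
      by (metis add_eq_0_iff add.commute)
    have "(\<Sum>k<?r. herm F p (s p (?u k)) (s' p (?u k))) = - (\<Sum>k<?r. herm F p (s' p (s p (?u k))) (?u k))"
      unfolding sum_negf[symmetric] by (intro sum.cong refl S2) simp
    ultimately show "- Re (\<Sum>k<?r. m k k p) = u_inner F p (s p) (s' p)"
      unfolding u_inner_eq by (simp only: uminus_complex.sel)
  qed
qed

section \<open>Continuity and algebra of the pairings of forms\<close>

definition some_frame :: "'m \<Rightarrow> 'n \<Rightarrow> 'm tvec" where
  "some_frame p = (SOME b. orthonormal_basis M p b)"

lemma some_frame: "orthonormal_basis M p (some_frame p)"
  unfolding some_frame_def by (rule someI_ex[OF orthonormal_basis_ex])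

lemmas some_frame_in = orthonormal_basis_in[OF some_frame]

lemma pair1_eq: "pair1 M F \<alpha> \<beta> p = (\<Sum>i\<in>UNIV. u_inner F p (\<alpha> p (some_frame p i)) (\<beta> p (some_frame p i)))"
  unfolding pair1_def some_frame_def Let_def ..

lemma pair2_eq: "pair2 M F \<alpha> \<beta> p = (1 / 2) * (\<Sum>i\<in>UNIV. \<Sum>j\<in>UNIV.
    u_inner F p (\<alpha> p (some_frame p i) (some_frame p j)) (\<beta> p (some_frame p i) (some_frame p j)))"
  unfolding pair2_def some_frame_def Let_def ..

lemma module_real: "module ((*) :: real \<Rightarrow> real \<Rightarrow> real)"
  by unfold_locales (simp_all add: algebra_simps)

lemma u_inner_add_right:
  assumes "a \<in> u_fibre F p" "b \<in> u_fibre F p" "d \<in> u_fibre F p"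
  shows "u_inner F p d (\<lambda>v. a v + b v) = u_inner F p d a + u_inner F p d b"
  using u_inner_add[OF assms] u_inner_sym[OF assms(3)] assms(1,2) u_fibre_plus[OF assms(1,2)]
  by (simp add: plus_fun_def)

lemma u_inner_rscl_right:
  assumes "a \<in> u_fibre F p" "d \<in> u_fibre F p"
  shows "u_inner F p d (\<lambda>v. rscl F r (a v)) = r * u_inner F p d a"
  using u_inner_rscl[OF assms, of r] u_inner_sym[OF assms(2)] assms(1) u_fibre_rscl[OF assms(1)]
  by simp

text \<open>The Gram matrix is smooth over a chart and the trace over a bundle frame, so smoothness
  is available exactly on their overlaps; these cover the manifold and continuity is local.\<close>

lemma continuous_on_UNIV_cover:
  fixes f :: "'m \<Rightarrow> real"
  assumes "\<And>c t. c \<in> charts M \<Longrightarrow> t \<in> frames F \<Longrightarrow> smooth_fun M (fst c \<inter> fst t) f"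
  shows "continuous_on UNIV f"
proof -
  let ?\<C> = "charts M \<times> frames F"
  have o: "open (fst (fst x) \<inter> fst (snd x))" if "x \<in> ?\<C>" for x
    using that chart_open frame(1) by auto
  have "continuous_on (\<Union>x\<in>?\<C>. fst (fst x) \<inter> fst (snd x)) f"
  proof (rule continuous_on_open_UN)
    fix x assume x: "x \<in> ?\<C>"
    show "open (fst (fst x) \<inter> fst (snd x))" by (rule o[OF x])
    show "continuous_on (fst (fst x) \<inter> fst (snd x)) f"
      by (rule smooth_fun_imp_continuous_on[OF o[OF x]], rule assms) (use x in auto)
  qed
  moreover have "(\<Union>x\<in>?\<C>. fst (fst x) \<inter> fst (snd x)) = UNIV"
  proof (intro set_eqI iffI UNIV_I)
    fix p
    obtain c t where "c \<in> charts M" "p \<in> fst c" "t \<in> frames F" "p \<in> fst t"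
      by (metis chart_cover frame_cover)
    then show "p \<in> (\<Union>x\<in>?\<C>. fst (fst x) \<inter> fst (snd x))"
      by (intro UN_I[of "(c, t)"]) auto
  qed
  ultimately show ?thesis by simp
qed

lemma pair1_continuous:
  assumes A: "\<alpha> \<in> u_forms1 M F" and B: "\<beta> \<in> u_forms1 M F"
  shows "continuous_on UNIV (pair1 M F \<alpha> \<beta>)"
proof (rule continuous_on_UNIV_cover)
  fix c t assume c: "c \<in> charts M" and t: "t \<in> frames F"
  let ?W = "fst c \<inter> fst t"
  have W: "open ?W" using chart_open[OF c] frame(1)[OF t] by blast
  let ?e = "\<lambda>i. coord_vec M c (axis i 1)"
  have "smooth_fun M ?W (\<lambda>p. \<Sum>i\<in>UNIV. \<Sum>j\<in>UNIV. inv_gram M c p $ i $ j * u_inner F p (\<alpha> p (?e i p)) (\<beta> p (?e j p)))"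
    by (intro smooth_fun_sum smooth_fun_mult W smooth_fun_subset[OF inv_gram_smooth[OF c]]
        u_inner_smooth[OF u_forms1_coord[OF A c] u_forms1_coord[OF B c] chart_open[OF c] t]) blast
  then show "smooth_fun M ?W (pair1 M F \<alpha> \<beta>)"
  proof (rule smooth_fun_cong[OF _ W])
    fix p assume "p \<in> ?W"
    then have p: "p \<in> fst c" by blast
    show "(\<Sum>i\<in>UNIV. \<Sum>j\<in>UNIV. inv_gram M c p $ i $ j * u_inner F p (\<alpha> p (?e i p)) (\<beta> p (?e j p))) = pair1 M F \<alpha> \<beta> p"
      unfolding pair1_eq
    proof (rule contraction_eq[OF module_real c p some_frame,
          where \<beta> = "\<lambda>X Y. u_inner F p (\<alpha> p X) (\<beta> p Y)", symmetric])
      fix X Y Z assume X: "X \<in> tspace M p" and Y: "Y \<in> tspace M p" and Z: "Z \<in> tspace M p"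
      show "u_inner F p (\<alpha> p (X + Y)) (\<beta> p Z) = u_inner F p (\<alpha> p X) (\<beta> p Z) + u_inner F p (\<alpha> p Y) (\<beta> p Z)"
        unfolding u_forms1_add[OF A X Y]
        using u_inner_add[OF u_forms1_fibre[OF A X] u_forms1_fibre[OF A Y] u_forms1_fibre[OF B Z]]
        by (simp add: plus_fun_def)
      show "u_inner F p (\<alpha> p Z) (\<beta> p (X + Y)) = u_inner F p (\<alpha> p Z) (\<beta> p X) + u_inner F p (\<alpha> p Z) (\<beta> p Y)"
        unfolding u_forms1_add[OF B X Y]
        using u_inner_add_right[OF u_forms1_fibre[OF B X] u_forms1_fibre[OF B Y] u_forms1_fibre[OF A Z]]
        by (simp add: plus_fun_def)
    next
      fix X Z r assume X: "X \<in> tspace M p" and Z: "Z \<in> tspace M p"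
      show "u_inner F p (\<alpha> p (tscale r X)) (\<beta> p Z) = r * u_inner F p (\<alpha> p X) (\<beta> p Z)"
        using u_inner_rscl[OF u_forms1_fibre[OF A X] u_forms1_fibre[OF B Z], of r]
        by (simp add: u_forms1_scale[OF A X, abs_def] ext[OF u_forms1_scale[OF A X]])
      show "u_inner F p (\<alpha> p Z) (\<beta> p (tscale r X)) = r * u_inner F p (\<alpha> p Z) (\<beta> p X)"
        using u_inner_rscl_right[OF u_forms1_fibre[OF B X] u_forms1_fibre[OF A Z], of r]
        by (simp add: ext[OF u_forms1_scale[OF B X]])
    qed
  qed
qed

lemma u_forms2_add_fun:
  assumes A: "\<omega> \<in> u_forms2 M F" and "X \<in> tspace M p" "Y \<in> tspace M p" "Z \<in> tspace M p"
  shows "\<omega> p (X + Y) Z = (\<lambda>v. \<omega> p X Z v + \<omega> p Y Z v)" "\<omega> p Z (X + Y) = (\<lambda>v. \<omega> p Z X v + \<omega> p Z Y v)"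
  using u_forms2_add[OF A assms(2,4,3)] u_forms2_add_right[OF A assms(4,2,3)] by (auto simp: fun_eq_iff)

lemma u_forms2_scale_fun:
  assumes A: "\<omega> \<in> u_forms2 M F" and "X \<in> tspace M p" "Z \<in> tspace M p"
  shows "\<omega> p (tscale r X) Z = (\<lambda>v. rscl F r (\<omega> p X Z v))" "\<omega> p Z (tscale r X) = (\<lambda>v. rscl F r (\<omega> p Z X v))"
  using u_forms2_scale[OF A assms(2,3)] u_forms2_scale_right[OF A assms(3,2)] by (auto simp: fun_eq_iff)

lemma pair2_continuous:
  assumes A: "\<alpha> \<in> u_forms2 M F" and B: "\<beta> \<in> u_forms2 M F"
  shows "continuous_on UNIV (pair2 M F \<alpha> \<beta>)"
proof (rule continuous_on_UNIV_cover)
  fix c t assume c: "c \<in> charts M" and t: "t \<in> frames F"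
  let ?W = "fst c \<inter> fst t"
  have W: "open ?W" using chart_open[OF c] frame(1)[OF t] by blast
  let ?e = "\<lambda>i. coord_vec M c (axis i 1)"
  let ?s = "\<lambda>p. (1 / 2) * (\<Sum>i\<in>UNIV. \<Sum>j\<in>UNIV. inv_gram M c p $ i $ j * (\<Sum>k\<in>UNIV. \<Sum>l\<in>UNIV. inv_gram M c p $ k $ l *
      u_inner F p (\<alpha> p (?e i p) (?e k p)) (\<beta> p (?e j p) (?e l p))))"
  have "smooth_fun M ?W ?s"
    by (intro smooth_fun_sum smooth_fun_mult smooth_fun_const W smooth_fun_subset[OF inv_gram_smooth[OF c]]
        u_inner_smooth[OF u_forms2_coord[OF A c] u_forms2_coord[OF B c] chart_open[OF c] t]) blast+
  then show "smooth_fun M ?W (pair2 M F \<alpha> \<beta>)"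
  proof (rule smooth_fun_cong[OF _ W])
    fix p assume "p \<in> ?W"
    then have p: "p \<in> fst c" by blast
    note Af = u_forms2_fibre[OF A] and Bf = u_forms2_fibre[OF B]
    let ?b = "some_frame p"
    \<comment> \<open>The first arguments \<open>X\<close> and \<open>X'\<close> are kept distinct
      because the outer contraction needs an expression bilinear in the two.\<close>
    have inner: "(\<Sum>j\<in>UNIV. u_inner F p (\<alpha> p X (?b j)) (\<beta> p X' (?b j))) =
      (\<Sum>k\<in>UNIV. \<Sum>l\<in>UNIV. inv_gram M c p $ k $ l * u_inner F p (\<alpha> p X (?e k p)) (\<beta> p X' (?e l p)))"
      if X: "X \<in> tspace M p" and X': "X' \<in> tspace M p" for X X'
      by (rule contraction_eq[OF module_real c p some_frame, where \<beta> = "\<lambda>Y Y'. u_inner F p (\<alpha> p X Y) (\<beta> p X' Y')"])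
        (simp_all only: u_forms2_add_fun[OF A _ _ X] u_forms2_add_fun[OF B _ _ X'] u_forms2_scale_fun[OF A _ X]
          u_forms2_scale_fun[OF B _ X'] u_inner_add[OF Af[OF X] Af[OF X] Bf[OF X']]
          u_inner_add_right[OF Bf[OF X'] Bf[OF X'] Af[OF X]] u_inner_rscl[OF Af[OF X] Bf[OF X']]
          u_inner_rscl_right[OF Bf[OF X'] Af[OF X]])
    have "(\<Sum>i\<in>UNIV. \<Sum>j\<in>UNIV. u_inner F p (\<alpha> p (?b i) (?b j)) (\<beta> p (?b i) (?b j))) =
      (\<Sum>i\<in>UNIV. \<Sum>j\<in>UNIV. inv_gram M c p $ i $ j *
        (\<Sum>k\<in>UNIV. u_inner F p (\<alpha> p (?e i p) (?b k)) (\<beta> p (?e j p) (?b k))))"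
      by (rule contraction_eq[OF module_real c p some_frame, where \<beta> = "\<lambda>X X'. \<Sum>j\<in>UNIV. u_inner F p (\<alpha> p X (?b j)) (\<beta> p X' (?b j))"])
        (simp_all only: u_forms2_add_fun[OF A _ _ some_frame_in] u_forms2_add_fun[OF B _ _ some_frame_in]
          u_forms2_scale_fun[OF A _ some_frame_in] u_forms2_scale_fun[OF B _ some_frame_in]
          u_inner_add[OF Af[OF _ some_frame_in] Af[OF _ some_frame_in] Bf[OF _ some_frame_in]]
          u_inner_add_right[OF Bf[OF _ some_frame_in] Bf[OF _ some_frame_in] Af[OF _ some_frame_in]]
          u_inner_rscl[OF Af[OF _ some_frame_in] Bf[OF _ some_frame_in]]
          u_inner_rscl_right[OF Bf[OF _ some_frame_in] Af[OF _ some_frame_in]] sum.distrib sum_distrib_left)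
    then show "?s p = pair2 M F \<alpha> \<beta> p"
      unfolding pair2_eq by (simp add: inner coord_vec_in[OF c p])
  qed
qed

lemma pair2_add:
  assumes "\<alpha> \<in> u_forms2 M F" "\<beta> \<in> u_forms2 M F" "\<gamma> \<in> u_forms2 M F"
  shows "pair2 M F (\<alpha> + \<beta>) \<gamma> p = pair2 M F \<alpha> \<gamma> p + pair2 M F \<beta> \<gamma> p"
proof -
  note T = some_frame_in some_frame_in
  have "u_inner F p ((\<alpha> + \<beta>) p (some_frame p i) (some_frame p j)) (\<gamma> p (some_frame p i) (some_frame p j)) =
      u_inner F p (\<alpha> p (some_frame p i) (some_frame p j)) (\<gamma> p (some_frame p i) (some_frame p j)) +
      u_inner F p (\<beta> p (some_frame p i) (some_frame p j)) (\<gamma> p (some_frame p i) (some_frame p j))" for i j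
    using u_inner_add[OF u_forms2_fibre[OF assms(1) T] u_forms2_fibre[OF assms(2) T] u_forms2_fibre[OF assms(3) T]]
    by (simp add: plus_fun_def)
  then show ?thesis unfolding pair2_eq by (simp only: sum.distrib distrib_left)
qed

lemma pair2_scale:
  assumes "\<alpha> \<in> u_forms2 M F" "\<gamma> \<in> u_forms2 M F"
  shows "pair2 M F (scale_form2 F r \<alpha>) \<gamma> p = r * pair2 M F \<alpha> \<gamma> p"
  unfolding pair2_eq scale_form2_def
  using u_inner_rscl[OF u_forms2_fibre[OF assms(1) some_frame_in some_frame_in] u_forms2_fibre[OF assms(2) some_frame_in some_frame_in]]
  by (simp add: sum_distrib_left)

lemma pair2_sym:
  assumes "\<alpha> \<in> u_forms2 M F" "\<gamma> \<in> u_forms2 M F"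
  shows "pair2 M F \<alpha> \<gamma> p = pair2 M F \<gamma> \<alpha> p"
  unfolding pair2_eq
  using u_inner_sym[OF u_forms2_fibre[OF assms(1) some_frame_in some_frame_in] u_forms2_fibre[OF assms(2) some_frame_in some_frame_in]]
  by simp

lemma pair1_add_right:
  assumes "\<alpha> \<in> u_forms1 M F" "\<beta> \<in> u_forms1 M F" "\<gamma> \<in> u_forms1 M F"
  shows "pair1 M F \<gamma> (\<alpha> + \<beta>) p = pair1 M F \<gamma> \<alpha> p + pair1 M F \<gamma> \<beta> p"
proof -
  have "u_inner F p (\<gamma> p (some_frame p i)) ((\<alpha> + \<beta>) p (some_frame p i)) =
      u_inner F p (\<gamma> p (some_frame p i)) (\<alpha> p (some_frame p i)) +
      u_inner F p (\<gamma> p (some_frame p i)) (\<beta> p (some_frame p i))" for i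
    using u_inner_add_right[OF u_forms1_fibre[OF assms(1) some_frame_in] u_forms1_fibre[OF assms(2) some_frame_in]
        u_forms1_fibre[OF assms(3) some_frame_in]]
    by (simp add: plus_fun_def)
  then show ?thesis unfolding pair1_eq by (simp only: sum.distrib)
qed

text \<open>A vanishing sum of nonnegative terms forces the form to vanish on a basis, hence on all
  tangent vectors by linearity; elsewhere forms are zero by convention.\<close>

lemma pair1_self:
  assumes A: "\<alpha> \<in> u_forms1 M F"
  shows "pair1 M F \<alpha> \<alpha> p \<ge> 0" and "pair1 M F \<alpha> \<alpha> p = 0 \<Longrightarrow> \<alpha> p = 0"
proof -
  note nn = u_inner_nonneg[OF u_forms1_fibre[OF A some_frame_in]]
  show "pair1 M F \<alpha> \<alpha> p \<ge> 0"
    unfolding pair1_eq by (intro sum_nonneg nn)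
  assume "pair1 M F \<alpha> \<alpha> p = 0"
  then have "\<forall>i\<in>UNIV. u_inner F p (\<alpha> p (some_frame p i)) (\<alpha> p (some_frame p i)) = 0"
    unfolding pair1_eq by (subst (asm) sum_nonneg_eq_0_iff) (auto intro: nn)
  then have z: "\<alpha> p (some_frame p i) = 0" for i
    using u_inner_zero_imp[OF u_forms1_fibre[OF A some_frame_in]] by blast
  show "\<alpha> p = 0"
  proof (intro ext)
    fix X v
    show "\<alpha> p X v = 0 X v"
    proof (cases "X \<in> tspace M p")
      case True
      have "\<alpha> p X v = \<alpha> p (\<Sum>i\<in>UNIV. tscale (metric M p X (some_frame p i)) (some_frame p i)) v"
        using orthonormal_basis_expand[OF some_frame True] by simp
      also have "\<dots> = 0"
        by (simp add: u_forms1_apply_sum[OF A finite some_frame_in] z)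
      finally show ?thesis by simp
    qed (simp add: u_forms1_zero[OF A])
  qed
qed

text \<open>The bracket has two halves that contribute equally, which absorbs the factor
  \<open>1 / 2\<close> of \<open>pair2\<close>. Invariance of the fibre metric then frees
  \<open>B\<close> in each term, and summing over the first index yields
  \<open>dagger\<close>.\<close>

lemma pair_bracket_dagger:
  assumes A: "A \<in> u_forms1 M F" and B: "B \<in> u_forms1 M F" and \<omega>: "\<omega> \<in> u_forms2 M F"
  shows "pair2 M F (wedge_bracket M F A B) \<omega> p = pair1 M F B (dagger M F A \<omega>) p"
proof -
  let ?b = "some_frame p"
  let ?c = "\<lambda>i j v. A p (?b i) (B p (?b j) v) - B p (?b j) (A p (?b i) v)"
  let ?w = "\<lambda>i j. \<omega> p (?b i) (?b j)"
  let ?d = "\<lambda>i j v. ?w i j (A p (?b i) v) - A p (?b i) (?w i j v)"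
  note Af = u_forms1_fibre[OF A some_frame_in] and Bf = u_forms1_fibre[OF B some_frame_in]
    and wf = u_forms2_fibre[OF \<omega> some_frame_in some_frame_in]
  have cf: "?c i j \<in> u_fibre F p" for i j by (rule u_fibre_commutator[OF Af Bf])
  have df: "?d i j \<in> u_fibre F p" for i j by (rule u_fibre_commutator[OF wf Af])
  have 1: "u_inner F p (wedge_bracket M F A B p (?b i) (?b j)) (?w i j) = u_inner F p (?c i j) (?w i j) + u_inner F p (?c j i) (?w j i)" for i j
  proof -
    have m: "rscl F (-1) x = - x" for x by simp
    have "u_inner F p (wedge_bracket M F A B p (?b i) (?b j)) (?w i j) =
      u_inner F p (\<lambda>v. ?c i j v + rscl F (-1) (?c j i v)) (?w i j)"
      by (rule u_inner_cong) (simp_all add: wedge_bracket_eq some_frame_in m)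
    also have "\<dots> = u_inner F p (?c i j) (?w i j) + u_inner F p (\<lambda>v. rscl F (-1) (?c j i v)) (?w i j)"
      by (rule u_inner_add[OF cf u_fibre_rscl[OF cf] wf])
    also have "u_inner F p (\<lambda>v. rscl F (-1) (?c j i v)) (?w i j) = -1 * u_inner F p (?c j i) (?w i j)"
      by (rule u_inner_rscl[OF cf wf])
    \<comment> \<open>Skewness of \<omega> supplies a second minus sign, which cancels the one in
      front of the exchanged half of the bracket.\<close>
    also have "u_inner F p (?c j i) (?w i j) = u_inner F p (?c j i) (\<lambda>v. rscl F (-1) (?w j i v))"
      by (rule u_inner_cong) (simp_all add: u_forms2_skew[OF \<omega> some_frame_in some_frame_in, of p j i] m)
    also have "\<dots> = -1 * u_inner F p (?c j i) (?w j i)"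
      by (rule u_inner_rscl_right[OF wf cf])
    finally show ?thesis by simp
  qed
  \<comment> \<open>Renaming the indices identifies the two halves; their sum is twice either
    one.\<close>
  have "(\<Sum>i\<in>UNIV. \<Sum>j\<in>UNIV. u_inner F p (?c j i) (?w j i)) = (\<Sum>i\<in>UNIV. \<Sum>j\<in>UNIV. u_inner F p (?c i j) (?w i j))"
    by (rule sum.swap)
  then have "pair2 M F (wedge_bracket M F A B) \<omega> p = (\<Sum>i\<in>UNIV. \<Sum>j\<in>UNIV. u_inner F p (?c i j) (?w i j))"
    unfolding pair2_eq 1 sum.distrib by simp
  also have "\<dots> = (\<Sum>i\<in>UNIV. \<Sum>j\<in>UNIV. u_inner F p (?d i j) (B p (?b j)))"
  proof (intro sum.cong refl)
    fix i j
    have m: "rscl F (-1) x = - x" for x by simp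
    \<comment> \<open>Invariance with \<open>A\<close> as the acting element replaces the bracket of
      \<open>A\<close> and \<open>B\<close> by minus the bracket of \<open>A\<close> and \<omega>;
      absorbing the sign gives the order of factors used in \<open>dagger\<close>.\<close>
    have "u_inner F p (?c i j) (?w i j) = - u_inner F p (B p (?b j)) (\<lambda>v. A p (?b i) (?w i j v) - ?w i j (A p (?b i) v))"
      by (rule u_inner_bracket[OF Bf wf Af])
    also have "\<dots> = - u_inner F p (B p (?b j)) (\<lambda>v. rscl F (-1) (?d i j v))"
      by (intro arg_cong[where f = uminus] u_inner_cong) (simp_all add: m)
    also have "\<dots> = u_inner F p (?d i j) (B p (?b j))"
      using u_inner_rscl_right[OF df Bf, where r = "-1"] u_inner_sym[OF df Bf] by simp
    finally show "u_inner F p (?c i j) (?w i j) = u_inner F p (?d i j) (B p (?b j))" .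
  qed
  also have "\<dots> = (\<Sum>j\<in>UNIV. \<Sum>i\<in>UNIV. u_inner F p (?d i j) (B p (?b j)))"
    by (rule sum.swap)
  also have "\<dots> = (\<Sum>j\<in>UNIV. u_inner F p (B p (?b j)) (dagger M F A \<omega> p (?b j)))"
  proof (intro sum.cong refl)
    fix j
    have "(\<Sum>i\<in>UNIV. u_inner F p (?d i j) (B p (?b j))) = u_inner F p (\<lambda>v. \<Sum>i\<in>UNIV. ?d i j v) (B p (?b j))"
      by (rule u_inner_sum_left[OF finite df Bf, symmetric])
    also have "\<dots> = u_inner F p (dagger M F A \<omega> p (?b j)) (B p (?b j))"
      by (rule u_inner_cong) (simp_all add: dagger_eq[OF A \<omega> some_frame_in _ some_frame])
    also have "\<dots> = u_inner F p (B p (?b j)) (dagger M F A \<omega> p (?b j))"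
      by (rule u_inner_sym[OF u_forms1_fibre[OF dagger_in[OF A \<omega>] some_frame_in] Bf])
    finally show "(\<Sum>i\<in>UNIV. u_inner F p (?d i j) (B p (?b j))) = u_inner F p (B p (?b j)) (dagger M F A \<omega> p (?b j))" .
  qed
  finally show ?thesis unfolding pair1_eq .
qed

end

section \<open>Integration against the volume form\<close>

context riemannian
begin

text \<open>The inverse chart maps a closed ball to a compact set, closed because the manifold is
  Hausdorff. It contains the closure of the preimage of the open ball, which therefore stays in the
  chart domain.\<close>

lemma chart_neighbourhood:
  assumes c: "c \<in> charts M" "p \<in> fst c"
  obtains V where "open V" "p \<in> V" "closure V \<subseteq> fst c"
proof -
  let ?O = "snd c ` fst c" and ?g = "chart_inv c"
  obtain e where e: "e > 0" "cball (snd c p) e \<subseteq> ?O"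
    using chart_image_open'[OF c(1)] c(2) by (metis imageI open_contains_cball)
  have hom: "homeomorphism (fst c) ?O (snd c) ?g" by (rule chart_homeo[OF c(1)])
  then have g: "continuous_on ?O ?g" "?g ` ?O = fst c" by (auto simp: homeomorphism_def)
  have "compact (?g ` cball (snd c p) e)"
    using g(1) e(2) by (intro compact_continuous_image continuous_on_subset[OF g(1)]) auto
  then have cl: "closed (?g ` cball (snd c p) e)" by (rule compact_imp_closed)
  let ?V = "fst c \<inter> snd c -` ball (snd c p) e"
  have "open ?V"
    using hom chart_open[OF c(1)] by (intro continuous_open_preimage) (auto simp: homeomorphism_def)
  moreover have "p \<in> ?V" using c e by simp
  moreover have "?V \<subseteq> ?g ` cball (snd c p) e"
  proof
    fix q assume "q \<in> ?V"
    then have "?g (snd c q) = q" "snd c q \<in> cball (snd c p) e" using chart_inv[OF c(1)] by auto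
    then show "q \<in> ?g ` cball (snd c p) e" by (metis imageI)
  qed
  then have "closure ?V \<subseteq> ?g ` cball (snd c p) e" by (rule closure_minimal[OF _ cl])
  then have "closure ?V \<subseteq> fst c" using e(2) g(2) by blast
  ultimately show thesis by (rule that)
qed

text \<open>Compactness selects finitely many neighbourhoods whose closures lie in charts. Without
  such data the choice inside \<open>vol_integral\<close> would be arbitrary.\<close>

lemma subordinate_ex:
  assumes "compact (UNIV :: 'm set)"
  shows "\<exists>d. subordinate M d"
proof -
  have "\<forall>p. \<exists>c V. c \<in> charts M \<and> open V \<and> p \<in> V \<and> closure V \<subseteq> fst c"
  proof
    fix p
    obtain c where c: "c \<in> charts M" "p \<in> fst c" by (rule chart_cover)
    obtain V where "open V" "p \<in> V" "closure V \<subseteq> fst c" by (rule chart_neighbourhood[OF c])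
    with c show "\<exists>c V. c \<in> charts M \<and> open V \<and> p \<in> V \<and> closure V \<subseteq> fst c" by blast
  qed
  from choice[OF this] obtain c where "\<forall>p. \<exists>V. c p \<in> charts M \<and> open V \<and> p \<in> V \<and> closure V \<subseteq> fst (c p)"
    by (elim exE)
  from choice[OF this] obtain V where V: "\<forall>p. c p \<in> charts M \<and> open (V p) \<and> p \<in> V p \<and> closure (V p) \<subseteq> fst (c p)"
    by (elim exE)
  have cV: "c p \<in> charts M" "open (V p)" "p \<in> V p" "closure (V p) \<subseteq> fst (c p)" for p
    using V by auto
  obtain P where P: "finite P" "UNIV \<subseteq> (\<Union>p\<in>P. V p)"
  proof (rule compactE_image[OF assms, of UNIV V])
    show "UNIV \<subseteq> (\<Union>p\<in>UNIV. V p)" using cV(3) by auto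
  qed (auto simp: cV(2))
  obtain h where h: "bij_betw h {0..<card P} P"
    using ex_bij_betw_nat_finite[OF P(1)] by blast
  let ?m = "card P"
  \<comment> \<open>Removing the earlier open sets makes the pieces disjoint; they stay Borel, and
    their closures only shrink.\<close>
  let ?A = "\<lambda>k. V (h k) - (\<Union>j<k. V (h j))"
  have "subordinate M (?m, \<lambda>k. c (h k), ?A)"
    unfolding subordinate_def prod.case
  proof (intro conjI allI impI)
    fix k
    show "c (h k) \<in> charts M" by (rule cV(1))
    show "?A k \<in> sets borel" using cV(2) by (intro sets.Diff borel_open open_UN) auto
    have "closure (?A k) \<subseteq> closure (V (h k))" by (rule closure_mono) blast
    then show "closure (?A k) \<subseteq> fst (c (h k))" using cV(4) by blast
  next
    show "disjoint_family_on ?A {..<?m}"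
      unfolding disjoint_family_on_def
    proof (intro ballI impI)
      fix i j :: nat assume "i \<noteq> j"
      then consider "i < j" | "j < i" by linarith
      then show "?A i \<inter> ?A j = {}" by cases blast+
    qed
    show "(\<Union>k<?m. ?A k) = UNIV"
    proof (intro set_eqI iffI UNIV_I)
      fix q
      obtain p where "p \<in> P" "q \<in> V p" using P(2) by blast
      then obtain k where k: "k < ?m" "q \<in> V (h k)"
        using bij_betw_imp_surj_on[OF h] by force
      \<comment> \<open>A point belongs to the piece of the first neighbourhood that contains
        it.\<close>
      define k0 where "k0 = (LEAST k. q \<in> V (h k))"
      have "q \<in> V (h k0)" unfolding k0_def using k(2) by (rule LeastI)
      moreover have "k0 \<le> k" unfolding k0_def using k(2) by (rule Least_le)
      moreover have "q \<notin> V (h j)" if "j < k0" for j using that not_less_Least unfolding k0_def by blast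
      ultimately show "q \<in> (\<Union>k<?m. ?A k)" using k(1) by (intro UN_I[of k0]) auto
    qed
  qed
  then show ?thesis by blast
qed

text \<open>All integrals use the same choice, so that its independence of the pieces is not needed.\<close>

definition piece_count :: nat where "piece_count = fst (SOME d. subordinate M d)"
definition piece_chart :: "nat \<Rightarrow> 'm set \<times> ('m \<Rightarrow> real ^ 'n)" where
  "piece_chart = fst (snd (SOME d. subordinate M d))"
definition piece :: "nat \<Rightarrow> 'm set" where "piece = snd (snd (SOME d. subordinate M d))"

definition piece_integrand :: "nat \<Rightarrow> ('m \<Rightarrow> real) \<Rightarrow> real ^ 'n \<Rightarrow> real" where
  "piece_integrand k f x = f (chart_inv (piece_chart k) x) * sqrt (det (gram M (piece_chart k) (chart_inv (piece_chart k) x)))"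

lemma vol_integral_eq:
  "vol_integral M f = (\<Sum>k<piece_count.
     set_lebesgue_integral lborel (snd (piece_chart k) ` piece k) (piece_integrand k f))"
  unfolding vol_integral_def piece_count_def piece_chart_def piece_def piece_integrand_def
  by (simp add: case_prod_unfold Let_def)

end

section \<open>Integrability, linearity and definiteness of the integral\<close>

locale compact_riemannian = riemannian M for M :: "('m::t2_space, 'n::finite) rmfd" +
  assumes compact_M: "compact (UNIV :: 'm set)"
begin

lemma subordinate_pieces: "subordinate M (piece_count, piece_chart, piece)"
  using someI_ex[OF subordinate_ex[OF compact_M]]
  by (simp add: piece_count_def piece_chart_def piece_def)

lemma pieces:
  assumes "k < piece_count"
  shows "piece_chart k \<in> charts M" "piece k \<in> sets borel" "closure (piece k) \<subseteq> fst (piece_chart k)"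
  using subordinate_pieces assms unfolding subordinate_def by auto

lemma pieces_cover: "p \<in> (\<Union>k<piece_count. piece k)"
  using subordinate_pieces unfolding subordinate_def by auto

text \<open>Continuous images of Borel sets need not be Borel, so the image is rewritten as a
  preimage under the continuous inverse chart, which lives on an open set.\<close>

lemma piece_image_borel:
  assumes k: "k < piece_count"
  shows "snd (piece_chart k) ` piece k \<in> sets lborel"
proof -
  let ?c = "piece_chart k"
  let ?O = "snd ?c ` fst ?c" and ?g = "chart_inv ?c"
  note c = pieces(1)[OF k]
  have sub: "piece k \<subseteq> fst ?c" using pieces(3)[OF k] closure_subset by blast
  have g: "continuous_on ?O ?g" using chart_homeo[OF c] by (simp add: homeomorphism_def)
  have O: "?O \<in> sets borel" using chart_image_open'[OF c] by (rule borel_open)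
  have "?g -` piece k \<inter> space (restrict_space borel ?O) \<in> sets (restrict_space borel ?O)"
    by (rule measurable_sets[OF borel_measurable_continuous_on_restrict[OF g] pieces(2)[OF k]])
  then have "?g -` piece k \<inter> ?O \<in> sets borel"
    using O by (simp add: space_restrict_space sets_restrict_space_iff)
  moreover have "?g -` piece k \<inter> ?O = snd ?c ` piece k"
  proof (intro set_eqI iffI)
    fix x assume "x \<in> ?g -` piece k \<inter> ?O"
    then obtain q where "q \<in> fst ?c" "x = snd ?c q" "?g x \<in> piece k" by blast
    then show "x \<in> snd ?c ` piece k" using chart_inv[OF c] by (metis imageI)
  next
    fix x assume "x \<in> snd ?c ` piece k"
    then obtain q where q: "q \<in> piece k" "x = snd ?c q" by blast
    then have "q \<in> fst ?c" using sub by blast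
    then show "x \<in> ?g -` piece k \<inter> ?O" using q chart_inv[OF c] by simp
  qed
  ultimately show ?thesis by simp
qed

text \<open>The closure of a piece is compact and contained in its chart, so the integrand is
  continuous on a compact set containing the image of the piece.\<close>

lemma piece_integrable:
  assumes k: "k < piece_count" and f: "continuous_on UNIV f"
  shows "set_integrable lborel (snd (piece_chart k) ` piece k) (piece_integrand k f)"
proof -
  let ?c = "piece_chart k"
  let ?O = "snd ?c ` fst ?c" and ?g = "chart_inv ?c" and ?K = "snd ?c ` closure (piece k)"
  note c = pieces(1)[OF k] and sub = pieces(3)[OF k]
  have hom: "homeomorphism (fst ?c) ?O (snd ?c) ?g" by (rule chart_homeo[OF c])
  have "compact (closure (piece k))"
    using compact_Int_closed[OF compact_M closed_closure, of "piece k"] by simp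
  then have K: "compact ?K"
    using hom sub by (intro compact_continuous_image) (auto simp: homeomorphism_def intro: continuous_on_subset)
  have KO: "?K \<subseteq> ?O" using sub by blast
  have g: "continuous_on ?O ?g" "?g ` ?O = fst ?c" using hom by (auto simp: homeomorphism_def)
  have "continuous_on (fst ?c) (\<lambda>p. f p * sqrt (det (gram M ?c p)))"
    by (intro continuous_on_mult continuous_on_real_sqrt continuous_on_subset[OF f]
        smooth_fun_imp_continuous_on[OF chart_open[OF c]] det_smooth chart_open[OF c] gram_smooth[OF c]) auto
  then have "continuous_on ?O ((\<lambda>p. f p * sqrt (det (gram M ?c p))) \<circ> ?g)"
    using g by (intro continuous_on_compose) auto
  then have "continuous_on ?K (piece_integrand k f)"
    using continuous_on_subset[OF _ KO] by (simp add: piece_integrand_def[abs_def] o_def)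
  then have "set_integrable lborel ?K (piece_integrand k f)"
    using borel_integrable_compact[OF K] unfolding set_integrable_def by blast
  then show ?thesis
    by (rule set_integrable_subset[OF _ piece_image_borel[OF k]]) (use closure_subset in blast)
qed

lemma vol_integral_add:
  assumes "continuous_on UNIV f" "continuous_on UNIV g"
  shows "vol_integral M (\<lambda>p. f p + g p) = vol_integral M f + vol_integral M g"
proof -
  have "piece_integrand k (\<lambda>p. f p + g p) = (\<lambda>x. piece_integrand k f x + piece_integrand k g x)" for k
    by (simp add: piece_integrand_def fun_eq_iff distrib_right)
  then show ?thesis
    unfolding vol_integral_eq sum.distrib[symmetric]
    by (intro sum.cong refl) (simp add: set_integral_add(2)[OF piece_integrable piece_integrable] assms)
qed

lemma vol_integral_mult: "vol_integral M (\<lambda>p. r * f p) = r * vol_integral M f"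
proof -
  have "piece_integrand k (\<lambda>p. r * f p) = (\<lambda>x. r * piece_integrand k f x)" for k
    by (simp add: piece_integrand_def fun_eq_iff)
  then show ?thesis unfolding vol_integral_eq by (simp add: sum_distrib_left)
qed

lemma vol_integral_zero: "vol_integral M (\<lambda>p. 0) = 0"
  using vol_integral_mult[of 0] by simp

text \<open>Where \<open>f\<close> is positive, every piece is null in its own chart; transported to one chart this would
  make a nonempty open set null.\<close>

lemma vol_integral_eq_0_imp:
  assumes f: "continuous_on UNIV f" and nn: "\<And>p. f p \<ge> 0" and z: "vol_integral M f = 0"
  shows "f p = 0"
proof (rule ccontr)
  assume "f p \<noteq> 0"
  let ?I = "\<lambda>k. snd (piece_chart k) ` piece k"
  have sub: "piece k \<subseteq> fst (piece_chart k)" if "k < piece_count" for k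
    using pieces(3)[OF that] closure_subset by blast
  \<comment> \<open>With \<open>f\<close> nonnegative and a positive Gram determinant every local
    integral is nonnegative, so a zero total makes each of them zero.\<close>
  have pos: "indicat_real (?I k) x *\<^sub>R piece_integrand k f x \<ge> 0" if k: "k < piece_count" for k x
  proof (cases "x \<in> ?I k")
    case True
    then obtain q where q: "q \<in> piece k" "x = snd (piece_chart k) q" by blast
    then have "det (gram M (piece_chart k) q) > 0"
      using det_gram_pos[OF pieces(1)[OF k]] sub[OF k] by blast
    then show ?thesis
      using q sub[OF k] chart_inv[OF pieces(1)[OF k]] nn
      by (auto simp: piece_integrand_def indicator_def subset_iff intro!: mult_nonneg_nonneg)
  qed simp
  have "\<forall>k\<in>{..<piece_count}. set_lebesgue_integral lborel (?I k) (piece_integrand k f) = 0"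
    using z unfolding vol_integral_eq
  proof (subst (asm) sum_nonneg_eq_0_iff)
    show "set_lebesgue_integral lborel (?I k) (piece_integrand k f) \<ge> 0" if "k \<in> {..<piece_count}" for k
      unfolding set_lebesgue_integral_def by (rule integral_nonneg_AE, rule AE_I2, rule pos) (use that in simp)
  qed auto
  then have ae: "AE x in lborel. indicat_real (?I k) x *\<^sub>R piece_integrand k f x = 0" if "k < piece_count" for k
    using that piece_integrable[OF that f] pos[OF that]
    unfolding set_lebesgue_integral_def set_integrable_def
    by (subst integral_nonneg_eq_0_iff_AE[symmetric]) auto
  let ?U = "{q. f q > 0}"
  have U: "open ?U"
    by (rule open_Collect_less[OF continuous_on_const f])
  have null: "negligible (snd (piece_chart k) ` (piece k \<inter> ?U))" if k: "k < piece_count" for k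
  proof -
    obtain N where N: "{x \<in> space lborel. \<not> indicat_real (?I k) x *\<^sub>R piece_integrand k f x = 0} \<subseteq> N"
      "emeasure lborel N = 0" "N \<in> sets lborel"
      by (rule AE_E[OF ae[OF k]])
    \<comment> \<open>The density is strictly positive on the chart, so the integrand is nonzero
      wherever \<open>f\<close> is positive and such points lie in the exceptional null set.\<close>
    have "snd (piece_chart k) ` (piece k \<inter> ?U) \<subseteq> N"
    proof
      fix x assume "x \<in> snd (piece_chart k) ` (piece k \<inter> ?U)"
      then obtain q where q: "q \<in> piece k" "f q > 0" "x = snd (piece_chart k) q" by blast
      have qc: "q \<in> fst (piece_chart k)" using q(1) sub[OF k] by blast
      have "piece_integrand k f x \<noteq> 0"
        using q det_gram_pos[OF pieces(1)[OF k] qc] chart_inv[OF pieces(1)[OF k] qc]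
        by (simp add: piece_integrand_def)
      then show "x \<in> N" using N(1) q by (auto simp: indicator_def)
    qed
    moreover have "negligible N"
      using N(2,3) by (simp add: negligible_iff_null_sets null_sets_completionI null_setsI)
    ultimately show ?thesis by (rule negligible_subset[rotated])
  qed
  obtain c where c: "c \<in> charts M" "p \<in> fst c" by (rule chart_cover)
  \<comment> \<open>The null sets live in different charts; transition maps bring them into the one
    chart \<open>c\<close> around \<open>p\<close>, where they can be united.\<close>
  let ?T = "\<lambda>k. (snd c \<circ> chart_inv (piece_chart k)) ` (snd (piece_chart k) ` (piece k \<inter> ?U \<inter> fst c))"
  \<comment> \<open>Differentiable maps preserve null sets when the target dimension is at least the
    source dimension; here both are equal, whence \<open>order_refl\<close>.\<close>
  have negT: "negligible (?T k)" if k: "k < piece_count" for k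
  proof (rule negligible_differentiable_image_negligible[OF order_refl])
    show "negligible (snd (piece_chart k) ` (piece k \<inter> ?U \<inter> fst c))"
      by (rule negligible_subset[OF null[OF k]]) blast
    show "(snd c \<circ> chart_inv (piece_chart k)) differentiable_on snd (piece_chart k) ` (piece k \<inter> ?U \<inter> fst c)"
      unfolding differentiable_on_def
    proof
      fix x assume "x \<in> snd (piece_chart k) ` (piece k \<inter> ?U \<inter> fst c)"
      then have "x \<in> snd (piece_chart k) ` (fst (piece_chart k) \<inter> fst c)" using sub[OF k] by blast
      then have "(snd c \<circ> chart_inv (piece_chart k)) differentiable (at x)"
        by (rule smooth_on_imp_differentiable[OF chart_transition[OF pieces(1)[OF k] c(1)]])
      then show "(snd c \<circ> chart_inv (piece_chart k)) differentiable (at x within snd (piece_chart k) ` (piece k \<inter> ?U \<inter> fst c))"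
        by (rule differentiable_at_withinI)
    qed
  qed
  have "negligible (\<Union>k<piece_count. ?T k)"
    by (rule negligible_Union) (use negT in auto)
  moreover have "snd c ` (?U \<inter> fst c) \<subseteq> (\<Union>k<piece_count. ?T k)"
  proof
    fix x assume "x \<in> snd c ` (?U \<inter> fst c)"
    then obtain q where q: "f q > 0" "q \<in> fst c" "x = snd c q" by blast
    obtain k where k: "k < piece_count" "q \<in> piece k" using pieces_cover[of q] by blast
    have "x = (snd c \<circ> chart_inv (piece_chart k)) (snd (piece_chart k) q)"
      using q chart_inv[OF pieces(1)[OF k(1)]] sub[OF k(1)] k(2) by auto
    then show "x \<in> (\<Union>k<piece_count. ?T k)" using q k by blast
  qed
  ultimately have "negligible (snd c ` (?U \<inter> fst c))" by (rule negligible_subset)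
  moreover have "open (snd c ` (?U \<inter> fst c))" by (rule chart_image_open[OF c(1) U])
  moreover have "snd c ` (?U \<inter> fst c) \<noteq> {}" using c nn[of p] \<open>f p \<noteq> 0\<close> by (auto simp: less_le)
  ultimately show False using open_not_negligible by blast
qed

end

text \<open>The wedge square is quadratic, and its cross term is the polarisation
  \<open>wedge_bracket\<close>.\<close>

lemma (in hermitian_vb) wedge_self_linear:
  assumes A: "A \<in> u_forms1 M F" and B: "B \<in> u_forms1 M F"
  shows "wedge_self M F (A + scale_form1 F r B) =
    wedge_self M F A + (scale_form2 F r (wedge_bracket M F A B) + scale_form2 F (r ^ 2) (wedge_self M F B))"
proof (intro ext)
  fix p X Y v
  define C where "C = A + scale_form1 F r B"
  have C: "C \<in> u_forms1 M F" unfolding C_def by (intro u_forms1_plus u_forms1_scale_form1 A B)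
  have Cap: "C q Z u = A q Z u + rscl F r (B q Z u)" for q Z u
    by (simp add: C_def scale_form1_def)
  have "wedge_self M F C p X Y v = wedge_self M F A p X Y v +
      (rscl F r (wedge_bracket M F A B p X Y v) + rscl F (r ^ 2) (wedge_self M F B p X Y v))"
  proof (cases "X \<in> tspace M p \<and> Y \<in> tspace M p \<and> v \<in> fibre F p")
    case False
    then show ?thesis
      unfolding wedge_self_def wedge_bracket_def by (simp only: if_False vs.scale_zero_right add_0)
  next
    case True
    then have X: "X \<in> tspace M p" and Y: "Y \<in> tspace M p" and v: "v \<in> fibre F p" by auto
    note Af = u_forms1_fibre[OF A] and Bf = u_forms1_fibre[OF B]
    have "C p X (C p Y v) = A p X (A p Y v) + rscl F r (A p X (B p Y v) + B p X (A p Y v)) + rscl F (r ^ 2) (B p X (B p Y v))"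
      if X: "X \<in> tspace M p" and Y: "Y \<in> tspace M p" for X Y
      unfolding Cap
      by (simp add: u_fibre_add[OF Af[OF X]] u_fibre_add[OF Bf[OF X]] u_fibre_scl[OF Af[OF X]] u_fibre_scl[OF Bf[OF X]]
          u_fibre_in[OF Af[OF Y] v] u_fibre_in[OF Bf[OF Y] v] fib.S_scale vs.scale_right_distrib power2_eq_square add.assoc)
    then show ?thesis
      by (simp add: wedge_self_eq[OF C X Y v] wedge_self_eq[OF A X Y v] wedge_self_eq[OF B X Y v] wedge_bracket_eq[OF X Y v]
          X Y vs.scale_right_distrib vs.scale_right_diff_distrib)
  qed
  then show "wedge_self M F (A + scale_form1 F r B) p X Y v = (wedge_self M F A +
      (scale_form2 F r (wedge_bracket M F A B) + scale_form2 F (r ^ 2) (wedge_self M F B))) p X Y v"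
    unfolding C_def[symmetric] by (simp add: scale_form2_def)
qed

section \<open>First variation of the Yang-Mills functional\<close>

locale compact_hermitian_vb = hermitian_vb M F + compact_riemannian M
  for M :: "('m::t2_space, 'n::finite) rmfd" and F :: "('m, 'v::ab_group_add) hbundle"
begin

text \<open>Pointwise additivity passes to the integrals because continuity of the pairings provides
  integrability.\<close>

lemma inner_form2_add:
  assumes "\<alpha> \<in> u_forms2 M F" "\<beta> \<in> u_forms2 M F" "\<gamma> \<in> u_forms2 M F"
  shows "inner_form2 M F (\<alpha> + \<beta>) \<gamma> = inner_form2 M F \<alpha> \<gamma> + inner_form2 M F \<beta> \<gamma>"
proof -
  have "pair2 M F (\<alpha> + \<beta>) \<gamma> = (\<lambda>p. pair2 M F \<alpha> \<gamma> p + pair2 M F \<beta> \<gamma> p)"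
    by (rule ext) (rule pair2_add[OF assms])
  then show ?thesis
    unfolding inner_form2_eq using vol_integral_add[OF pair2_continuous pair2_continuous] assms by simp
qed

lemma inner_form2_scale:
  assumes "\<alpha> \<in> u_forms2 M F" "\<gamma> \<in> u_forms2 M F"
  shows "inner_form2 M F (scale_form2 F r \<alpha>) \<gamma> = r * inner_form2 M F \<alpha> \<gamma>"
proof -
  have "pair2 M F (scale_form2 F r \<alpha>) \<gamma> = (\<lambda>p. r * pair2 M F \<alpha> \<gamma> p)"
    by (rule ext) (rule pair2_scale[OF assms])
  then show ?thesis unfolding inner_form2_eq by (simp add: vol_integral_mult)
qed

lemma inner_form2_sym:
  assumes "\<alpha> \<in> u_forms2 M F" "\<gamma> \<in> u_forms2 M F"
  shows "inner_form2 M F \<alpha> \<gamma> = inner_form2 M F \<gamma> \<alpha>"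
proof -
  have "pair2 M F \<alpha> \<gamma> = pair2 M F \<gamma> \<alpha>"
    by (rule ext) (rule pair2_sym[OF assms])
  then show ?thesis unfolding inner_form2_eq by simp
qed

lemma inner_form1_add_right:
  assumes "\<alpha> \<in> u_forms1 M F" "\<beta> \<in> u_forms1 M F" "\<gamma> \<in> u_forms1 M F"
  shows "inner_form1 M F \<gamma> (\<alpha> + \<beta>) = inner_form1 M F \<gamma> \<alpha> + inner_form1 M F \<gamma> \<beta>"
proof -
  have "pair1 M F \<gamma> (\<alpha> + \<beta>) = (\<lambda>p. pair1 M F \<gamma> \<alpha> p + pair1 M F \<gamma> \<beta> p)"
    by (rule ext) (rule pair1_add_right[OF assms])
  then show ?thesis
    unfolding inner_form1_eq using vol_integral_add[OF pair1_continuous pair1_continuous] assms by simp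
qed

text \<open>The pairing of a form with itself is continuous and nonnegative, so a zero integral
  makes it vanish at every point; \<open>pair1_self\<close> concludes fibrewise.\<close>

lemma inner_form1_self_eq_0:
  assumes A: "\<alpha> \<in> u_forms1 M F" and z: "inner_form1 M F \<alpha> \<alpha> = 0"
  shows "\<alpha> = 0"
proof
  fix p
  have "pair1 M F \<alpha> \<alpha> p = 0"
    using vol_integral_eq_0_imp[OF pair1_continuous[OF A A] pair1_self(1)[OF A]] z
    unfolding inner_form1_eq by blast
  from pair1_self(2)[OF A this] show "\<alpha> p = 0 p" by simp
qed

lemma inner_form1_zero_right:
  assumes B: "\<beta> \<in> u_forms1 M F"
  shows "inner_form1 M F \<beta> 0 = 0"
proof -
  have "u_inner F p b 0 = 0" if "b \<in> u_fibre F p" for p b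
    using u_inner_zero_left[OF that] u_inner_sym[OF that u_fibre_zero_in] by simp
  then have "pair1 M F \<beta> 0 = (\<lambda>p. 0)"
    unfolding pair1_eq[abs_def] using u_forms1_fibre[OF B some_frame_in] by simp
  then show ?thesis unfolding inner_form1_eq by (simp add: vol_integral_zero)
qed

lemma inner_form2_bracket:
  assumes "A \<in> u_forms1 M F" "B \<in> u_forms1 M F" "\<omega> \<in> u_forms2 M F"
  shows "inner_form2 M F (wedge_bracket M F A B) \<omega> = inner_form1 M F B (dagger M F A \<omega>)"
proof -
  have "pair2 M F (wedge_bracket M F A B) \<omega> = pair1 M F B (dagger M F A \<omega>)"
    by (rule ext) (rule pair_bracket_dagger[OF assms])
  then show ?thesis unfolding inner_form1_eq inner_form2_eq by simp
qed

text \<open>The square of a quadratic curve of forms is a polynomial of degree four in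
  \<open>e\<close>. Its linear coefficient is the pairing of \<open>L\<close> with \<open>K\<close>
  counted twice by symmetry.\<close>

lemma inner_form2_variation:
  assumes K: "K \<in> u_forms2 M F" and L: "L \<in> u_forms2 M F" and Q: "Q \<in> u_forms2 M F"
  defines "k \<equiv> \<lambda>e. K + (scale_form2 F e L + scale_form2 F (e ^ 2) Q)"
  shows "((\<lambda>e. inner_form2 M F (k e) (k e)) has_real_derivative 2 * inner_form2 M F L K) (at 0)"
proof -
  let ?i = "inner_form2 M F"
  have sL: "scale_form2 F e L \<in> u_forms2 M F" and sQ: "scale_form2 F e Q \<in> u_forms2 M F" for e
    by (rule u_forms2_scale_form2[OF L] u_forms2_scale_form2[OF Q])+
  have LQ: "scale_form2 F e L + scale_form2 F (e ^ 2) Q \<in> u_forms2 M F" for e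
    by (rule u_forms2_plus[OF sL sQ])
  have kf: "k e \<in> u_forms2 M F" for e unfolding k_def by (rule u_forms2_plus[OF K LQ])
  have left: "?i (k e) \<gamma> = ?i K \<gamma> + (e * ?i L \<gamma> + e ^ 2 * ?i Q \<gamma>)" if "\<gamma> \<in> u_forms2 M F" for e \<gamma>
    unfolding k_def inner_form2_add[OF K LQ that] inner_form2_add[OF sL sQ that]
      inner_form2_scale[OF L that] inner_form2_scale[OF Q that] ..
  have right: "?i \<gamma> (k e) = ?i \<gamma> K + (e * ?i \<gamma> L + e ^ 2 * ?i \<gamma> Q)" if g: "\<gamma> \<in> u_forms2 M F" for e \<gamma>
    using left[OF g, of e] inner_form2_sym[OF g] kf K L Q by simp
  \<comment> \<open>The parameter leaves both slots before differentiation, so no differentiation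
    under the integral sign is required.\<close>
  have "?i (k e) (k e) = (?i K K + (e * ?i K L + e ^ 2 * ?i K Q)) +
      (e * (?i L K + (e * ?i L L + e ^ 2 * ?i L Q)) + e ^ 2 * (?i Q K + (e * ?i Q L + e ^ 2 * ?i Q Q)))" for e
    unfolding left[OF kf] right[OF K] right[OF L] right[OF Q] ..
  moreover have "?i K L = ?i L K" by (rule inner_form2_sym[OF K L])
  ultimately show ?thesis
    by (auto intro!: derivative_eq_intros)
qed

end

theorem theorem1:
  fixes M :: "('m::t2_space, 'n::finite) rmfd"
    and F :: "('m, 'v::ab_group_add) hbundle"
    and D :: "('m, 'v) connection"
    and E :: "('m, 'v) uform1"
    and \<delta> :: "('m, 'v) uform2 \<Rightarrow> ('m, 'v) uform1"
  assumes "compact (UNIV :: 'm set)" and "connected (UNIV :: 'm set)"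
    and "oriented_riemannian_manifold M"
    and "hermitian_bundle M F"
    and "hermitian_connection M F D"
    and "flat_connection M F D"
    and "E \<in> u_forms1 M F"
    and "formal_adjoint M F (nabla_u M F D) \<delta>"
  shows "yang_mills_connection M F (D + morphism_of E) \<longleftrightarrow>
    \<delta> (nabla_u M F D E) + \<delta> (wedge_self M F E)
      + dagger M F E (nabla_u M F D E) + dagger M F E (wedge_self M F E) = 0"
proof -
  interpret herm_connection M F D
    using assms by unfold_locales
  interpret compact_hermitian_vb M F
    using assms by unfold_locales
  note E = assms(7)
  let ?N = "nabla_u M F D E" and ?W = "wedge_self M F E"
  let ?G = "\<delta> ?N + \<delta> ?W + dagger M F E ?N + dagger M F E ?W"
  let ?L = "\<lambda>B. nabla_u M F D B + wedge_bracket M F E B"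
  note N = nabla_u_in[OF E] and W = wedge_self_in[OF E]
  have K: "?N + ?W \<in> u_forms2 M F" by (rule u_forms2_plus[OF N W])
  have L: "?L B \<in> u_forms2 M F" if "B \<in> u_forms1 M F" for B
    by (rule u_forms2_plus[OF nabla_u_in[OF that] wedge_bracket_in[OF E that]])
  note adj = assms(8)[unfolded formal_adjoint_def, THEN bspec]
  have dN: "\<delta> ?N \<in> u_forms1 M F" and dW: "\<delta> ?W \<in> u_forms1 M F"
    using adj[OF N] adj[OF W] by auto
  note gN = dagger_in[OF E N] and gW = dagger_in[OF E W]
  have G: "?G \<in> u_forms1 M F"
    by (intro u_forms1_plus dN dW gN gW)
  have LK: "inner_form2 M F (?L B) (?N + ?W) = inner_form1 M F B ?G" if B: "B \<in> u_forms1 M F" for B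
  proof -
    note nB = nabla_u_in[OF B] and wB = wedge_bracket_in[OF E B]
    \<comment> \<open>The second slot is split by symmetry so that \<open>?N\<close> and
      \<open>?W\<close> each meet their own \<delta> and \<open>dagger\<close>, matching the four
      summands of the equation.\<close>
    have right: "inner_form2 M F \<gamma> (?N + ?W) = inner_form2 M F \<gamma> ?N + inner_form2 M F \<gamma> ?W"
      if g: "\<gamma> \<in> u_forms2 M F" for \<gamma>
      using inner_form2_add[OF N W g] inner_form2_sym[OF g] N W K by simp
    have "inner_form2 M F (?L B) (?N + ?W) =
        inner_form2 M F (nabla_u M F D B) ?N + inner_form2 M F (nabla_u M F D B) ?W +
        (inner_form2 M F (wedge_bracket M F E B) ?N + inner_form2 M F (wedge_bracket M F E B) ?W)"
      unfolding inner_form2_add[OF nB wB K] right[OF nB] right[OF wB] ..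
    also have "\<dots> = inner_form1 M F B (\<delta> ?N) + inner_form1 M F B (\<delta> ?W) +
        (inner_form1 M F B (dagger M F E ?N) + inner_form1 M F B (dagger M F E ?W))"
      using adj[OF N] adj[OF W] B inner_form2_bracket[OF E B N] inner_form2_bracket[OF E B W] by simp
    also have "\<dots> = inner_form1 M F B ?G"
      unfolding inner_form1_add_right[OF u_forms1_plus[OF u_forms1_plus[OF dN dW] gN] gW B]
        inner_form1_add_right[OF u_forms1_plus[OF dN dW] gN B] inner_form1_add_right[OF dN dW B]
      by simp
    finally show ?thesis .
  qed
  have deriv: "((\<lambda>\<epsilon>. YM M F (D + morphism_of E + (\<lambda>\<sigma> p X. rscl F \<epsilon> (morphism_of B \<sigma> p X))))
      has_real_derivative 2 * inner_form1 M F B ?G) (at 0)" if B: "B \<in> u_forms1 M F" for B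
  proof -
    have "YM M F (D + morphism_of E + (\<lambda>\<sigma> p X. rscl F \<epsilon> (morphism_of B \<sigma> p X))) =
        inner_form2 M F ((?N + ?W) + (scale_form2 F \<epsilon> (?L B) + scale_form2 F (\<epsilon> ^ 2) (wedge_self M F B)))
          ((?N + ?W) + (scale_form2 F \<epsilon> (?L B) + scale_form2 F (\<epsilon> ^ 2) (wedge_self M F B)))" for \<epsilon>
    proof -
      \<comment> \<open>The varied connection is expanded around the flat \<open>D\<close> and not
        around \<open>D + morphism_of E\<close>: a single use of \<open>curvature_plus\<close> then
        suffices, the curvature of \<open>D\<close> drops out, and the operator that appears is the
        one to which \<delta> is adjoint.\<close>
      let ?A = "E + scale_form1 F \<epsilon> B"
      have A: "?A \<in> u_forms1 M F" by (intro u_forms1_plus u_forms1_scale_form1 E B)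
      have "D + morphism_of E + (\<lambda>\<sigma> p X. rscl F \<epsilon> (morphism_of B \<sigma> p X)) = D + morphism_of ?A"
        by (intro ext) (simp add: morphism_of_def scale_form1_def)
      moreover have "curvature M F (D + morphism_of ?A) =
          (?N + scale_form2 F \<epsilon> (nabla_u M F D B)) + wedge_self M F ?A"
        using curvature_plus[OF A] nabla_u_linear[OF E B] assms(6) by (simp add: flat_connection_def)
      moreover have "wedge_self M F ?A = ?W + (scale_form2 F \<epsilon> (wedge_bracket M F E B) + scale_form2 F (\<epsilon> ^ 2) (wedge_self M F B))"
        by (rule wedge_self_linear[OF E B])
      moreover have "scale_form2 F \<epsilon> (?L B) = scale_form2 F \<epsilon> (nabla_u M F D B) + scale_form2 F \<epsilon> (wedge_bracket M F E B)"
        by (intro ext) (simp add: scale_form2_def vs.scale_right_distrib)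
      ultimately show ?thesis unfolding YM_def by (simp only: ac_simps)
    qed
    then show ?thesis
      using inner_form2_variation[OF K L[OF B] wedge_self_in[OF B]] LK[OF B] by simp
  qed
  show ?thesis
  proof
    assume "yang_mills_connection M F (D + morphism_of E)"
    then have "((\<lambda>\<epsilon>. YM M F (D + morphism_of E + (\<lambda>\<sigma> p X. rscl F \<epsilon> (morphism_of ?G \<sigma> p X))))
        has_real_derivative 0) (at 0)"
      unfolding yang_mills_connection_def using G by blast
    then have "2 * inner_form1 M F ?G ?G = 0"
      by (rule DERIV_unique[OF deriv[OF G]])
    then have "inner_form1 M F ?G ?G = 0" by linarith
    then show "?G = 0" by (rule inner_form1_self_eq_0[OF G])
  next
    assume z: "?G = 0"
    show "yang_mills_connection M F (D + morphism_of E)"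
      unfolding yang_mills_connection_def
    proof (intro conjI ballI)
      show "hermitian_connection M F (D + morphism_of E)" by (rule hermitian_connection_plus[OF E])
      fix B assume B: "B \<in> u_forms1 M F"
      show "((\<lambda>\<epsilon>. YM M F (D + morphism_of E + (\<lambda>\<sigma> p X. rscl F \<epsilon> (morphism_of B \<sigma> p X))))
          has_real_derivative 0) (at 0)"
        using deriv[OF B] unfolding z by (simp add: inner_form1_zero_right[OF B])
    qed
  qed
qed

end
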